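(* Let $m\ge 2$ and let $\Gamma$ be a discrete subgroup of $\mathrm{SO}_+(m,1)$ acting on $\mathbb{H}_{\mathbb{R}}^m$ whose limit set is the whole sphere $\mathbb{S}^{m-1}$. Let $\Lambda\subset\mathbb{P}_{\mathbb{C}}^m$ be the Kulkarni limit set of $\iota(\Gamma)$ acting on $\mathbb{P}_{\mathbb{C}}^m$. Then $\Lambda$ is a (real) semi-algebraic set. Moreover, if $m>2$, then $\Lambda$ has non-empty interior in $\mathbb{P}_{\mathbb{C}}^m$.
   Context: $\mathbb{C}^{m,1}$ is $\mathbb{C}^{m+1}$ with the Hermitian form $\langle \mathbf{z},\mathbf{w}\rangle=z_1\overline{w_1}+\cdots+z_m\overline{w_m}-z_{m+1}\overline{w_{m+1}}$, and $\mathbb{P}_{\mathbb{C}}^m$ is its projectivization, with $[\mathbf z]$ the class of $\mathbf z\neq \mathbf 0$. $\mathbb{H}_{\mathbb{C}}^m=\{[\mathbf z]:\langle\mathbf z,\mathbf z\rangle<0\}$, $\partial\mathbb{H}_{\mathbb{C}}^m=\{[\mathbf z]:\langle\mathbf z,\mathbf z\rangle=0\}$, $\mathbb{P}_{\mathbb{R}}^m\subset\mathbb{P}_{\mathbb{C}}^m$ is the set of points having real homogeneous coordinates, $\mathbb{H}_{\mathbb{R}}^m=\mathbb{H}_{\mathbb{C}}^m\cap\mathbb{P}_{\mathbb{R}}^m$ and $\partial\mathbb{H}_{\mathbb{R}}^m=\partial\mathbb{H}_{\mathbb{C}}^m\cap\mathbb{P}_{\mathbb{R}}^m\cong\mathbb{S}^{m-1}$.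 $\mathrm{SO}_+(m,1)$ is the group of real $(m+1)\times(m+1)$ matrices giving the orientation preserving isometries of $\mathbb{H}_{\mathbb{R}}^m$; the limit set of a discrete subgroup $\Gamma$ is the set of accumulation points in $\mathbb{S}^{m-1}$ of an orbit $\Gamma\cdot \mathbf z$, $\mathbf z\in\mathbb{H}_{\mathbb{R}}^m$. Here $\iota:\mathrm{SO}_+(m,1)\to\mathrm{SU}(m,1)$ is the inclusion (a real matrix regarded as a complex matrix), and matrices act projectively on $\mathbb{P}_{\mathbb{C}}^m$. A subset of $\mathbb{P}_{\mathbb{C}}^m$ is called semi-algebraic if it consists of the points $[\mathbf z]$ whose homogeneous coordinates $z_j=x_j+iy_j$ satisfy a finite Boolean combination of real polynomial equations and inequalities in the $x_j,y_j$. Kulkarni limit set: for a discrete group $G$ acting on $X=\mathbb{P}_{\mathbb{C}}^m$, let $L_0$ be the closure of the set of points with infinite isotropy group, $L_1$ the closure of the set of cluster points of orbits $Gz$, $z\in X\setminus L_0$, and $L_2$ the closure of the set of cluster points of the families $\{gK\}_{g\in G}$, $K$ ranging over compact subsets of $X\setminus(L_0\cup L_1)$. The Kulkarni limit set is $\Lambda_{Kul}(G)=L_0\cup L_1\cup L_2$. By a known result of Cano, Liu and López, for the groups considered here $\Lambda_{Kul}(\iota(\Gamma))=\bigcup_{p\in\partial\mathbb{H}_{\mathbb{R}}^m}H_p$, where $H_p=\{[\mathbf w]\in\mathbb{P}_{\mathbb{C}}^m:\langle\mathbf p,\mathbf w\rangle=0\}$ is the complex projective hyperplane tangent to $\partial\mathbb{H}_{\mathbb{C}}^m$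 at $p=[\mathbf p]$. *)

theory Defs
  imports "HOL-Analysis.Analysis" "HOL-Algebra.Group"
begin

section \<open>Complex projective space\<close>

quotient_type 'n cproj = "complex ^ 'n::finite" /
    partial: "\<lambda>z w. z \<noteq> 0 \<and> w \<noteq> 0 \<and> (\<exists>c. c \<noteq> 0 \<and> w = c *s z)"
  morphisms rep_cproj hclass
proof (rule part_equivpI)
  show "\<exists>z::complex^'n. z \<noteq> 0 \<and> z \<noteq> 0 \<and> (\<exists>c. c \<noteq> 0 \<and> z = c *s z)"
    by (rule exI[of _ "1"]) (auto intro: exI[of _ 1])
  show "symp (\<lambda>z w::complex^'n. z \<noteq> 0 \<and> w \<noteq> 0 \<and> (\<exists>c. c \<noteq> 0 \<and> w = c *s z))"
  proof (rule sympI, safe)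
    fix z :: "complex^'n" and c :: complex
    assume "c \<noteq> 0"
    then show "\<exists>d. d \<noteq> 0 \<and> z = d *s (c *s z)"
      by (intro exI[of _ "inverse c"]) (simp add: vector_smult_assoc)
  qed
  show "transp (\<lambda>z w::complex^'n. z \<noteq> 0 \<and> w \<noteq> 0 \<and> (\<exists>c. c \<noteq> 0 \<and> w = c *s z))"
  proof (rule transpI, safe)
    fix z :: "complex^'n" and c d :: complex
    assume "c \<noteq> 0" "d \<noteq> 0"
    then show "\<exists>e. e \<noteq> 0 \<and> d *s (c *s z) = e *s z"
      by (intro exI[of _ "d * c"]) (simp add: vector_smult_assoc)
  qed
qed

text \<open>\<open>hclass z\<close> is the class \<open>[z]\<close>; it is meaningful only for \<open>z \<noteq> 0\<close>.\<close>

lemma hclass_eq_iff: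
  assumes "z \<noteq> 0" "w \<noteq> 0"
  shows "hclass z = hclass w \<longleftrightarrow> (\<exists>c. c \<noteq> 0 \<and> w = c *s z)"
  using Quotient3_rel[OF Quotient3_cproj, of z w] assms
  by (auto intro: exI[of _ 1])

lemma rep_cproj_nonzero: "rep_cproj p \<noteq> 0"
  using Quotient3_rep_reflp[OF Quotient3_cproj, of p] by auto

lemma hclass_rep_cproj: "hclass (rep_cproj p) = p"
  by (rule Quotient3_abs_rep[OF Quotient3_cproj])

text \<open>The quotient topology from \<open>\<complex>\<^sup>n - {0}\<close>.\<close>

instantiation cproj :: (finite) topological_space
begin

definition open_cproj :: "'a cproj set \<Rightarrow> bool"
  where "open_cproj U \<longleftrightarrow> open {z. z \<noteq> 0 \<and> hclass z \<in> U}"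

instance
proof
  have "{z::complex^'a. z \<noteq> 0 \<and> hclass z \<in> UNIV} = - {0}" by auto
  then show "open (UNIV :: 'a cproj set)"
    by (simp only: open_cproj_def open_Compl[OF closed_singleton])
next
  fix S T :: "'a cproj set"
  assume "open S" "open T"
  moreover have "{z. z \<noteq> 0 \<and> hclass z \<in> S \<inter> T}
      = {z. z \<noteq> 0 \<and> hclass z \<in> S} \<inter> {z. z \<noteq> 0 \<and> hclass z \<in> T}" by auto
  ultimately show "open (S \<inter> T)"
    by (simp only: open_cproj_def open_Int)
next
  fix K :: "'a cproj set set"
  assume "\<forall>S\<in>K. open S"
  moreover have "{z. z \<noteq> 0 \<and> hclass z \<in> \<Union>K} = (\<Union>S\<in>K. {z. z \<noteq> 0 \<and> hclass z \<in> S})" by auto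
  ultimately show "open (\<Union>K)"
    by (simp only: open_cproj_def) (auto intro: open_UN)
qed

end

text \<open>The projective action of (invertible) matrices, defined through a representative;
  \<open>proj_act_hclass\<close> shows that its choice does not matter.\<close>

definition proj_act :: "complex ^ 'n ^ 'n \<Rightarrow> 'n::finite cproj \<Rightarrow> 'n cproj"
  where "proj_act A p = hclass (A *v rep_cproj p)"

lemma proj_act_hclass:
  assumes A: "invertible A" and z: "z \<noteq> 0"
  shows "proj_act A (hclass z) = hclass (A *v z)"
proof -
  have inj: "A *v v \<noteq> 0" if "v \<noteq> 0" for v
    using A that by (metis invertible_left_inverse matrix_left_invertible_ker)
  obtain c where c: "c \<noteq> 0" "rep_cproj (hclass z) = c *s z"
    using hclass_eq_iff[OF z rep_cproj_nonzero[of "hclass z"]] by (auto simp: hclass_rep_cproj)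
  have "A *v rep_cproj (hclass z) = c *s (A *v z)"
    by (simp add: c vector_scalar_commute)
  then show ?thesis
    unfolding proj_act_def
    using hclass_eq_iff[OF inj[OF z] inj[OF rep_cproj_nonzero[of "hclass z"]]] c by metis
qed


section \<open>Real semi-algebraic subsets\<close>

text \<open>\<^const>\<open>real_polynomial_function\<close> is generated by the real-linear functionals, which on
  \<open>\<complex>\<^sup>n\<close> are the real combinations of the \<open>x\<^sub>j = Re z\<^sub>j\<close> and \<open>y\<^sub>j = Im z\<^sub>j\<close>; so these are exactly the
  real polynomials in the \<open>x\<^sub>j, y\<^sub>j\<close>.\<close>

inductive semialgebraic_condition :: "(complex ^ 'n::finite \<Rightarrow> bool) \<Rightarrow> bool" where
  eq: "real_polynomial_function f \<Longrightarrow> semialgebraic_condition (\<lambda>z. f z = 0)"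
| gt: "real_polynomial_function f \<Longrightarrow> semialgebraic_condition (\<lambda>z. f z > 0)"
| neg: "semialgebraic_condition P \<Longrightarrow> semialgebraic_condition (\<lambda>z. \<not> P z)"
| conj: "\<lbrakk>semialgebraic_condition P; semialgebraic_condition Q\<rbrakk>
    \<Longrightarrow> semialgebraic_condition (\<lambda>z. P z \<and> Q z)"

definition semialgebraic :: "'n::finite cproj set \<Rightarrow> bool"
  where "semialgebraic S \<longleftrightarrow>
    (\<exists>P. semialgebraic_condition P \<and> (\<forall>z. z \<noteq> 0 \<longrightarrow> (hclass z \<in> S \<longleftrightarrow> P z)))"


section \<open>The Kulkarni limit set\<close>

text \<open>Cluster points of the family \<open>{gK}\<close>, indexed by \<open>g \<in> G\<close>: every neighbourhood meets \<open>gK\<close> for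
  infinitely many \<open>g\<close>. The orbit of a point \<open>z\<close> is the case \<open>K = {z}\<close>.\<close>

definition cluster_points :: "(complex ^ 'n ^ 'n) set \<Rightarrow> 'n::finite cproj set \<Rightarrow> 'n cproj set"
  where "cluster_points G K =
    {x. \<forall>U. open U \<and> x \<in> U \<longrightarrow> infinite {g \<in> G. proj_act g ` K \<inter> U \<noteq> {}}}"

definition kulkarni_L0 :: "(complex ^ 'n ^ 'n) set \<Rightarrow> 'n::finite cproj set"
  where "kulkarni_L0 G = closure {x. infinite {g \<in> G. proj_act g x = x}}"

definition kulkarni_L1 :: "(complex ^ 'n ^ 'n) set \<Rightarrow> 'n::finite cproj set"
  where "kulkarni_L1 G = closure (\<Union>z \<in> - kulkarni_L0 G. cluster_points G {z})"

definition kulkarni_L2 :: "(complex ^ 'n ^ 'n) set \<Rightarrow> 'n::finite cproj set"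
  where "kulkarni_L2 G =
    closure (\<Union>K \<in> {K. compact K \<and> K \<subseteq> - (kulkarni_L0 G \<union> kulkarni_L1 G)}. cluster_points G K)"

definition kulkarni_limit_set :: "(complex ^ 'n ^ 'n) set \<Rightarrow> 'n::finite cproj set"
  where "kulkarni_limit_set G = kulkarni_L0 G \<union> kulkarni_L1 G \<union> kulkarni_L2 G"


section \<open>Hyperbolic spaces and the Lorentz group\<close>

text \<open>Coordinates of \<open>\<complex>\<^sup>m\<^sup>+\<^sup>1\<close> are indexed by \<^typ>\<open>'m option\<close> with \<^prop>\<open>CARD('m) = m\<close>; the index
  \<^const>\<open>None\<close> is the last, negative coordinate.\<close>

definition herm :: "complex ^ ('m::finite option) \<Rightarrow> complex ^ ('m option) \<Rightarrow> complex"
  where "herm z w = (\<Sum>i\<in>UNIV. z $ Some i * cnj (w $ Some i)) - z $ None * cnj (w $ None)"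

definition lorentz :: "real ^ ('m::finite option) \<Rightarrow> real ^ ('m option) \<Rightarrow> real"
  where "lorentz x y = (\<Sum>i\<in>UNIV. x $ Some i * y $ Some i) - x $ None * y $ None"

text \<open>\<^term>\<open>herm z z\<close> is always real.\<close>

definition HC :: "('m::finite option) cproj set"
  where "HC = {hclass z | z. z \<noteq> 0 \<and> Re (herm z z) < 0}"

definition bdry_HC :: "('m::finite option) cproj set"
  where "bdry_HC = {hclass z | z. z \<noteq> 0 \<and> herm z z = 0}"

definition PR :: "'n::finite cproj set"
  where "PR = {hclass z | z. z \<noteq> 0 \<and> (\<forall>i. z $ i \<in> \<real>)}"

definition HR :: "('m::finite option) cproj set"
  where "HR = HC \<inter> PR"

definition bdry_HR :: "('m::finite option) cproj set"
  where "bdry_HR = bdry_HC \<inter> PR"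

text \<open>The group \<open>SO\<^sub>+(m,1)\<close>: real matrices of determinant one that preserve the form and map the
  upper sheet of time-like vectors to itself.\<close>

definition SO_plus :: "(real ^ ('m::finite option) ^ ('m option)) monoid"
  where "SO_plus =
    \<lparr>carrier = {A. (\<forall>x y. lorentz (A *v x) (A *v y) = lorentz x y) \<and> det A = 1 \<and>
        (\<forall>x. lorentz x x < 0 \<and> x $ None > 0 \<longrightarrow> (A *v x) $ None > 0)},
     mult = (**), one = mat 1\<rparr>"

lemma lorentz_neg_None_nonzero:
  assumes "lorentz x x < 0"
  shows "x $ None \<noteq> 0"
proof
  assume "x $ None = 0"
  then have "lorentz x x = (\<Sum>i\<in>UNIV. x $ Some i * x $ Some i)"
    by (simp add: lorentz_def)
  also have "\<dots> \<ge> 0" by (intro sum_nonneg) simp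
  finally show False using assms by simp
qed

lemma group_SO_plus: "group (SO_plus :: (real ^ ('m::finite option) ^ ('m option)) monoid)"
proof (rule groupI)
  fix A B :: "real ^ ('m option) ^ ('m option)"
  assume "A \<in> carrier SO_plus" "B \<in> carrier SO_plus"
  then show "A \<otimes>\<^bsub>SO_plus\<^esub> B \<in> carrier SO_plus"
    by (auto simp: SO_plus_def det_mul matrix_vector_mul_assoc[symmetric])
next
  fix A :: "real ^ ('m option) ^ ('m option)"
  assume A: "A \<in> carrier SO_plus"
  then have "invertible A" by (auto simp: SO_plus_def invertible_det_nz)
  then obtain B where B: "A ** B = mat 1" "B ** A = mat 1"
    by (auto simp: invertible_def)
  have AB: "A *v (B *v x) = x" for x
    by (simp add: matrix_vector_mul_assoc B)
  have form: "lorentz (B *v x) (B *v y) = lorentz x y" for x y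
  proof -
    have "lorentz (A *v (B *v x)) (A *v (B *v y)) = lorentz (B *v x) (B *v y)"
      using A unfolding SO_plus_def by simp
    then show ?thesis by (simp only: AB)
  qed
  have "det A * det B = 1"
    using B(1) by (metis det_I det_mul)
  then have det: "det B = 1"
    using A by (simp add: SO_plus_def)
  have sheet: "(B *v x) $ None > 0" if x: "lorentz x x < 0" "x $ None > 0" for x
  proof (rule ccontr)
    let ?y = "- (B *v x)"
    assume "\<not> (B *v x) $ None > 0"
    moreover have "(B *v x) $ None \<noteq> 0"
      using lorentz_neg_None_nonzero[of "B *v x"] form x by simp
    ultimately have "?y $ None > 0" by simp
    moreover have "lorentz ?y ?y < 0"
      using form[of x x] x by (simp add: lorentz_def)
    ultimately have "(A *v ?y) $ None > 0"
      using A unfolding SO_plus_def by simp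
    moreover have "A *v ?y = - x"
      by (metis AB matrix_vector_mult_diff_distrib matrix_vector_mult_0_right diff_0)
    ultimately show False using x by simp
  qed
  show "\<exists>B\<in>carrier SO_plus. B \<otimes>\<^bsub>SO_plus\<^esub> A = \<one>\<^bsub>SO_plus\<^esub>"
    using B form det sheet by (intro bexI[of _ B]) (auto simp: SO_plus_def)
qed (auto simp: SO_plus_def matrix_mul_assoc)

abbreviation complexify :: "real ^ 'n ^ 'n \<Rightarrow> complex ^ 'n::finite ^ 'n"
  where "complexify \<equiv> map_matrix complex_of_real"

text \<open>The set of accumulation points on the sphere of the orbit of \<open>p\<close>. For a discrete group and
  \<open>p \<in> HR\<close> it does not depend on \<open>p\<close>.\<close>

definition limit_set_at ::
    "(real ^ ('m::finite option) ^ ('m option)) set \<Rightarrow> ('m option) cproj \<Rightarrow> ('m option) cproj set"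
  where "limit_set_at \<Gamma> p =
    {q \<in> bdry_HR. q islimpt {proj_act (complexify A) p | A. A \<in> \<Gamma>}}"

end

theory Submission
  imports Defs
begin

text \<open>
The theorem rests on the equality of the Kulkarni limit set with the union of the hyperplanes \<open>H\<^sub>p\<close>
tangent to the light cone at the real boundary points \<open>p\<close> (\<open>kulkarni_limit_set_eq\<close>).

Write \<open>z = x + iy\<close>. As \<open>p\<close> is real, \<open>[z]\<close> lies in \<open>H\<^sub>p\<close> exactly if \<open>p\<close> is orthogonal to both \<open>x\<close> and
\<open>y\<close>. So the union consists of the \<open>[z]\<close> such that the orthogonal complement of the real span of \<open>x\<close> and
\<open>y\<close> contains a null vector, and by counting signatures this depends only on the Gram matrix of \<open>x\<close> and
\<open>y\<close>: for \<open>m > 2\<close> the matrix has to be positive semidefinite, for \<open>m = 2\<close> also singular. With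
\<open>N = \<langle>z, z\<rangle>\<close> and the complex quadratic form \<open>Q = z\<^sub>1\<^sup>2 + \<dots> + z\<^sub>m\<^sup>2 - z\<^sub>m\<^sub>+\<^sub>1\<^sup>2\<close> these conditions read \<open>N \<ge> |Q|\<close>
and \<open>N = |Q|\<close> (\<open>tangent_iff_gap\<close>). Both are polynomial after squaring, and \<open>N > |Q|\<close> is open and
satisfiable.

The limit set lies in the union. Infinitely many elements of a discrete group diverge, and after
scaling they subconverge to a map \<open>x \<mapsto> - \<langle>q, x\<rangle> p\<close> with null vectors \<open>p\<close> and \<open>q\<close> (\<open>exists_attracts\<close>).
If \<open>g\<^sub>n z\<^sub>n\<close> tends to \<open>w\<close> projectively, then the invariance of \<open>\<langle>g\<^sub>n o, g\<^sub>n z\<^sub>n\<rangle>\<close> for a fixed timelike \<open>o\<close>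
forces \<open>w\<close> into \<open>H\<^sub>p\<close>, unless the limit of the \<open>z\<^sub>n\<close> is itself a real boundary point
(\<open>cluster_point_tangent\<close>). The real boundary lies in \<open>L\<^sub>1\<close> because the limit set of the group is
everything, so the compact sets that enter \<open>L\<^sub>2\<close> avoid it.

The union lies in the limit set. As the limit set of the group is everything, every \<open>p\<close> occurs as the
attracting direction of such a rank-one limit. Limits with different inner directions compose, and the
group fixes no null direction (\<open>no_full_attraction\<close>), so every pair \<open>(p, q)\<close> occurs. For \<open>p \<noteq> q\<close> Brouwer's
theorem finds a loxodromic element with fixed points near \<open>p\<close> and \<open>q\<close>. A loxodromic element acts on the
orthogonal complement of its two fixed vectors by an isometry of a definite form, which is recurrent;
hence its powers carry points near \<open>s + bq\<close> to points near \<open>s + ap\<close> for all \<open>s\<close> in that complement.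
So either \<open>[s + bq]\<close> lies in \<open>L\<^sub>0 \<union> L\<^sub>1\<close> or \<open>[s + ap]\<close> lies in \<open>L\<^sub>2\<close>, and by density one of the two
points lies in the limit set for arbitrary null \<open>p \<noteq> q\<close> (\<open>kulkarni_dichotomy\<close>). If \<open>N > |Q|\<close> and
\<open>m > 2\<close>, then \<open>z\<close> is orthogonal to two null vectors, and \<open>s = z\<close>, \<open>a = b = 0\<close> gives the claim. If
\<open>N = |Q|\<close>, the null vectors \<open>p\<close> and \<open>q\<close> are moved towards a single tangent point from opposite
sides in such a way that \<open>s + ap\<close> and \<open>s + bq\<close> both approach a multiple of \<open>z\<close>
(\<open>zero_gap_in_kulkarni\<close>).
\<close>

section \<open>The Lorentz form\<close>

definition space_part :: "real ^ ('m::finite option) \<Rightarrow> real ^ 'm"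
  where "space_part x = (\<chi> i. x $ Some i)"

definition origin :: "real ^ ('m::finite option)"
  where "origin = axis None 1"

text \<open>The sphere at infinity: each real null line has one representative with last coordinate one.\<close>

definition null_sphere :: "(real ^ ('m::finite option)) set"
  where "null_sphere = {u. u $ None = 1 \<and> lorentz u u = 0}"

lemma sum_option: "(\<Sum>i\<in>UNIV. f i) = f None + (\<Sum>i\<in>UNIV. f (Some i))"
  for f :: "'m::finite option \<Rightarrow> 'b::comm_monoid_add"
  unfolding UNIV_option_conv by (simp add: sum.reindex)

lemma lorentz_space_part: "lorentz x y = space_part x \<bullet> space_part y - x $ None * y $ None"
  by (simp add: lorentz_def space_part_def inner_vec_def)

lemma lorentz_self: "lorentz x x = (norm (space_part x))\<^sup>2 - (x $ None)\<^sup>2"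
  by (simp add: lorentz_space_part power2_norm_eq_inner) (simp add: power2_eq_square)

lemma inner_space_part: "x \<bullet> y = space_part x \<bullet> space_part y + x $ None * y $ None"
  by (simp add: space_part_def inner_vec_def sum_option)

lemma lorentz_inner: "lorentz x y = x \<bullet> y - 2 * (x $ None * y $ None)"
  by (simp add: lorentz_space_part inner_space_part)

lemma bounded_bilinear_lorentz:
  "bounded_bilinear (lorentz :: real ^ ('m::finite option) \<Rightarrow> _)"
proof -
  have eq: "lorentz = (\<lambda>x y :: real ^ ('m option). x \<bullet> (y - (2 * y $ None) *\<^sub>R origin))"
    by (simp add: fun_eq_iff lorentz_inner inner_diff_right origin_def inner_axis)
  have "bounded_linear (\<lambda>y :: real ^ ('m option). y - (2 * y $ None) *\<^sub>R origin)"
    by (intro bounded_linear_intros bounded_linear_vec_nth)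
  then show ?thesis
    unfolding eq by (rule bounded_bilinear.comp[OF bounded_bilinear_inner bounded_linear_ident])
qed

lemma lorentz_commute: "lorentz x y = lorentz y x"
  by (simp add: lorentz_space_part inner_commute)

lemma space_part_zero_iff: "x = 0 \<longleftrightarrow> space_part x = 0 \<and> x $ None = 0"
  unfolding vec_eq_iff space_part_def by (simp) (metis option.exhaust)

text \<open>Cauchy--Schwarz for the spatial parts: \<open>|t\<^sub>0 x\<^sub>0| \<le> |t| |x|\<close> while \<open>|t| < |t\<^sub>0|\<close>. The null case below is the
  same computation with equality in the second estimate.\<close>

lemma lorentz_orthogonal_timelike:
  assumes t: "lorentz t t < 0" and tx: "lorentz t x = 0" and x: "x \<noteq> 0"
  shows "lorentz x x > 0"
proof (rule ccontr)
  assume "\<not> lorentz x x > 0"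
  then have x2: "(norm (space_part x))\<^sup>2 \<le> (x $ None)\<^sup>2"
    by (simp add: lorentz_self)
  have t2: "(norm (space_part t))\<^sup>2 < (t $ None)\<^sup>2"
    using t by (simp add: lorentz_self)
  have "t $ None * x $ None = space_part t \<bullet> space_part x"
    using tx by (simp add: lorentz_space_part)
  then have "(t $ None * x $ None)\<^sup>2 \<le> (norm (space_part t) * norm (space_part x))\<^sup>2"
    by (metis Cauchy_Schwarz_ineq2 abs_le_square_iff abs_mult abs_norm_cancel)
  then have "(t $ None)\<^sup>2 * (x $ None)\<^sup>2 \<le> (norm (space_part t))\<^sup>2 * (norm (space_part x))\<^sup>2"
    by (simp add: power_mult_distrib)
  also have "\<dots> \<le> (norm (space_part t))\<^sup>2 * (x $ None)\<^sup>2"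
    using x2 by (simp add: mult_left_mono)
  finally have "x $ None = 0" using t2
    by (metis mult_le_cancel_right not_less zero_less_power2)
  then show False using x2 x by (simp add: space_part_zero_iff[of x])
qed

lemma lorentz_orthogonal_null:
  assumes u: "lorentz u u = 0" "u \<noteq> 0" and ux: "lorentz u x = 0"
  shows "lorentz x x \<ge> 0"
proof -
  have u2: "(norm (space_part u))\<^sup>2 = (u $ None)\<^sup>2"
    using u(1) by (simp add: lorentz_self)
  then have u0: "(u $ None)\<^sup>2 > 0"
    using u(2) by (auto simp: space_part_zero_iff[of u])
  have "u $ None * x $ None = space_part u \<bullet> space_part x"
    using ux by (simp add: lorentz_space_part)
  then have "(u $ None * x $ None)\<^sup>2 \<le> (norm (space_part u) * norm (space_part x))\<^sup>2"
    by (metis Cauchy_Schwarz_ineq2 abs_le_square_iff abs_mult abs_norm_cancel)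
  then have "(u $ None)\<^sup>2 * (x $ None)\<^sup>2 \<le> (u $ None)\<^sup>2 * (norm (space_part x))\<^sup>2"
    by (simp add: power_mult_distrib u2)
  then have "(x $ None)\<^sup>2 \<le> (norm (space_part x))\<^sup>2"
    using u0 by simp
  then show ?thesis
    by (simp add: lorentz_self)
qed

interpretation lorentz: bounded_bilinear "lorentz :: real ^ ('m::finite option) \<Rightarrow> _"
  by (rule bounded_bilinear_lorentz)

lemma lorentz_origin [simp]: "lorentz origin x = - (x $ None)" "lorentz x origin = - (x $ None)"
  by (simp_all add: lorentz_def origin_def axis_def)

lemma origin_None [simp]: "origin $ None = 1"
  by (simp add: origin_def)

lemma null_sphere_nonzero: "u \<in> null_sphere \<Longrightarrow> u \<noteq> 0"
  by (auto simp: null_sphere_def)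

lemma null_orthogonal_null_sphere:
  assumes u: "u \<in> null_sphere" and v: "lorentz v v = 0" and uv: "lorentz u v = 0"
  shows "v = (v $ None) *\<^sub>R u"
proof -
  define w where "w = v - (v $ None) *\<^sub>R u"
  have "w $ None = 0" using u by (simp add: w_def null_sphere_def)
  moreover have "lorentz w w = 0"
    using u v uv lorentz_commute[of u v]
    by (simp add: w_def null_sphere_def lorentz.diff_left lorentz.diff_right lorentz.scaleR_left lorentz.scaleR_right)
  ultimately have "w = 0"
    by (simp add: space_part_zero_iff[of w] lorentz_space_part)
  then show ?thesis by (simp add: w_def)
qed

lemma lorentz_null_sphere:
  assumes "p \<in> null_sphere" "q \<in> null_sphere"
  shows "lorentz p q = - (norm (p - q))\<^sup>2 / 2"
proof -
  have "(norm (p - q))\<^sup>2 = lorentz (p - q) (p - q)"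
    using assms by (simp add: lorentz_inner power2_norm_eq_inner null_sphere_def)
  also have "\<dots> = - 2 * lorentz p q"
    using assms lorentz_commute[of p q] by (simp add: null_sphere_def lorentz.diff_left lorentz.diff_right)
  finally show ?thesis by simp
qed

lemma lorentz_null_sphere_neg:
  assumes "p \<in> null_sphere" "q \<in> null_sphere" "p \<noteq> q"
  shows "lorentz p q < 0"
  using assms by (simp add: lorentz_null_sphere)

lemma null_sphere_eqI:
  assumes "p \<in> null_sphere" "q \<in> null_sphere" "q = c *\<^sub>R p"
  shows "q = p"
proof -
  have "c = 1" using assms by (auto simp: null_sphere_def)
  then show ?thesis using assms(3) by simp
qed

lemma null_sphere_normalize:
  assumes "lorentz v v = 0" "v \<noteq> 0"
  shows "v $ None \<noteq> 0" "(1 / v $ None) *\<^sub>R v \<in> null_sphere"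
proof -
  show "v $ None \<noteq> 0"
    using assms by (auto simp: space_part_zero_iff[of v] lorentz_space_part)
  then show "(1 / v $ None) *\<^sub>R v \<in> null_sphere"
    using assms by (simp add: null_sphere_def lorentz.scaleR_left lorentz.scaleR_right)
qed

text \<open>Flipping the last coordinate turns orthogonality for the form into Euclidean orthogonality, and at most
  \<open>m\<close> vectors do not span a space of dimension \<open>m + 1\<close>.\<close>

lemma exists_lorentz_orthogonal:
  fixes S :: "(real ^ ('m::finite option)) set"
  assumes "finite S" "card S \<le> CARD('m)"
  shows "\<exists>n. n \<noteq> 0 \<and> (\<forall>x\<in>S. lorentz x n = 0)"
proof -
  have "dim S \<le> card S" using assms(1) by (rule dim_le_card')
  also have "\<dots> < DIM(real ^ ('m option))" using assms(2) by simp
  finally obtain n where n: "n \<noteq> 0" "\<And>x. x \<in> span S \<Longrightarrow> orthogonal n x"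
    using orthogonal_to_subspace_exists[of S] by auto
  define n' where "n' = n - (2 * n $ None) *\<^sub>R origin"
  have "space_part n' = space_part n" "n' $ None = - n $ None"
    by (simp_all add: n'_def space_part_def origin_def vec_eq_iff axis_def)
  then have "lorentz x n' = x \<bullet> n" for x
    by (simp add: lorentz_space_part inner_space_part)
  moreover have "n' \<noteq> 0" using n(1) \<open>space_part n' = _\<close> \<open>n' $ None = _\<close>
    by (simp add: space_part_zero_iff[of n] space_part_zero_iff[of n'])
  ultimately show ?thesis
    using n(2) by (intro exI[of _ n']) (auto simp: orthogonal_def inner_commute span_base)
qed

text \<open>A timelike vector and an orthogonal spacelike one span a hyperbolic plane; after scaling \<open>n\<close> to the
  length of \<open>t\<close>, its null lines are spanned by \<open>t + n\<close> and \<open>t - n\<close>.\<close>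

lemma exists_two_null:
  assumes t: "lorentz t t < 0" and n: "n \<noteq> 0" "lorentz t n = 0"
  obtains p q where "p \<in> null_sphere" "q \<in> null_sphere" "p \<noteq> q"
    "p \<in> span {t, n}" "q \<in> span {t, n}"
proof -
  have nn: "lorentz n n > 0" by (rule lorentz_orthogonal_timelike[OF t n(2,1)])
  define k where "k = sqrt (- lorentz t t / lorentz n n)"
  have "- lorentz t t / lorentz n n > 0" using t nn by (intro divide_pos_pos) auto
  then have k: "k > 0" "k\<^sup>2 * lorentz n n = - lorentz t t"
    using nn by (simp_all add: k_def)
  define a b where "a = t + k *\<^sub>R n" and "b = t - k *\<^sub>R n"
  have nt: "lorentz n t = 0" using n(2) by (simp add: lorentz_commute)
  have ab: "lorentz a a = 0" "lorentz b b = 0" "lorentz a b = 2 * lorentz t t"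
    using k(2) n(2) nt unfolding a_def b_def
    by (simp_all add: lorentz.add_left lorentz.add_right lorentz.diff_left lorentz.diff_right lorentz.scaleR_left
        lorentz.scaleR_right power2_eq_square)
  have nz: "a \<noteq> 0" "b \<noteq> 0" using ab(3) t by (auto simp: lorentz.zero_left lorentz.zero_right)
  define p q where "p = (1 / a $ None) *\<^sub>R a" and "q = (1 / b $ None) *\<^sub>R b"
  have a0: "a $ None \<noteq> 0" "b $ None \<noteq> 0" using null_sphere_normalize(1) ab nz by blast+
  have pq: "p \<in> null_sphere" "q \<in> null_sphere"
    unfolding p_def q_def using null_sphere_normalize(2) ab nz by blast+
  have "lorentz p q \<noteq> 0" using ab(3) t a0 by (simp add: p_def q_def lorentz.scaleR_left lorentz.scaleR_right)
  then have "p \<noteq> q" using pq by (auto simp: null_sphere_def)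
  moreover have "a \<in> span {t, n}" "b \<in> span {t, n}"
    unfolding a_def b_def by (rule span_add span_diff; intro span_scale span_base; simp)+
  then have "p \<in> span {t, n}" "q \<in> span {t, n}" unfolding p_def q_def by (auto intro: span_scale)
  ultimately show thesis using pq that by blast
qed

section \<open>Lorentz matrices\<close>

definition coordinate_sign :: "'m option \<Rightarrow> real"
  where "coordinate_sign i = (case i of None \<Rightarrow> -1 | Some _ \<Rightarrow> 1)"

text \<open>The adjoint with respect to the form, hence the inverse of a matrix that preserves the form. As an
  explicit formula it is continuous.\<close>

definition lorentz_adjoint :: "real ^ ('m::finite option) ^ ('m option) \<Rightarrow> real ^ ('m option) ^ ('m option)"
  where "lorentz_adjoint A = (\<chi> i j. coordinate_sign i * coordinate_sign j * A $ j $ i)"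

text \<open>The rank-one operator \<open>x \<mapsto> - \<langle>q, x\<rangle> p\<close>.\<close>

definition null_projection ::
    "real ^ ('m::finite option) \<Rightarrow> real ^ ('m option) \<Rightarrow> real ^ ('m option) ^ ('m option)"
  where "null_projection p q = (\<chi> i j. - (p $ i * (coordinate_sign j * q $ j)))"

lemma coordinate_sign_cases: "coordinate_sign i = 1 \<or> coordinate_sign i = -1"
  by (cases i) (auto simp: coordinate_sign_def)

lemma coordinate_sign_square [simp]: "coordinate_sign i * coordinate_sign i = 1"
  "coordinate_sign i * (coordinate_sign i * x) = x"
  using coordinate_sign_cases[of i] by auto

lemma lorentz_sign: "lorentz x y = (\<Sum>i\<in>UNIV. coordinate_sign i * (x $ i * y $ i))"
  by (simp add: lorentz_def sum_option coordinate_sign_def)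

lemma lorentz_axis: "lorentz (axis i 1) y = coordinate_sign i * y $ i"
  "lorentz y (axis i 1) = coordinate_sign i * y $ i"
proof -
  show "lorentz (axis i 1) y = coordinate_sign i * y $ i"
    by (simp add: lorentz_sign axis_def if_distrib[of "\<lambda>c. c * _"] if_distrib[of "\<lambda>c. _ * c"] cong: if_cong)
  then show "lorentz y (axis i 1) = coordinate_sign i * y $ i"
    by (simp add: lorentz_commute)
qed

lemma lorentz_nondegenerate: "x = y" if "\<And>z. lorentz z x = lorentz z y"
proof -
  have "x $ i = y $ i" for i
    using that[of "axis i 1"] coordinate_sign_cases[of i] by (auto simp: lorentz_axis)
  then show ?thesis by (simp add: vec_eq_iff)
qed

lemma null_projection_mult: "null_projection p q *v x = - lorentz q x *\<^sub>R p"
  by (simp add: vec_eq_iff null_projection_def matrix_vector_mult_def lorentz_sign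
      sum_distrib_left sum_distrib_right sum_negf algebra_simps)

lemma lorentz_adjoint: "lorentz (A *v x) y = lorentz x (lorentz_adjoint A *v y)"
proof -
  have "lorentz (A *v x) y = (\<Sum>i\<in>UNIV. \<Sum>j\<in>UNIV. coordinate_sign i * (A $ i $ j * x $ j * y $ i))"
    by (simp add: lorentz_sign matrix_vector_mult_def sum_distrib_left sum_distrib_right mult.assoc)
  also have "\<dots> = (\<Sum>j\<in>UNIV. \<Sum>i\<in>UNIV. coordinate_sign i * (A $ i $ j * x $ j * y $ i))"
    by (rule sum.swap)
  also have "\<dots> = lorentz x (lorentz_adjoint A *v y)"
    by (simp add: lorentz_sign matrix_vector_mult_def lorentz_adjoint_def sum_distrib_left algebra_simps)
  finally show ?thesis .
qed

lemma lorentz_adjoint_adjoint [simp]: "lorentz_adjoint (lorentz_adjoint A) = A"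
  by (simp add: lorentz_adjoint_def vec_eq_iff mult_ac)

lemma lorentz_adjoint_None [simp]: "lorentz_adjoint A $ None $ None = A $ None $ None"
  by (simp add: lorentz_adjoint_def)

lemma lorentz_adjoint_null_projection: "lorentz_adjoint (null_projection p q) = null_projection q p"
  by (simp add: lorentz_adjoint_def null_projection_def vec_eq_iff mult_ac)

lemma tendsto_lorentz_adjoint:
  assumes "(f \<longlongrightarrow> A) F"
  shows "((\<lambda>n. lorentz_adjoint (f n)) \<longlongrightarrow> lorentz_adjoint A) F"
  unfolding lorentz_adjoint_def by (intro tendsto_intros assms)

lemma tendsto_matrix_mult:
  fixes f g :: "'a \<Rightarrow> real ^ 'n::finite ^ 'n"
  assumes "(f \<longlongrightarrow> A) F" "(g \<longlongrightarrow> B) F"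
  shows "((\<lambda>n. f n ** g n) \<longlongrightarrow> A ** B) F"
  unfolding matrix_matrix_mult_def by (intro tendsto_intros assms)

lemma tendsto_matrix_vector_mult:
  fixes f :: "'a \<Rightarrow> real ^ 'n::finite ^ 'n"
  assumes "(f \<longlongrightarrow> A) F" "(g \<longlongrightarrow> x) F"
  shows "((\<lambda>n. f n *v g n) \<longlongrightarrow> A *v x) F"
  unfolding matrix_vector_mult_def by (intro tendsto_intros assms)

lemma scaleR_matrix_vector_mult: "(c *\<^sub>R A) *v x = c *\<^sub>R (A *v x)"
  for A :: "real ^ 'n ^ 'm"
  by (simp add: vec_eq_iff matrix_vector_mult_def sum_distrib_left mult.assoc)

lemma scaleR_matrix_mult: "(c *\<^sub>R A) ** (d *\<^sub>R B) = (c * d) *\<^sub>R (A ** B)"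
  for A :: "real ^ 'n::finite ^ 'm" and B :: "real ^ 'k ^ 'n"
  by (simp add: vec_eq_iff matrix_matrix_mult_def sum_distrib_left mult_ac)

lemma scaleR_matrix_mult_left: "(c *\<^sub>R A) ** B = c *\<^sub>R (A ** B)"
  for A :: "real ^ 'n::finite ^ 'm" and B :: "real ^ 'k ^ 'n"
  by (simp add: vec_eq_iff matrix_matrix_mult_def sum_distrib_left mult_ac)

lemma matrix_vector_mult_entry: "(A *v axis j 1) $ i = A $ i $ j" for A :: "real ^ 'n::finite ^ 'm"
  by (simp add: matrix_vector_mult_basis column_def)

lemma preserves_lorentz_inverse:
  assumes A: "\<And>x y. lorentz (A *v x) (A *v y) = lorentz x y"
  shows "lorentz_adjoint A ** A = mat 1" "A ** lorentz_adjoint A = mat 1"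
proof -
  have "(lorentz_adjoint A ** A) *v x = mat 1 *v x" for x
    by (rule lorentz_nondegenerate)
       (simp add: A matrix_vector_mul_assoc[symmetric] lorentz_adjoint[symmetric])
  then show "lorentz_adjoint A ** A = mat 1" by (simp add: matrix_eq)
  then show "A ** lorentz_adjoint A = mat 1" by (simp add: matrix_left_right_inverse)
qed

text \<open>The column of the origin controls the last coordinate of every row, and the form is at most one on each
  row; so the whole matrix is controlled by how far it moves the origin of hyperbolic space.\<close>

lemma preserves_lorentz_entry_bound:
  fixes A :: "real ^ ('m::finite option) ^ ('m option)"
  assumes A: "\<And>x y. lorentz (A *v x) (A *v y) = lorentz x y" and A0: "A $ None $ None > 0"
  shows "\<bar>A $ i $ j\<bar> \<le> 2 * A $ None $ None"
proof -
  let ?a = "A $ None $ None"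
  have col: "(A *v origin) $ i = A $ i $ None" for i
    by (simp add: origin_def matrix_vector_mult_entry)
  have "(norm (space_part (A *v origin)))\<^sup>2 = ?a\<^sup>2 - 1"
    using A[of origin origin] by (simp add: lorentz_self[of "A *v origin"] col)
  then have sq: "(norm (space_part (A *v origin)))\<^sup>2 \<le> ?a\<^sup>2" "1 \<le> ?a\<^sup>2"
    by (simp_all, metis diff_ge_0_iff_ge zero_le_power2)
  have "norm (space_part (A *v origin)) \<le> ?a"
    using sq(1) less_imp_le[OF A0] by (rule power2_le_imp_le)
  then have c: "\<bar>A $ i $ None\<bar> \<le> ?a" for i
  proof (cases i)
    case (Some k)
    then have "\<bar>A $ i $ None\<bar> = \<bar>space_part (A *v origin) $ k\<bar>" by (simp add: space_part_def col)
    also have "\<dots> \<le> ?a" using \<open>norm _ \<le> ?a\<close> component_le_norm_cart order_trans by blast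
    finally show ?thesis .
  qed (use A0 in simp)
  define r where "r = lorentz_adjoint A *v axis i 1"
  have r: "\<bar>r $ j\<bar> = \<bar>A $ i $ j\<bar>" for j
    using coordinate_sign_cases[of i] coordinate_sign_cases[of j]
    by (auto simp: r_def matrix_vector_mult_entry lorentz_adjoint_def)
  have "A *v r = axis i 1"
    by (simp add: r_def matrix_vector_mul_assoc preserves_lorentz_inverse(2)[OF A])
  then have "lorentz r r = lorentz (axis i 1) (axis i 1)" by (metis A)
  also have "\<dots> \<le> 1" using coordinate_sign_cases[of i] by (auto simp: lorentz_axis)
  finally have "(norm (space_part r))\<^sup>2 \<le> 1 + (r $ None)\<^sup>2" by (simp add: lorentz_self)
  also have "(r $ None)\<^sup>2 \<le> ?a\<^sup>2" using c[of i] r[of None] by (metis abs_le_square_iff abs_of_pos A0)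
  also have "1 + ?a\<^sup>2 \<le> (2 * ?a)\<^sup>2" using sq(2) by (simp add: power_mult_distrib)
  finally have sqr: "(norm (space_part r))\<^sup>2 \<le> (2 * ?a)\<^sup>2" by simp
  have "0 \<le> 2 * ?a" using A0 by simp
  with sqr have "norm (space_part r) \<le> 2 * ?a" by (rule power2_le_imp_le)
  then have "\<bar>r $ j\<bar> \<le> 2 * ?a"
  proof (cases j)
    case (Some k)
    then have "\<bar>r $ j\<bar> = \<bar>space_part r $ k\<bar>" by (simp add: space_part_def)
    also have "\<dots> \<le> 2 * ?a" using \<open>norm _ \<le> 2 * ?a\<close> component_le_norm_cart order_trans by blast
    finally show ?thesis .
  qed (use c[of i] r[of None] A0 in simp)
  then show "\<bar>A $ i $ j\<bar> \<le> 2 * ?a" by (simp add: r)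
qed

lemma norm_matrix_le:
  fixes A :: "real ^ 'n::finite ^ 'm::finite" and C :: real
  assumes "\<And>i j. \<bar>A $ i $ j\<bar> \<le> C"
  shows "norm A \<le> CARD('m) * (CARD('n) * C)"
proof -
  have "norm (A $ i) \<le> CARD('n) * C" for i
    using norm_le_l1_cart[of "A $ i"] sum_bounded_above[of UNIV "\<lambda>j. \<bar>A $ i $ j\<bar>" C] assms by simp
  then have "(\<Sum>i\<in>UNIV. norm (A $ i)) \<le> CARD('m) * (CARD('n) * C)"
    using sum_bounded_above[of UNIV "\<lambda>i. norm (A $ i)"] by simp
  moreover have "norm A \<le> (\<Sum>i\<in>UNIV. norm (A $ i))"
    by (subst norm_vec_def) (simp add: L2_set_le_sum)
  ultimately show ?thesis by linarith
qed

lemma bounded_seq_convergent_subseq: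
  fixes f :: "nat \<Rightarrow> 'a::heine_borel"
  assumes "bounded (range f)"
  obtains l r where "strict_mono (r :: nat \<Rightarrow> nat)" "(f \<circ> r) \<longlonglongrightarrow> l"
  using bounded_imp_convergent_subsequence[OF assms] by blast

section \<open>Discrete groups of Lorentz matrices\<close>

locale discrete_lorentz_group =
  fixes \<Gamma> :: "(real ^ ('m::finite option) ^ ('m option)) set"
  assumes subgroup: "subgroup \<Gamma> SO_plus"
    and discrete: "discrete \<Gamma>"
begin

lemma in_SO_plus: "A \<in> \<Gamma> \<Longrightarrow> A \<in> carrier SO_plus"
  using subgroup.subset[OF subgroup] by blast

lemma preserves_lorentz: "A \<in> \<Gamma> \<Longrightarrow> lorentz (A *v x) (A *v y) = lorentz x y"
  and preserves_future: "A \<in> \<Gamma> \<Longrightarrow> lorentz x x < 0 \<Longrightarrow> x $ None > 0 \<Longrightarrow> (A *v x) $ None > 0"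
  using in_SO_plus[of A] by (simp_all add: SO_plus_def)

lemma corner_pos: "A \<in> \<Gamma> \<Longrightarrow> A $ None $ None > 0"
  using preserves_future[of A origin] by (simp add: matrix_vector_mult_entry flip: origin_def)
     (simp add: origin_def matrix_vector_mult_entry)

lemma entry_bound: "A \<in> \<Gamma> \<Longrightarrow> \<bar>A $ i $ j\<bar> \<le> 2 * A $ None $ None"
  by (rule preserves_lorentz_entry_bound[OF preserves_lorentz corner_pos])

lemma one_closed: "mat 1 \<in> \<Gamma>"
  using subgroup.one_closed[OF subgroup] by (simp add: SO_plus_def)

lemma mult_closed: "A \<in> \<Gamma> \<Longrightarrow> B \<in> \<Gamma> \<Longrightarrow> A ** B \<in> \<Gamma>"
  using subgroup.m_closed[OF subgroup, of A B] by (simp add: SO_plus_def)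

lemmas inverse_mult = preserves_lorentz_inverse[OF preserves_lorentz]

lemma inverse_closed: "lorentz_adjoint A \<in> \<Gamma>" if A: "A \<in> \<Gamma>"
proof -
  obtain B where B: "B \<in> \<Gamma>" "B ** A = mat 1"
    using subgroup.m_inv_closed[OF subgroup A] group.l_inv[OF group_SO_plus in_SO_plus[OF A]]
    by (auto simp: SO_plus_def)
  have "lorentz_adjoint A = B ** (A ** lorentz_adjoint A)"
    by (simp add: matrix_mul_assoc B)
  then show ?thesis using B(1) by (simp add: inverse_mult[OF A])
qed

lemma inverse_mult_vec:
  assumes "A \<in> \<Gamma>"
  shows "lorentz_adjoint A *v (A *v x) = x" "A *v (lorentz_adjoint A *v x) = x"
  by (simp_all add: matrix_vector_mul_assoc inverse_mult[OF assms])

lemma image_eq_0_iff: "A \<in> \<Gamma> \<Longrightarrow> A *v x = 0 \<longleftrightarrow> x = 0"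
  by (metis inverse_mult_vec(1) matrix_vector_mult_0_right)

text \<open>By continuity from the timelike vectors \<open>u + k o\<close> with \<open>k > 0\<close>; the last coordinate of a nonzero null
  vector does not vanish.\<close>

lemma future_null: "(A *v u) $ None > 0" if A: "A \<in> \<Gamma>" and u: "u \<in> null_sphere"
proof -
  let ?v = "lorentz_adjoint A *v origin"
  have v: "lorentz ?v ?v = -1" "?v $ None > 0"
    using preserves_lorentz[OF inverse_closed[OF A], of origin origin]
      preserves_future[OF inverse_closed[OF A], of origin] by simp_all
  have lim: "((\<lambda>k. (A *v (u + k *\<^sub>R origin)) $ None) \<longlongrightarrow> (A *v (u + 0 *\<^sub>R origin)) $ None) (at_right 0)"
    by (intro tendsto_intros tendsto_matrix_vector_mult)
  have "lorentz (u + k *\<^sub>R origin) (u + k *\<^sub>R origin) < 0" if "k > 0" for k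
    using u that by (simp add: lorentz.add_left lorentz.add_right lorentz.scaleR_left lorentz.scaleR_right null_sphere_def)
  then have "(A *v (u + k *\<^sub>R origin)) $ None > 0" if "k > 0" for k
    using preserves_future[OF A, of "u + k *\<^sub>R origin"] u that by (simp add: null_sphere_def)
  then have "(A *v u) $ None \<ge> 0"
    using tendsto_lowerbound[OF lim, of 0]
    by (simp add: eventually_at_right_field) (meson less_eq_real_def zero_less_one)
  moreover have "(A *v u) $ None \<noteq> 0"
    using null_sphere_normalize(1)[of "A *v u"] u preserves_lorentz[OF A, of u u] image_eq_0_iff[OF A]
      null_sphere_nonzero[OF u] by (simp add: null_sphere_def)
  ultimately show ?thesis by simp
qed

definition sphere_action :: "real ^ ('m option) ^ ('m option) \<Rightarrow> real ^ ('m option) \<Rightarrow> real ^ ('m option)"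
  where "sphere_action A u = (1 / (A *v u) $ None) *\<^sub>R (A *v u)"

lemma sphere_action_in: "A \<in> \<Gamma> \<Longrightarrow> u \<in> null_sphere \<Longrightarrow> sphere_action A u \<in> null_sphere"
  unfolding sphere_action_def
  by (rule null_sphere_normalize(2)) (auto simp: preserves_lorentz image_eq_0_iff null_sphere_nonzero,
      auto simp: null_sphere_def)

lemma isolated_one: "\<exists>e>0. \<forall>A\<in>\<Gamma>. dist A (mat 1) < e \<longrightarrow> A = mat 1"
proof -
  obtain T where T: "open T" "T \<inter> \<Gamma> = {mat 1}"
    using discreteD[OF discrete one_closed] by (auto simp: isolated_in_def)
  then obtain e where "e > 0" "\<And>A. dist A (mat 1) < e \<Longrightarrow> A \<in> T"
    by (metis Int_iff insertI1 open_dist)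
  then show ?thesis using T(2) by blast
qed

text \<open>In a convergent sequence of distinct elements the quotients of consecutive elements would
  converge to the identity, which is isolated.\<close>

lemma finite_bounded_corner: "finite {A \<in> \<Gamma>. A $ None $ None \<le> C}"
proof (rule ccontr)
  let ?S = "{A \<in> \<Gamma>. A $ None $ None \<le> C}"
  assume "infinite ?S"
  moreover have "bounded ?S"
  proof (rule boundedI)
    fix A assume "A \<in> ?S"
    then have "\<bar>A $ i $ j\<bar> \<le> 2 * C" for i j using entry_bound[of A i j] by auto
    then show "norm A \<le> CARD('m option) * (CARD('m option) * (2 * C))" by (rule norm_matrix_le)
  qed
  ultimately obtain L where "L islimpt ?S" using bounded_infinite_imp_islimpt by blast
  then obtain f where f: "\<And>n. f n \<in> ?S - {L}" "f \<longlonglongrightarrow> L"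
    by (auto simp: islimpt_sequential)
  have fG: "f n \<in> \<Gamma>" for n using f(1)[of n] by auto
  have "lorentz (L *v x) (L *v y) = lorentz x y" for x y
  proof -
    have "(\<lambda>n. lorentz (f n *v x) (f n *v y)) \<longlonglongrightarrow> lorentz (L *v x) (L *v y)"
      by (intro lorentz.tendsto tendsto_matrix_vector_mult f tendsto_const)
    then show ?thesis by (simp add: preserves_lorentz fG LIMSEQ_const_iff)
  qed
  then have "lorentz_adjoint L ** L = mat 1" by (rule preserves_lorentz_inverse)
  moreover have "(\<lambda>n. lorentz_adjoint (f n) ** f (Suc n)) \<longlonglongrightarrow> lorentz_adjoint L ** L"
    by (intro tendsto_matrix_mult tendsto_lorentz_adjoint f LIMSEQ_Suc)
  ultimately have lim: "(\<lambda>n. lorentz_adjoint (f n) ** f (Suc n)) \<longlonglongrightarrow> mat 1" by simp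
  obtain e where e: "e > 0" "\<forall>A\<in>\<Gamma>. dist A (mat 1) < e \<longrightarrow> A = mat 1"
    using isolated_one by blast
  have "\<forall>\<^sub>F n in sequentially. lorentz_adjoint (f n) ** f (Suc n) = mat 1"
    using tendstoD[OF lim e(1)]
    by (rule eventually_mono) (use e(2) fG in \<open>blast intro: mult_closed inverse_closed\<close>)
  then obtain N where N: "\<And>n. n \<ge> N \<Longrightarrow> lorentz_adjoint (f n) ** f (Suc n) = mat 1"
    by (auto simp: eventually_sequentially)
  have "f (Suc n) = f n" if "n \<ge> N" for n
  proof -
    have "f (Suc n) = f n ** (lorentz_adjoint (f n) ** f (Suc n))"
      by (simp add: matrix_mul_assoc inverse_mult[OF fG])
    then show ?thesis using N[OF that] by simp
  qed
  then have "f (N + k) = f N" for k by (induction k) auto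
  then have "(\<lambda>k. f (k + N)) \<longlonglongrightarrow> f N" by (simp add: add.commute)
  then have "f N = L" using LIMSEQ_ignore_initial_segment[OF f(2), of N] LIMSEQ_unique by blast
  then show False using f(1)[of N] by simp
qed

end

context discrete_lorentz_group
begin

section \<open>Rank-one limits\<close>

text \<open>The dynamics of a divergent sequence: away from the directions orthogonal to the repelling point \<open>q\<close>
  everything converges to the attracting point \<open>p\<close>. The corner entry measures how far the origin is
  moved; dividing by it keeps the sequence bounded.\<close>

definition attracts :: "(nat \<Rightarrow> real ^ ('m option) ^ ('m option)) \<Rightarrow> real ^ ('m option) \<Rightarrow> real ^ ('m option) \<Rightarrow> bool"
  where "attracts g p q \<longleftrightarrow> (\<forall>n. g n \<in> \<Gamma>) \<and> p \<in> null_sphere \<and> q \<in> null_sphere \<and>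
    filterlim (\<lambda>n. g n $ None $ None) at_top sequentially \<and>
    (\<lambda>n. (1 / g n $ None $ None) *\<^sub>R g n) \<longlonglongrightarrow> null_projection p q"

lemma attractsD:
  assumes "attracts g p q"
  shows "g n \<in> \<Gamma>" "p \<in> null_sphere" "q \<in> null_sphere"
    "filterlim (\<lambda>n. g n $ None $ None) at_top sequentially"
    "(\<lambda>n. (1 / g n $ None $ None) *\<^sub>R g n) \<longlonglongrightarrow> null_projection p q"
  using assms by (auto simp: attracts_def)

lemma attracts_vector:
  assumes "attracts g p q" "x \<longlonglongrightarrow> l"
  shows "(\<lambda>n. (1 / g n $ None $ None) *\<^sub>R (g n *v x n)) \<longlonglongrightarrow> - lorentz q l *\<^sub>R p"
  using tendsto_matrix_vector_mult[OF attractsD(5)[OF assms(1)] assms(2)]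
  by (simp add: scaleR_matrix_vector_mult null_projection_mult)

lemma attracts_subseq:
  assumes "attracts g p q" "strict_mono r"
  shows "attracts (g \<circ> r) p q"
  using assms LIMSEQ_subseq_LIMSEQ[OF attractsD(5)[OF assms(1)] assms(2)]
    filterlim_compose[OF attractsD(4)[OF assms(1)] filterlim_subseq[OF assms(2)]]
  by (auto simp: attracts_def o_def)

lemma attracts_inverse:
  assumes "attracts g p q"
  shows "attracts (\<lambda>n. lorentz_adjoint (g n)) q p"
proof -
  have "lorentz_adjoint (c *\<^sub>R A) = c *\<^sub>R lorentz_adjoint A" for c and A :: "real ^ ('m option) ^ ('m option)"
    by (simp add: lorentz_adjoint_def vec_eq_iff)
  then show ?thesis
    using tendsto_lorentz_adjoint[OF attractsD(5)[OF assms]] attractsD[OF assms]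
    by (simp add: attracts_def inverse_closed lorentz_adjoint_null_projection)
qed

lemma null_projection_corner: "p \<in> null_sphere \<Longrightarrow> q \<in> null_sphere \<Longrightarrow> null_projection p q $ None $ None = 1"
  by (simp add: null_projection_def null_sphere_def coordinate_sign_def)

text \<open>The corner entry of the limit is \<open>k\<close>, so the corner entries of \<open>g\<^sub>n\<close> grow like \<open>k a\<^sub>n\<close>.\<close>

lemma attractsI_scaled:
  assumes g: "\<And>n. g n \<in> \<Gamma>" and pq: "p \<in> null_sphere" "q \<in> null_sphere" and k: "k > 0"
    and a: "filterlim a at_top sequentially"
    and lim: "(\<lambda>n. (1 / a n) *\<^sub>R g n) \<longlonglongrightarrow> k *\<^sub>R null_projection p q"
  shows "attracts g p q"
proof -
  have c: "(\<lambda>n. g n $ None $ None / a n) \<longlonglongrightarrow> k"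
    using tendsto_vec_nth[OF tendsto_vec_nth[OF lim, of None], of None]
    by (simp add: null_projection_corner[OF pq])
  have apos: "\<forall>\<^sub>F n in sequentially. a n > 0"
    using a by (simp add: filterlim_at_top_dense)
  have "filterlim (\<lambda>n. (g n $ None $ None / a n) * a n) at_top sequentially"
    by (rule filterlim_tendsto_pos_mult_at_top[OF c k a])
  then have "filterlim (\<lambda>n. g n $ None $ None) at_top sequentially"
    by (rule filterlim_cong[OF refl refl, THEN iffD1, rotated])
       (use apos in eventually_elim, simp)
  moreover have "(\<lambda>n. (1 / g n $ None $ None) *\<^sub>R g n) \<longlonglongrightarrow> null_projection p q"
  proof (rule Lim_transform_eventually)
    have "(\<lambda>n. inverse (g n $ None $ None / a n) *\<^sub>R ((1 / a n) *\<^sub>R g n))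
        \<longlonglongrightarrow> inverse k *\<^sub>R (k *\<^sub>R null_projection p q)"
      by (intro tendsto_intros c lim) (use k in simp)
    then show "(\<lambda>n. inverse (g n $ None $ None / a n) *\<^sub>R ((1 / a n) *\<^sub>R g n))
        \<longlonglongrightarrow> null_projection p q"
      using k by simp
    show "\<forall>\<^sub>F n in sequentially. inverse (g n $ None $ None / a n) *\<^sub>R ((1 / a n) *\<^sub>R g n)
        = (1 / g n $ None $ None) *\<^sub>R g n"
      using apos by eventually_elim (simp add: field_simps)
  qed
  ultimately show ?thesis using g pq by (simp add: attracts_def)
qed

text \<open>The product of the limits is \<open>- \<langle>q, p'\<rangle>\<close> times the new rank-one operator, and the factor is
  positive for distinct null directions.\<close>

lemma attracts_mult:
  assumes g: "attracts g p q" and h: "attracts h p' q'" and ne: "q \<noteq> p'"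
  shows "attracts (\<lambda>n. g n ** h n) p q'"
proof (rule attractsI_scaled)
  show "g n ** h n \<in> \<Gamma>" for n using attractsD(1) g h by (blast intro: mult_closed)
  show "p \<in> null_sphere" "q' \<in> null_sphere" using attractsD g h by blast+
  show "- lorentz q p' > 0"
    using lorentz_null_sphere_neg[OF attractsD(3)[OF g] attractsD(2)[OF h] ne] by simp
  show "filterlim (\<lambda>n. g n $ None $ None * h n $ None $ None) at_top sequentially"
    by (intro filterlim_at_top_mult_at_top attractsD(4)[OF g] attractsD(4)[OF h])
  have "null_projection p q ** null_projection p' q' = - lorentz q p' *\<^sub>R null_projection p q'"
    by (simp add: matrix_eq matrix_vector_mul_assoc[symmetric] null_projection_mult
        scaleR_matrix_vector_mult lorentz.minus_right lorentz.scaleR_right mult.commute del: scaleR_minus_left)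
  then show "(\<lambda>n. (1 / (g n $ None $ None * h n $ None $ None)) *\<^sub>R (g n ** h n))
      \<longlonglongrightarrow> - lorentz q p' *\<^sub>R null_projection p q'"
    using tendsto_matrix_mult[OF attractsD(5)[OF g] attractsD(5)[OF h]]
    by (simp add: scaleR_matrix_mult)
qed

lemma attracts_mult_right:
  assumes g: "attracts g p q" and A: "A \<in> \<Gamma>"
  shows "attracts (\<lambda>n. g n ** A) p (sphere_action (lorentz_adjoint A) q)"
proof (rule attractsI_scaled)
  show "g n ** A \<in> \<Gamma>" for n using attractsD(1) g A by (blast intro: mult_closed)
  show "p \<in> null_sphere" "sphere_action (lorentz_adjoint A) q \<in> null_sphere"
    using attractsD[OF g] A by (blast intro: sphere_action_in inverse_closed)+
  show pos: "(lorentz_adjoint A *v q) $ None > 0"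
    using future_null[OF inverse_closed[OF A] attractsD(3)[OF g]] .
  show "filterlim (\<lambda>n. g n $ None $ None) at_top sequentially" by (rule attractsD(4)[OF g])
  have "null_projection p q ** A
      = (lorentz_adjoint A *v q) $ None *\<^sub>R null_projection p (sphere_action (lorentz_adjoint A) q)"
    using pos by (simp add: matrix_eq matrix_vector_mul_assoc[symmetric] null_projection_mult
        scaleR_matrix_vector_mult sphere_action_def lorentz.scaleR_left lorentz_adjoint)
  then show "(\<lambda>n. (1 / g n $ None $ None) *\<^sub>R (g n ** A)) \<longlonglongrightarrow>
      (lorentz_adjoint A *v q) $ None *\<^sub>R null_projection p (sphere_action (lorentz_adjoint A) q)"
    using tendsto_matrix_mult[OF attractsD(5)[OF g] tendsto_const[of A]]
    by (simp add: scaleR_matrix_mult_left)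
qed

text \<open>After division by its corner entry a diverging sequence subconverges. The limit pulls the form back to
  zero, so its range is totally isotropic and hence a null line. The same holds for the inverses.\<close>

lemma exists_attracts:
  assumes g: "\<And>n. g n \<in> \<Gamma>" and lim: "filterlim (\<lambda>n. g n $ None $ None) at_top sequentially"
  obtains r p q where "strict_mono r" "attracts (g \<circ> r) p q"
proof -
  let ?c = "\<lambda>n. g n $ None $ None"
  define A where "A = (\<lambda>n. (1 / ?c n) *\<^sub>R g n)"
  have "bounded (range A)"
  proof (rule boundedI, clarify)
    fix n
    have "\<bar>A n $ i $ j\<bar> \<le> 2" for i j
      using entry_bound[OF g, of n i j] corner_pos[OF g, of n]
      by (simp add: A_def abs_mult field_simps)
    then show "norm (A n) \<le> real CARD('m option) * (real CARD('m option) * 2)" by (rule norm_matrix_le)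
  qed
  then obtain M r where r: "strict_mono r" and M: "(A \<circ> r) \<longlonglongrightarrow> M"
    by (rule bounded_seq_convergent_subseq)
  have limr: "filterlim (\<lambda>n. ?c (r n)) at_top sequentially"
    by (rule filterlim_compose[OF lim filterlim_subseq[OF r]])
  have zero: "(\<lambda>n. (1 / ?c (r n)) * ((1 / ?c (r n)) * a)) \<longlonglongrightarrow> 0 * (0 * a)" for a
    by (intro tendsto_intros tendsto_divide_0[OF tendsto_const] filterlim_at_top_imp_at_infinity limr)
  have iso: "lorentz (M *v x) (M *v y) = 0" for x y
  proof (rule LIMSEQ_unique)
    show "(\<lambda>n. lorentz ((A \<circ> r) n *v x) ((A \<circ> r) n *v y)) \<longlonglongrightarrow> lorentz (M *v x) (M *v y)"
      by (intro lorentz.tendsto tendsto_matrix_vector_mult M tendsto_const)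
    show "(\<lambda>n. lorentz ((A \<circ> r) n *v x) ((A \<circ> r) n *v y)) \<longlonglongrightarrow> 0"
      using zero[of "lorentz x y"]
      by (simp add: A_def scaleR_matrix_vector_mult lorentz.scaleR_left lorentz.scaleR_right
          preserves_lorentz g)
  qed
  define p where "p = M *v origin"
  define q where "q = lorentz_adjoint M *v origin"
  have "(\<lambda>n. (A \<circ> r) n $ None $ None) \<longlonglongrightarrow> M $ None $ None"
    by (intro tendsto_vec_nth M)
  moreover have "(A \<circ> r) n $ None $ None = 1" for n
    using corner_pos[OF g, of "r n"] by (simp add: A_def)
  ultimately have M0: "M $ None $ None = 1" by (simp add: LIMSEQ_const_iff)
  have p: "p \<in> null_sphere"
    using iso[of origin origin] M0 by (simp add: p_def null_sphere_def origin_def matrix_vector_mult_entry)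
  have "lorentz q q = 0"
  proof (rule LIMSEQ_unique)
    let ?q = "\<lambda>n. lorentz_adjoint ((A \<circ> r) n) *v origin"
    show "(\<lambda>n. lorentz (?q n) (?q n)) \<longlonglongrightarrow> lorentz q q"
      unfolding q_def by (intro lorentz.tendsto tendsto_matrix_vector_mult tendsto_lorentz_adjoint M tendsto_const)
    have "lorentz_adjoint (c *\<^sub>R B) = c *\<^sub>R lorentz_adjoint B" for c and B :: "real ^ ('m option) ^ ('m option)"
      by (simp add: lorentz_adjoint_def vec_eq_iff)
    then show "(\<lambda>n. lorentz (?q n) (?q n)) \<longlonglongrightarrow> 0"
      using zero[of "-1"] preserves_lorentz[OF inverse_closed[OF g], of _ origin origin]
      by (simp add: A_def scaleR_matrix_vector_mult lorentz.scaleR_left lorentz.scaleR_right)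
  qed
  then have q: "q \<in> null_sphere"
    using M0 by (simp add: q_def null_sphere_def origin_def matrix_vector_mult_entry)
  have "M *v x = null_projection p q *v x" for x
  proof -
    have "M *v x = ((M *v x) $ None) *\<^sub>R p"
      by (rule null_orthogonal_null_sphere[OF p]) (simp_all add: p_def iso)
    moreover have "(M *v x) $ None = - lorentz q x"
      using lorentz_adjoint[of M x origin] by (simp add: q_def lorentz_commute[of _ x])
    ultimately show ?thesis by (simp add: null_projection_mult)
  qed
  then have "M = null_projection p q" by (simp add: matrix_eq)
  then have "attracts (g \<circ> r) p q"
    using M limr p q g by (simp add: attracts_def A_def o_def)
  with r show thesis by (rule that)
qed

lemma infinite_range_subseq:
  fixes g :: "nat \<Rightarrow> _"
  assumes g: "\<And>n. g n \<in> \<Gamma>" and inf: "infinite (range g)"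
  obtains r where "strict_mono r" "filterlim (\<lambda>n. (g \<circ> r) n $ None $ None) at_top sequentially"
proof -
  have ex: "\<exists>n>N. g n $ None $ None > C" for N C
  proof (rule ccontr)
    assume "\<not> (\<exists>n>N. g n $ None $ None > C)"
    then have "n \<le> N \<or> g n $ None $ None \<le> C" for n by (meson not_le)
    then have "g n \<in> g ` {..N} \<union> {A \<in> \<Gamma>. A $ None $ None \<le> C}" for n
      using g[of n] by blast
    then have "range g \<subseteq> g ` {..N} \<union> {A \<in> \<Gamma>. A $ None $ None \<le> C}" by blast
    moreover have "finite (g ` {..N} \<union> {A \<in> \<Gamma>. A $ None $ None \<le> C})"
      by (simp add: finite_bounded_corner)
    ultimately show False using inf finite_subset by blast
  qed
  have "\<exists>r. \<forall>n. g (r n) $ None $ None > real n \<and> r n < r (Suc n)"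
  proof (rule dependent_nat_choice)
    show "\<exists>k. real 0 < g k $ None $ None" using ex[of 0 0] by auto
    show "\<exists>l. real (Suc n) < g l $ None $ None \<and> k < l" for k n using ex[of k "real (Suc n)"] by auto
  qed
  then obtain r where r: "\<And>n. g (r n) $ None $ None > real n" "\<And>n. r n < r (Suc n)" by blast
  have "filterlim (\<lambda>n. (g \<circ> r) n $ None $ None) at_top sequentially"
    by (rule filterlim_at_top_mono[OF filterlim_real_sequentially]) (use r(1) in \<open>auto intro!: always_eventually less_imp_le\<close>)
  moreover have "strict_mono r" using r(2) by (simp add: strict_mono_Suc_iff)
  ultimately show thesis using that by blast
qed

text \<open>A diverging sequence stretches timelike vectors beyond all bounds, since the repelling null
  vector cannot be orthogonal to a timelike one.\<close>

lemma finite_range_of_bounded_timelike: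
  assumes g: "\<And>n. g n \<in> \<Gamma>" and t: "t \<longlonglongrightarrow> l" "lorentz l l < 0"
    and b: "(\<lambda>n. g n *v t n) \<longlonglongrightarrow> l'"
  shows "finite (range g)"
proof (rule ccontr)
  assume "infinite (range g)"
  then obtain r where r: "strict_mono r" "filterlim (\<lambda>n. (g \<circ> r) n $ None $ None) at_top sequentially"
    using infinite_range_subseq[of g] g by blast
  then obtain r' p q where r': "strict_mono r'" "attracts (g \<circ> r \<circ> r') p q"
    using exists_attracts[of "g \<circ> r"] g by auto
  let ?h = "g \<circ> r \<circ> r'"
  have "strict_mono (r \<circ> r')" using r(1) r'(1) by (rule strict_mono_o)
  note sub = LIMSEQ_subseq_LIMSEQ[OF _ this]
  have "(\<lambda>n. (1 / ?h n $ None $ None) *\<^sub>R (?h n *v (t \<circ> (r \<circ> r')) n)) \<longlonglongrightarrow> - lorentz q l *\<^sub>R p"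
    by (rule attracts_vector[OF r'(2) sub[OF t(1)]])
  moreover have "(\<lambda>n. (1 / ?h n $ None $ None) *\<^sub>R (?h n *v (t \<circ> (r \<circ> r')) n)) \<longlonglongrightarrow> 0 *\<^sub>R l'"
    using sub[OF b] by (intro tendsto_scaleR tendsto_divide_0[OF tendsto_const]
      filterlim_at_top_imp_at_infinity attractsD(4)[OF r'(2)]) (simp add: o_def)
  ultimately have "- lorentz q l *\<^sub>R p = 0 *\<^sub>R l'" by (rule LIMSEQ_unique)
  then have "lorentz l q = 0"
    using null_sphere_nonzero[OF attractsD(2)[OF r'(2)]] by (simp add: lorentz_commute)
  then show False
    using lorentz_orthogonal_timelike[OF t(2)] attractsD(3)[OF r'(2)] null_sphere_nonzero[of q]
    by (force simp: null_sphere_def)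
qed

end

section \<open>Loxodromic elements\<close>

lemma norm_matrix_vector_mult_le: "norm (A *v x) \<le> norm A * norm x"
  for A :: "real ^ 'n::finite ^ 'm::finite"
proof -
  have "norm (A *v x) = L2_set (\<lambda>i. \<bar>A $ i \<bullet> x\<bar>) UNIV"
    by (simp add: norm_vec_def matrix_vector_mul_component)
  also have "\<dots> \<le> L2_set (\<lambda>i. norm (A $ i) * norm x) UNIV"
    by (intro L2_set_mono) (auto simp: Cauchy_Schwarz_ineq2)
  also have "\<dots> = norm A * norm x"
    by (simp add: norm_vec_def[of A] L2_set_left_distrib)
  finally show ?thesis .
qed

text \<open>The quantitative form of \<open>lorentz_orthogonal_timelike\<close>: with \<open>k = |t|\<^sup>2 / t\<^sub>0\<^sup>2 < 1\<close> every \<open>x\<close> orthogonal to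
  \<open>t\<close> satisfies \<open>x\<^sub>0\<^sup>2 \<le> k |x|\<^sup>2\<close>.\<close>

lemma timelike_orthogonal_coercive:
  assumes t: "lorentz t t < 0"
  obtains c where "c > 0" "\<And>x. lorentz t x = 0 \<Longrightarrow> c * (norm x)\<^sup>2 \<le> lorentz x x"
proof -
  let ?s = "norm (space_part t)"
  have st: "?s\<^sup>2 < (t $ None)\<^sup>2" using t by (simp add: lorentz_self)
  define k where "k = ?s\<^sup>2 / (t $ None)\<^sup>2"
  have t0: "(t $ None)\<^sup>2 > 0" using st by (smt (verit) zero_le_power2)
  have k: "k < 1" "k \<ge> 0" "?s\<^sup>2 = k * (t $ None)\<^sup>2" using st t0 by (simp_all add: k_def)
  have "(1 - k) / 2 * (norm x)\<^sup>2 \<le> lorentz x x" if "lorentz t x = 0" for x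
  proof -
    let ?a = "(norm (space_part x))\<^sup>2" and ?b = "(x $ None)\<^sup>2"
    have "t $ None * x $ None = space_part t \<bullet> space_part x"
      using that by (simp add: lorentz_space_part)
    then have "(t $ None * x $ None)\<^sup>2 \<le> (?s * norm (space_part x))\<^sup>2"
      by (metis Cauchy_Schwarz_ineq2 abs_le_square_iff abs_mult abs_norm_cancel)
    then have "(t $ None)\<^sup>2 * ?b \<le> (t $ None)\<^sup>2 * (k * ?a)"
      by (simp add: power_mult_distrib k(3) mult_ac)
    then have b: "?b \<le> k * ?a" using t0 by simp
    have "k * ?a \<le> 1 * ?a" using k by (intro mult_right_mono) auto
    then have "(1 - k) * ?b \<le> (1 - k) * ?a" using b k by (intro mult_left_mono) auto
    moreover have "(norm x)\<^sup>2 = ?a + ?b"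
      by (simp add: power2_norm_eq_inner inner_space_part[of x]) (simp add: power2_eq_square)
    moreover have "(1 - k) / 2 * (?a + ?b) = ((1 - k) * ?a + (1 - k) * ?b) / 2"
      by (simp add: algebra_simps add_divide_distrib diff_divide_distrib)
    moreover have "((1 - k) * ?a + (1 - k) * ?b) / 2 \<le> (1 - k) * ?a"
      using \<open>(1 - k) * ?b \<le> (1 - k) * ?a\<close> by simp
    moreover have "(1 - k) * ?a \<le> ?a - ?b" using b by (simp add: left_diff_distrib)
    ultimately show ?thesis unfolding lorentz_self by simp
  qed
  then show thesis using that[of "(1 - k) / 2"] k by simp
qed

primrec matrix_power :: "real ^ 'n::finite ^ 'n \<Rightarrow> nat \<Rightarrow> real ^ 'n ^ 'n"
  where "matrix_power A 0 = mat 1"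
  | "matrix_power A (Suc n) = A ** matrix_power A n"

lemma matrix_power_add: "matrix_power A (m + n) = matrix_power A m ** matrix_power A n"
  by (induction m) (simp_all add: matrix_mul_assoc)

lemma matrix_power_eigenvector: "A *v x = c *\<^sub>R x \<Longrightarrow> matrix_power A n *v x = c ^ n *\<^sub>R x"
  by (induction n) (simp_all add: matrix_vector_mul_assoc[symmetric] matrix_vector_mult_scaleR)

context discrete_lorentz_group
begin

lemma matrix_power_in: "A \<in> \<Gamma> \<Longrightarrow> matrix_power A n \<in> \<Gamma>"
  by (induction n) (simp_all add: one_closed mult_closed)

definition loxodromic where
  "loxodromic A p q c \<longleftrightarrow> A \<in> \<Gamma> \<and> p \<in> null_sphere \<and> q \<in> null_sphere \<and> c > 1 \<and>
    A *v p = c *\<^sub>R p \<and> A *v q = inverse c *\<^sub>R q"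

lemma loxodromic_distinct: "loxodromic A p q c \<Longrightarrow> p \<noteq> q"
proof
  assume "loxodromic A p q c" and "p = q"
  then have "c *\<^sub>R p = inverse c *\<^sub>R p" "p \<noteq> 0" "c > 1"
    by (auto simp: loxodromic_def dest: null_sphere_nonzero)
  then have "c = inverse c" by auto
  moreover have "inverse c < 1" using \<open>c > 1\<close> by (simp add: inverse_less_1_iff)
  ultimately show False using \<open>c > 1\<close> by simp
qed

text \<open>Near the limit the projective map sends a small ball around the attracting point into itself, and
  Brouwer's theorem gives a fixed point there; its eigenvalue is large, so the form vanishes on
  it.\<close>

lemma attracts_eigenvector:
  assumes g: "attracts g p q" and pq: "p \<noteq> q" and e: "e > 0"
  shows "\<forall>\<^sub>F n in sequentially. \<exists>x\<in>null_sphere. \<exists>c>1. dist x p < e \<and> g n *v x = c *\<^sub>R x"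
proof -
  let ?M = "null_projection p q"
  define A where "A n = (1 / g n $ None $ None) *\<^sub>R g n" for n
  note p = attractsD(2)[OF g] and q = attractsD(3)[OF g]
  have p1: "p $ None = 1" using p by (simp add: null_sphere_def)
  define k where "k = - lorentz q p"
  have k: "k > 0" using lorentz_null_sphere_neg[OF q p] pq by (auto simp: k_def)
  have "open {x. - lorentz q x > k / 2}"
    by (intro open_Collect_less continuous_intros lorentz.continuous_on)
  moreover have "p \<in> {x. - lorentz q x > k / 2}" using k by (simp add: k_def)
  ultimately obtain d0 where d0: "d0 > 0" "cball p d0 \<subseteq> {x. - lorentz q x > k / 2}"
    by (meson open_contains_cball)
  define d where "d = min d0 (e / 2)"
  have d: "d > 0" "d < e" "\<And>x. dist p x \<le> d \<Longrightarrow> - lorentz q x > k / 2"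
    using d0 e by (auto simp: d_def subset_iff)
  define B where "B = norm p + d"
  have B: "B > 0" using d by (simp add: B_def add_nonneg_pos)
  \<comment> \<open>The first bound keeps the last coordinate above \<open>k / 4\<close>, the second keeps the image in the ball.\<close>
  define h where "h = min (k / (4 * B)) (k * d / (4 * B * (1 + norm p)))"
  have np: "1 + norm p > 0" by (smt (verit) norm_ge_zero)
  have h: "h > 0" using k B d np by (simp add: h_def)
  have hB: "h * B \<le> k / 4" using B by (simp add: h_def min_def field_simps)
  have "h \<le> k * d / (4 * B * (1 + norm p))" by (simp add: h_def)
  then have "h * (4 * B * (1 + norm p)) \<le> k * d"
    using B np by (simp add: pos_le_divide_eq)
  then have hd: "h * B * (1 + norm p) \<le> k / 4 * d" by (simp add: algebra_simps)
  define C where "C = {x. x $ None = 1} \<inter> cball p d"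
  have "closed {x :: real ^ ('m option). x $ None = 1}" by (intro closed_Collect_eq continuous_intros)
  moreover have "convex {x :: real ^ ('m option). x $ None = 1}" by (simp add: convex_def)
  ultimately have C: "compact C" "convex C" "C \<noteq> {}"
    using d p1 unfolding C_def by (auto intro!: closed_Int_compact convex_Int)
  have "\<forall>\<^sub>F n in sequentially. dist (A n) ?M < h"
    using tendstoD[OF attractsD(5)[OF g] h] by (simp add: A_def)
  moreover have "\<forall>\<^sub>F n in sequentially. 4 / k < g n $ None $ None"
    using attractsD(4)[OF g] by (simp add: filterlim_at_top_dense)
  ultimately show ?thesis
  proof eventually_elim
    case (elim n)
    let ?c = "g n $ None $ None"
    have c: "?c > 0" by (rule corner_pos[OF attractsD(1)[OF g]])
    define D where "D = A n - ?M"
    have D: "norm D \<le> h" using elim(1) by (simp add: D_def dist_norm)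
    have AD: "A n *v x = - lorentz q x *\<^sub>R p + D *v x" for x
      by (simp add: D_def matrix_vector_mult_diff_rdistrib null_projection_mult)
    have bnd: "norm (D *v x) \<le> h * B" "(A n *v x) $ None \<ge> k / 4" if "x \<in> C" for x
    proof -
      have "norm x \<le> B"
        using that norm_triangle_ineq[of p "x - p"] by (simp add: C_def B_def dist_norm norm_minus_commute)
      then show *: "norm (D *v x) \<le> h * B"
        using norm_matrix_vector_mult_le[of D x] mult_mono[OF D \<open>norm x \<le> B\<close>] h by simp
      have "(A n *v x) $ None = - lorentz q x + (D *v x) $ None" using p1 by (simp add: AD)
      moreover have "\<bar>(D *v x) $ None\<bar> \<le> k / 4"
        using * hB component_le_norm_cart[of "D *v x" None] by linarith
      moreover have "- lorentz q x > k / 2" using d(3) that by (simp add: C_def)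
      ultimately show "(A n *v x) $ None \<ge> k / 4" by linarith
    qed
    define f where "f x = (1 / (A n *v x) $ None) *\<^sub>R (A n *v x)" for x
    have "continuous_on C f"
      unfolding f_def using bnd(2) k
      by (intro continuous_intros matrix_vector_mult_linear_continuous_on) force
    moreover have "f x \<in> C" if x: "x \<in> C" for x
    proof -
      let ?a = "(A n *v x) $ None"
      have a: "?a \<ge> k / 4" "?a > 0" using bnd(2)[OF x] k by auto
      have "A n *v x - ?a *\<^sub>R p = D *v x - (D *v x) $ None *\<^sub>R p"
        using p1 by (simp add: AD algebra_simps)
      also have "norm \<dots> \<le> norm (D *v x) + \<bar>(D *v x) $ None\<bar> * norm p"
        using norm_triangle_ineq4 by (metis norm_scaleR)
      also have "\<dots> \<le> norm (D *v x) + norm (D *v x) * norm p"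
        by (intro add_left_mono mult_right_mono component_le_norm_cart) auto
      also have "\<dots> = norm (D *v x) * (1 + norm p)" by (simp add: algebra_simps)
      also have "\<dots> \<le> h * B * (1 + norm p)" using bnd(1)[OF x] np by (intro mult_right_mono) auto
      also have "\<dots> \<le> k / 4 * d" by (rule hd)
      also have "\<dots> \<le> ?a * d" using a d by (intro mult_right_mono) auto
      finally have *: "norm (A n *v x - ?a *\<^sub>R p) \<le> ?a * d" .
      have "f x - p = (1 / ?a) *\<^sub>R (A n *v x - ?a *\<^sub>R p)"
        using a by (simp add: f_def scaleR_diff_right)
      then have "norm (f x - p) = norm (A n *v x - ?a *\<^sub>R p) / ?a"
        by (subst \<open>f x - p = _\<close>) (use a in simp)
      then have "norm (f x - p) \<le> d" using * a by (simp add: pos_divide_le_eq mult.commute)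
      then show ?thesis using a by (simp add: C_def f_def dist_norm norm_minus_commute)
    qed
    ultimately obtain x where x: "x \<in> C" "f x = x"
      using brouwer[OF C, of f] by blast
    let ?l = "?c * (A n *v x) $ None"
    have gA: "g n *v x = ?c *\<^sub>R (A n *v x)" using c by (simp add: A_def scaleR_matrix_vector_mult)
    have a: "(A n *v x) $ None \<ge> k / 4" "(A n *v x) $ None > 0" using bnd(2)[OF x(1)] k by auto
    have "A n *v x = (A n *v x) $ None *\<^sub>R f x" using a by (simp add: f_def)
    then have Ax: "A n *v x = (A n *v x) $ None *\<^sub>R x" by (simp only: x(2))
    have eig: "g n *v x = ?l *\<^sub>R x" by (metis Ax gA scaleR_scaleR)
    have "1 < ?c * (k / 4)" using elim(2) k by (simp add: field_simps)
    also have "\<dots> \<le> ?l" using a c by (intro mult_left_mono) auto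
    finally have l: "?l > 1" .
    have "lorentz x x = ?l * (?l * lorentz x x)"
      using preserves_lorentz[OF attractsD(1)[OF g], of n x x]
      by (simp only: eig lorentz.scaleR_left lorentz.scaleR_right real_scaleR_def)
    then have "(?l * ?l - 1) * lorentz x x = 0" by (simp add: left_diff_distrib mult.assoc)
    moreover have "?l * ?l > 1" using l by (smt (verit) mult_less_cancel_right2)
    ultimately have "lorentz x x = 0" by simp
    then have "x \<in> null_sphere" using x(1) by (simp add: C_def null_sphere_def)
    moreover have "dist x p < e" using x(1) d by (simp add: C_def dist_commute)
    ultimately show ?case using eig l by blast
  qed
qed

text \<open>The inverse sequence attracts to \<open>q\<close>, which gives the repelling fixed point. The two eigenvalues are
  inverse to each other because the form pairs the two fixed vectors nontrivially.\<close>

lemma exists_loxodromic: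
  assumes g: "attracts g p q" and pq: "p \<noteq> q" and e: "e > 0"
  obtains A p' q' c where "loxodromic A p' q' c" "dist p' p < e" "dist q' q < e"
proof -
  have "\<forall>\<^sub>F n in sequentially.
      (\<exists>x\<in>null_sphere. \<exists>c>1. dist x p < e \<and> g n *v x = c *\<^sub>R x) \<and>
      (\<exists>y\<in>null_sphere. \<exists>c>1. dist y q < e \<and> lorentz_adjoint (g n) *v y = c *\<^sub>R y)"
    using attracts_eigenvector[OF g pq e] attracts_eigenvector[OF attracts_inverse[OF g] pq[symmetric] e]
    by (rule eventually_conj)
  then obtain n x c y d where
    x: "x \<in> null_sphere" "c > 1" "dist x p < e" "g n *v x = c *\<^sub>R x" and
    y: "y \<in> null_sphere" "d > 1" "dist y q < e" "lorentz_adjoint (g n) *v y = d *\<^sub>R y"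
    using eventually_happens'[OF sequentially_bot] by blast
  note gn = attractsD(1)[OF g, of n]
  have gy: "g n *v y = inverse d *\<^sub>R y"
  proof -
    have "y = d *\<^sub>R (g n *v y)"
      using inverse_mult_vec(2)[OF gn, of y] y(4) by (simp add: matrix_vector_mult_scaleR)
    then have "inverse d *\<^sub>R y = inverse d *\<^sub>R (d *\<^sub>R (g n *v y))" by simp
    then show ?thesis using y(2) by simp
  qed
  have "x \<noteq> y"
  proof
    assume "x = y"
    then have "c *\<^sub>R x = inverse d *\<^sub>R x" using x(4) gy by metis
    then have "c = inverse d \<or> x = 0" by (simp only: scaleR_cancel_right)
    then have "c = inverse d" using null_sphere_nonzero[OF x(1)] by blast
    moreover have "inverse d < 1" using y(2) by (simp add: inverse_less_1_iff)
    ultimately show False using x(2) by simp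
  qed
  then have "lorentz x y \<noteq> 0" using lorentz_null_sphere_neg x(1) y(1) by force
  moreover have "lorentz x y = c * (inverse d * lorentz x y)"
    using preserves_lorentz[OF gn, of x y]
    by (simp only: x(4) gy lorentz.scaleR_left lorentz.scaleR_right real_scaleR_def mult.left_commute)
  ultimately have "c * inverse d = 1" by simp
  then have "d = c" using y(2) by (simp add: field_simps)
  then have "loxodromic (g n) x y c" using x y gy gn by (simp add: loxodromic_def)
  then show thesis using that x(3) y(3) by blast
qed

text \<open>On the orthogonal complement of its axis a loxodromic element is an isometry of a definite form,
  hence recurrent.\<close>

lemma loxodromic_recurrent:
  assumes A: "loxodromic A p q c"
    and x: "lorentz p x = 0" "lorentz q x = 0" and y: "lorentz p y = 0" "lorentz q y = 0"
  obtains k where "\<And>j. k j \<ge> j" "(\<lambda>j. matrix_power A (k j) *v x) \<longlonglongrightarrow> x"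
    "(\<lambda>j. matrix_power A (k j) *v y) \<longlonglongrightarrow> y"
proof -
  note lox = A[unfolded loxodromic_def]
  have pq: "lorentz p q < 0"
    using lorentz_null_sphere_neg loxodromic_distinct[OF A] lox by blast
  have "lorentz (p + q) (p + q) < 0"
    using lox pq lorentz_commute[of p q] by (simp add: lorentz.add_left lorentz.add_right null_sphere_def)
  then obtain b where b: "b > 0" "\<And>x. lorentz (p + q) x = 0 \<Longrightarrow> b * (norm x)\<^sup>2 \<le> lorentz x x"
    using timelike_orthogonal_coercive by blast
  let ?A = "matrix_power A"
  define V where "V = {v. lorentz p v = 0 \<and> lorentz q v = 0}"
  have form: "lorentz (?A n *v v) (?A n *v w) = lorentz v w" for n v w
    using lox matrix_power_in preserves_lorentz by blast
  have V: "?A n *v v \<in> V" if "v \<in> V" for n v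
  proof -
    have "c ^ n *\<^sub>R lorentz p (?A n *v v) = lorentz (?A n *v p) (?A n *v v)"
      "inverse c ^ n *\<^sub>R lorentz q (?A n *v v) = lorentz (?A n *v q) (?A n *v v)"
      using lox matrix_power_eigenvector[of A p c n] matrix_power_eigenvector[of A q "inverse c" n]
      by (simp_all add: lorentz.scaleR_left)
    then show ?thesis using that lox by (simp add: form V_def)
  qed
  have Vdiff: "v - w \<in> V" if "v \<in> V" "w \<in> V" for v w
    using that by (simp add: V_def lorentz.diff_right)
  have bV: "b * (norm v)\<^sup>2 \<le> lorentz v v" if "v \<in> V" for v
    using b(2) that by (simp add: V_def lorentz.add_left)
  have bdd: "bounded (range (\<lambda>n. ?A n *v v))" if "v \<in> V" for v
  proof (rule boundedI, clarify)
    fix n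
    have "b * (norm (?A n *v v))\<^sup>2 \<le> lorentz v v" using bV[OF V[OF that]] form by metis
    then have "(norm (?A n *v v))\<^sup>2 \<le> lorentz v v / b" using b(1) by (simp add: field_simps)
    then show "norm (?A n *v v) \<le> sqrt (lorentz v v / b)" by (rule real_le_rsqrt)
  qed
  have xy: "x \<in> V" "y \<in> V" using x y by (simp_all add: V_def)
  have "bounded (range (\<lambda>n. (?A n *v x, ?A n *v y)))"
    by (rule bounded_subset[OF bounded_Times[OF bdd[OF xy(1)] bdd[OF xy(2)]]]) auto
  then obtain l r where r: "strict_mono r" "((\<lambda>n. (?A n *v x, ?A n *v y)) \<circ> r) \<longlonglongrightarrow> l"
    by (rule bounded_seq_convergent_subseq)
  \<comment> \<open>The exponents \<open>r (2 j)\<close> and \<open>r j\<close> have the same limit, and their difference is at least \<open>j\<close>.\<close>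
  define k where "k j = r (2 * j) - r j" for j
  have rk: "r (2 * j) = r j + k j" for j
    using strict_mono_less_eq[OF r(1), of j "2 * j"] by (simp add: k_def)
  have kj: "k j \<ge> j" for j
  proof -
    have "r (i + j) \<ge> r j + i" for i
    proof (induction i)
      case (Suc i)
      then show ?case using strict_monoD[OF r(1), of "i + j" "Suc i + j"] by simp
    qed simp
    from this[of j] show ?thesis by (simp add: k_def mult_2)
  qed
  have rec: "(\<lambda>j. ?A (k j) *v v) \<longlonglongrightarrow> v" if v: "v \<in> V" and lim: "(\<lambda>n. ?A (r n) *v v) \<longlonglongrightarrow> l'" for v l'
  proof -
    have "strict_mono (\<lambda>j :: nat. 2 * j)" by (simp add: strict_mono_def)
    from LIMSEQ_subseq_LIMSEQ[OF lim this]
    have "(\<lambda>j. ?A (r (2 * j)) *v v - ?A (r j) *v v) \<longlonglongrightarrow> l' - l'"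
      by (intro tendsto_diff lim) (simp add: o_def)
    then have lim0: "(\<lambda>j. ?A (r (2 * j)) *v v - ?A (r j) *v v) \<longlonglongrightarrow> 0" by simp
    have "(\<lambda>j. lorentz (?A (r (2 * j)) *v v - ?A (r j) *v v) (?A (r (2 * j)) *v v - ?A (r j) *v v)) \<longlonglongrightarrow> 0"
      using lorentz.tendsto[OF lim0 lim0] by (simp add: lorentz.zero_left)
    moreover have "?A (r (2 * j)) *v v - ?A (r j) *v v = ?A (r j) *v (?A (k j) *v v - v)" for j
      by (simp add: rk matrix_power_add matrix_vector_mul_assoc matrix_vector_mult_diff_distrib)
    ultimately have "(\<lambda>j. lorentz (?A (k j) *v v - v) (?A (k j) *v v - v)) \<longlonglongrightarrow> 0"
      by (simp add: form lorentz.zero_left)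
    then have lim: "(\<lambda>j. lorentz (?A (k j) *v v - v) (?A (k j) *v v - v) / b) \<longlonglongrightarrow> 0"
      by (rule tendsto_divide_zero)
    have le: "(norm (?A (k j) *v v - v))\<^sup>2 \<le> lorentz (?A (k j) *v v - v) (?A (k j) *v v - v) / b" for j
      using bV[OF Vdiff[OF V[OF v] v]] b(1) by (simp add: pos_le_divide_eq mult.commute)
    have "(\<lambda>j. (norm (?A (k j) *v v - v))\<^sup>2) \<longlonglongrightarrow> 0"
      by (rule tendsto_sandwich[OF _ _ tendsto_const lim]) (simp_all add: le)
    then have "(\<lambda>j. ?A (k j) *v v - v) \<longlonglongrightarrow> 0"
      by (simp add: tendsto_norm_zero_iff)
    then show ?thesis by (simp add: LIM_zero_iff)
  qed
  show thesis
  proof (rule that[OF kj])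
    show "(\<lambda>j. ?A (k j) *v x) \<longlonglongrightarrow> x" "(\<lambda>j. ?A (k j) *v y) \<longlonglongrightarrow> y"
      using tendsto_fst[OF r(2)] tendsto_snd[OF r(2)] by (auto simp: o_def intro: rec[OF xy(1)] rec[OF xy(2)])
  qed
qed

lemma loxodromic_power_inj:
  assumes "loxodromic A p q c"
  shows "inj (matrix_power A)"
proof (rule injI)
  fix m n assume "matrix_power A m = matrix_power A n"
  moreover have "matrix_power A k *v p = c ^ k *\<^sub>R p" for k
    using assms by (auto simp: loxodromic_def intro: matrix_power_eigenvector)
  ultimately have "c ^ m *\<^sub>R p = c ^ n *\<^sub>R p" by metis
  then have "c ^ m = c ^ n" using assms null_sphere_nonzero by (auto simp: loxodromic_def)
  then show "m = n" using assms by (simp add: loxodromic_def)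
qed

end

section \<open>Projective space\<close>

lemma hclass_scale: "z \<noteq> 0 \<Longrightarrow> c \<noteq> 0 \<Longrightarrow> hclass (c *s z) = hclass z"
  using hclass_eq_iff[of z "c *s z"] by auto

lemma cproj_cases: obtains z where "z \<noteq> 0" "x = hclass z"
  using rep_cproj_nonzero hclass_rep_cproj by metis

lemma open_lift: "open U \<Longrightarrow> open {z. z \<noteq> 0 \<and> hclass z \<in> U}"
  by (simp add: open_cproj_def)

lemma continuous_on_vector_scalar_mult:
  "continuous_on S c \<Longrightarrow> continuous_on S f \<Longrightarrow> continuous_on S (\<lambda>x. c x *s (f x :: complex ^ 'n::finite))"
  unfolding vector_scalar_mult_def by (intro continuous_intros)

lemma tendsto_vector_scalar_mult:
  "(c \<longlongrightarrow> a) F \<Longrightarrow> (f \<longlongrightarrow> b) F \<Longrightarrow> ((\<lambda>x. c x *s (f x :: complex ^ 'n::finite)) \<longlongrightarrow> a *s b) F"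
  unfolding vector_scalar_mult_def by (intro tendsto_intros)

lemma open_hclass_image:
  assumes V: "open V" "0 \<notin> V"
  shows "open (hclass ` V)"
proof -
  have "{z. z \<noteq> 0 \<and> hclass z \<in> hclass ` V} = (\<Union>c\<in>-{0}. (\<lambda>z. c *s z) -` V)"
  proof (intro Set.set_eqI iffI)
    fix z assume "z \<in> {z. z \<noteq> 0 \<and> hclass z \<in> hclass ` V}"
    then obtain v where v: "z \<noteq> 0" "v \<in> V" "hclass z = hclass v" by auto
    then have "v \<noteq> 0" using V(2) by auto
    then show "z \<in> (\<Union>c\<in>-{0}. (\<lambda>z. c *s z) -` V)"
      using v hclass_eq_iff[of z v] by auto
  next
    fix z assume "z \<in> (\<Union>c\<in>-{0}. (\<lambda>z. c *s z) -` V)"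
    then obtain c where c: "c \<noteq> 0" "c *s z \<in> V" by auto
    then have "z \<noteq> 0" using V(2) by auto
    then show "z \<in> {z. z \<noteq> 0 \<and> hclass z \<in> hclass ` V}"
      using c hclass_scale[of z c] by (auto intro!: image_eqI[of _ _ "c *s z"])
  qed
  moreover have "open ((\<lambda>z. c *s z) -` V)" for c
    by (intro open_vimage V continuous_on_vector_scalar_mult continuous_intros)
  ultimately show ?thesis unfolding open_cproj_def by auto
qed

lemma continuous_on_hclass: "0 \<notin> S \<Longrightarrow> continuous_on S hclass"
proof -
  assume S: "0 \<notin> S"
  show ?thesis
    unfolding continuous_on_open_invariant
  proof (intro allI impI)
    fix B :: "'a cproj set" assume "open B"
    then show "\<exists>A. open A \<and> A \<inter> S = hclass -` B \<inter> S"
      using S by (intro exI[of _ "{z. z \<noteq> 0 \<and> hclass z \<in> B}"]) (auto simp: open_lift)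
  qed
qed

lemma eventually_hclass:
  assumes "f \<longlonglongrightarrow> z" "z \<noteq> 0" "open U" "hclass z \<in> U"
  shows "\<forall>\<^sub>F n in sequentially. f n \<noteq> 0 \<and> hclass (f n) \<in> U"
  using topological_tendstoD[OF assms(1) open_lift[OF assms(3)]] assms by auto

text \<open>Proportionality is the vanishing of all two by two minors, which is a closed condition.\<close>

lemma proportional_iff_minors:
  fixes z w :: "complex ^ 'n::finite"
  assumes "z \<noteq> 0" "w \<noteq> 0"
  shows "hclass z = hclass w \<longleftrightarrow> (\<forall>i j. z $ i * w $ j = z $ j * w $ i)"
proof
  assume "hclass z = hclass w"
  then show "\<forall>i j. z $ i * w $ j = z $ j * w $ i"
    using assms by (auto simp: hclass_eq_iff)
next
  assume m: "\<forall>i j. z $ i * w $ j = z $ j * w $ i"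
  obtain i where i: "z $ i \<noteq> 0" using assms(1) by (auto simp: vec_eq_iff)
  define c where "c = w $ i / z $ i"
  have "w $ j = c * z $ j" for j
    using m[rule_format, of i j] i by (simp add: c_def field_simps)
  then have w: "w = c *s z" by (simp add: vec_eq_iff)
  then have "c \<noteq> 0" using assms(2) by auto
  then show "hclass z = hclass w" using w assms by (auto simp: hclass_eq_iff)
qed

instance cproj :: (finite) t2_space
proof
  fix x y :: "'a cproj" assume xy: "x \<noteq> y"
  obtain z where z: "z \<noteq> 0" "x = hclass z" by (rule cproj_cases)
  obtain w where w: "w \<noteq> 0" "y = hclass w" by (rule cproj_cases)
  obtain i j where ij: "z $ i * w $ j \<noteq> z $ j * w $ i"
    using xy proportional_iff_minors[OF z(1) w(1)] z w by auto
  have "open {v. fst v $ i * snd v $ j \<noteq> fst v $ j * (snd v :: complex ^ 'a) $ i}"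
    by (intro open_Collect_neq continuous_intros)
  then have "open ({v. fst v $ i * snd v $ j \<noteq> fst v $ j * (snd v :: complex ^ 'a) $ i} \<inter> (-{0}) \<times> (-{0}))"
    by (intro open_Int open_Times) auto
  moreover have "(z, w) \<in> {v. fst v $ i * snd v $ j \<noteq> fst v $ j * (snd v :: complex ^ 'a) $ i} \<inter> (-{0}) \<times> (-{0})"
    using ij z w by auto
  ultimately obtain A B where AB: "open A" "open B" "(z, w) \<in> A \<times> B"
      "A \<times> B \<subseteq> {v. fst v $ i * snd v $ j \<noteq> fst v $ j * (snd v :: complex ^ 'a) $ i} \<inter> (-{0}) \<times> (-{0})"
    by (rule open_prod_elim)
  have nz: "0 \<notin> A" "0 \<notin> B" using AB(3,4) by auto
  have "hclass ` A \<inter> hclass ` B = {}"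
  proof (rule ccontr)
    assume "hclass ` A \<inter> hclass ` B \<noteq> {}"
    then obtain a b where ab: "a \<in> A" "b \<in> B" "hclass a = hclass b" by auto
    then have "a $ i * b $ j = a $ j * b $ i"
      using proportional_iff_minors[of a b] nz by auto
    moreover have "(a, b) \<in> A \<times> B" using ab by simp
    ultimately show False using AB(4) by auto
  qed
  then show "\<exists>U V. open U \<and> open V \<and> x \<in> U \<and> y \<in> V \<and> U \<inter> V = {}"
    using open_hclass_image[OF AB(1) nz(1)] open_hclass_image[OF AB(2) nz(2)] AB(3) z w
    by (intro exI[of _ "hclass ` A"] exI[of _ "hclass ` B"]) auto
qed

section \<open>Real and complex forms\<close>

definition re_vec :: "complex ^ 'n \<Rightarrow> real ^ 'n" where "re_vec z = (\<chi> i. Re (z $ i))"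

definition im_vec :: "complex ^ 'n \<Rightarrow> real ^ 'n" where "im_vec z = (\<chi> i. Im (z $ i))"

definition complex_vec :: "real ^ 'n \<Rightarrow> real ^ 'n \<Rightarrow> complex ^ 'n"
  where "complex_vec x y = (\<chi> i. Complex (x $ i) (y $ i))"

text \<open>The complex bilinear extension of the form, with a real first argument and as a quadratic
  form.\<close>

definition clorentz :: "real ^ ('m::finite option) \<Rightarrow> complex ^ ('m option) \<Rightarrow> complex"
  where "clorentz u z = Complex (lorentz u (re_vec z)) (lorentz u (im_vec z))"

definition cquad :: "complex ^ ('m::finite option) \<Rightarrow> complex"
  where "cquad z = (\<Sum>i\<in>UNIV. (z $ Some i)\<^sup>2) - (z $ None)\<^sup>2"

text \<open>The Gram matrix of the real and imaginary parts of \<open>z\<close> has trace \<open>\<langle>z, z\<rangle>\<close> and determinant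
  \<open>(\<langle>z, z\<rangle>\<^sup>2 - |cquad z|\<^sup>2) / 4\<close>; its smaller eigenvalue is \<open>gap z / 2\<close>.\<close>

definition gap :: "complex ^ ('m::finite option) \<Rightarrow> real"
  where "gap z = Re (herm z z) - cmod (cquad z)"

lemma re_im_vec_simps [simp]:
  "re_vec (complex_vec x y) = x" "im_vec (complex_vec x y) = y"
  "complex_vec (re_vec z) (im_vec z) = z"
  "re_vec (z + w) = re_vec z + re_vec w" "im_vec (z + w) = im_vec z + im_vec w"
  "re_vec (z - w) = re_vec z - re_vec w" "im_vec (z - w) = im_vec z - im_vec w"
  "re_vec 0 = 0" "im_vec 0 = 0"
  by (simp_all add: re_vec_def im_vec_def complex_vec_def vec_eq_iff)

lemma re_im_vec_scale:
  "re_vec (c *s z) = Re c *\<^sub>R re_vec z - Im c *\<^sub>R im_vec z"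
  "im_vec (c *s z) = Im c *\<^sub>R re_vec z + Re c *\<^sub>R im_vec z"
  by (simp_all add: re_vec_def im_vec_def vec_eq_iff)

lemma re_im_vec_complexify:
  "re_vec (complexify A *v z) = A *v re_vec z" "im_vec (complexify A *v z) = A *v im_vec z"
  by (simp_all add: re_vec_def im_vec_def vec_eq_iff matrix_vector_mult_def)

lemma re_im_vec_eqI: "re_vec z = re_vec w \<Longrightarrow> im_vec z = im_vec w \<Longrightarrow> z = w"
  by (simp add: re_vec_def im_vec_def vec_eq_iff complex_eq_iff)

lemma tendsto_re_im_vec [tendsto_intros]:
  fixes f :: "'a \<Rightarrow> complex ^ 'n::finite"
  assumes "(f \<longlongrightarrow> z) F"
  shows "((\<lambda>x. re_vec (f x)) \<longlongrightarrow> re_vec z) F" "((\<lambda>x. im_vec (f x)) \<longlongrightarrow> im_vec z) F"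
  unfolding re_vec_def im_vec_def by (intro tendsto_intros assms)+

lemma tendsto_complex_vec [tendsto_intros]:
  fixes f g :: "'a \<Rightarrow> real ^ 'n::finite"
  assumes "(f \<longlongrightarrow> x) F" "(g \<longlongrightarrow> y) F"
  shows "((\<lambda>a. complex_vec (f a) (g a)) \<longlongrightarrow> complex_vec x y) F"
  unfolding complex_vec_def by (intro tendsto_intros assms)

lemma herm_self: "herm z z = of_real (lorentz (re_vec z) (re_vec z) + lorentz (im_vec z) (im_vec z))"
proof -
  have *: "w * cnj w = of_real ((Re w)\<^sup>2 + (Im w)\<^sup>2)" for w
    by (rule complex_mult_cnj)
  show ?thesis
    unfolding herm_def * lorentz_def re_vec_def im_vec_def
    by (simp add: sum.distrib power2_eq_square)
qed

lemma cquad_lorentz: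
  "cquad z = Complex (lorentz (re_vec z) (re_vec z) - lorentz (im_vec z) (im_vec z))
    (2 * lorentz (re_vec z) (im_vec z))"
  by (simp add: cquad_def lorentz_def re_vec_def im_vec_def complex_eq_iff power2_eq_square
      sum_subtractf sum_distrib_left algebra_simps)

lemma cquad_scale: "cquad (c *s z) = c\<^sup>2 * cquad z"
  by (simp add: cquad_def power_mult_distrib sum_distrib_left right_diff_distrib)

lemma herm_scale: "herm (c *s z) (c *s z) = of_real ((cmod c)\<^sup>2) * herm z z"
proof -
  have "c * cnj c = of_real ((cmod c)\<^sup>2)" by (rule complex_norm_square[symmetric])
  then have *: "c * a * cnj (c * a) = of_real ((cmod c)\<^sup>2) * (a * cnj a)" for a
    by (simp add: algebra_simps)
  show ?thesis by (simp only: herm_def vector_smult_component * sum_distrib_left right_diff_distrib)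
qed

lemma gap_scale: "gap (c *s z) = (cmod c)\<^sup>2 * gap z"
  by (simp add: gap_def cquad_scale herm_scale norm_mult norm_power right_diff_distrib)

lemma clorentz_scale: "clorentz u (c *s z) = c * clorentz u z"
  by (simp add: clorentz_def re_im_vec_scale complex_eq_iff lorentz.diff_right lorentz.add_right
      lorentz.scaleR_right)

lemma clorentz_scaleR: "clorentz (b *\<^sub>R u) z = of_real b * clorentz u z"
  by (simp add: clorentz_def complex_eq_iff lorentz.scaleR_left)

lemma clorentz_add: "clorentz u (z + w) = clorentz u z + clorentz u w"
  by (simp add: clorentz_def complex_eq_iff lorentz.add_right)

lemma clorentz_diff: "clorentz u (z - w) = clorentz u z - clorentz u w"
  by (simp add: clorentz_def complex_eq_iff lorentz.diff_right)

lemma clorentz_real: "clorentz u (complex_vec x 0) = of_real (lorentz u x)"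
  by (simp add: clorentz_def complex_eq_iff lorentz.zero_right)

lemma tendsto_clorentz:
  assumes "(f \<longlongrightarrow> u) F" "(g \<longlongrightarrow> z) F"
  shows "((\<lambda>x. clorentz (f x) (g x)) \<longlongrightarrow> clorentz u z) F"
  unfolding clorentz_def by (intro tendsto_intros lorentz.tendsto assms)

lemma tendsto_herm:
  assumes "(f \<longlongrightarrow> z) F"
  shows "((\<lambda>x. herm (f x) (f x)) \<longlongrightarrow> herm z z) F"
  unfolding herm_def by (intro tendsto_intros assms)

lemma tendsto_cquad:
  assumes "(f \<longlongrightarrow> z) F"
  shows "((\<lambda>x. cquad (f x)) \<longlongrightarrow> cquad z) F"
  unfolding cquad_def by (intro tendsto_intros assms)

text \<open>Multiplying \<open>z\<close> by a unimodular number rotates the quadratic form; the rotation that makes it real and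
  nonpositive diagonalizes the Gram matrix of the real and imaginary parts.\<close>

lemma exists_phase:
  obtains c where "cmod c = 1" "lorentz (re_vec (c *s z)) (re_vec (c *s z)) = gap z / 2"
    "lorentz (im_vec (c *s z)) (im_vec (c *s z)) = (Re (herm z z) + cmod (cquad z)) / 2"
    "lorentz (re_vec (c *s z)) (im_vec (c *s z)) = 0"
proof -
  obtain c where c: "cmod c = 1" "c\<^sup>2 * cquad z = - of_real (cmod (cquad z))"
  proof (cases "cquad z = 0")
    case False
    let ?c = "csqrt (- of_real (cmod (cquad z)) / cquad z)"
    have sq: "?c\<^sup>2 = - of_real (cmod (cquad z)) / cquad z" by simp
    then have "(cmod ?c)\<^sup>2 = 1" using False by (simp add: norm_power[symmetric] norm_divide)
    then have "cmod ?c = 1" by (simp add: power2_eq_1_iff)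
    then show thesis using that[of ?c] sq False by simp
  qed (use that[of 1] in simp)
  let ?x = "re_vec (c *s z)" and ?y = "im_vec (c *s z)"
  have "cquad (c *s z) = - of_real (cmod (cquad z))" by (simp add: cquad_scale c)
  then have 1: "lorentz ?x ?x - lorentz ?y ?y = - cmod (cquad z)" "lorentz ?x ?y = 0"
    by (simp_all add: cquad_lorentz complex_eq_iff)
  have "herm (c *s z) (c *s z) = herm z z" by (simp add: herm_scale c)
  then have 2: "lorentz ?x ?x + lorentz ?y ?y = Re (herm z z)"
    by (metis Re_complex_of_real herm_self)
  show thesis
  proof (rule that[OF c(1) _ _ 1(2)])
    show "lorentz ?x ?x = gap z / 2" using 1(1) 2 by (simp add: gap_def)
    show "lorentz ?y ?y = (Re (herm z z) + cmod (cquad z)) / 2" using 1(1) 2 by simp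
  qed
qed

text \<open>A common tangent vector of the light cone constrains the Gram matrix: the orthogonal complement
  of a null vector is positive semidefinite, and in dimension three it contains no definite
  plane.\<close>

lemma tangent_gap_nonneg:
  assumes u: "u \<in> null_sphere" and z: "clorentz u z = 0"
  shows "gap z \<ge> 0"
proof -
  obtain c where c: "lorentz (re_vec (c *s z)) (re_vec (c *s z)) = gap z / 2"
    using exists_phase[of z] by metis
  have "clorentz u (c *s z) = 0" by (simp add: clorentz_scale z)
  then have "lorentz u (re_vec (c *s z)) = 0" by (simp add: clorentz_def complex_eq_iff)
  then have "lorentz (re_vec (c *s z)) (re_vec (c *s z)) \<ge> 0"
    using lorentz_orthogonal_null[of u] u null_sphere_nonzero[OF u] by (simp add: null_sphere_def)
  then show ?thesis using c by simp
qed

lemma tangent_gap_zero: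
  fixes z :: "complex ^ ('m::finite option)"
  assumes m: "CARD('m) = 2" and u: "u \<in> null_sphere" and z: "clorentz u z = 0"
  shows "gap z = 0"
proof (rule ccontr)
  assume "gap z \<noteq> 0"
  then have gap: "gap z > 0" using tangent_gap_nonneg[OF u z] by simp
  obtain c where c: "lorentz (re_vec (c *s z)) (re_vec (c *s z)) = gap z / 2"
    "lorentz (im_vec (c *s z)) (im_vec (c *s z)) = (Re (herm z z) + cmod (cquad z)) / 2"
    "lorentz (re_vec (c *s z)) (im_vec (c *s z)) = 0"
    using exists_phase[of z] by metis
  define x y where "x = re_vec (c *s z)" and "y = im_vec (c *s z)"
  have "clorentz u (c *s z) = 0" by (simp add: clorentz_scale z)
  then have ux: "lorentz u x = 0" "lorentz u y = 0"
    by (simp_all add: clorentz_def complex_eq_iff x_def y_def)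
  have xx: "lorentz x x > 0" using c(1) gap by (simp add: x_def)
  have "Re (herm z z) + cmod (cquad z) > 0" using gap by (simp add: gap_def) (smt (verit) norm_ge_zero)
  then have yy: "lorentz y y > 0" using c(2) by (simp add: y_def)
  have xy: "lorentz x y = 0" using c(3) by (simp add: x_def y_def)
  have uu: "lorentz u u = 0" "u \<noteq> 0" using u null_sphere_nonzero by (auto simp: null_sphere_def)
  have s1: "y \<notin> span {}" using yy by (auto simp: lorentz.zero_left)
  have s2: "x \<notin> span {y}"
  proof
    assume "x \<in> span {y}"
    then obtain k where k: "x = k *\<^sub>R y" by (auto simp: span_singleton)
    then have "k * lorentz y y = 0" using xy by (simp add: lorentz.scaleR_left)
    then show False using yy xx k by (auto simp: lorentz.zero_left)
  qed
  have s3: "u \<notin> span {x, y}"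
  proof
    assume "u \<in> span {x, y}"
    then obtain k l where kl: "u = k *\<^sub>R x + l *\<^sub>R y"
      by (auto simp: span_insert span_singleton algebra_simps)
    have "k * lorentz x x = 0"
      using ux(1) xy by (simp add: kl lorentz.add_left lorentz.scaleR_left lorentz_commute[of y x])
    moreover have "l * lorentz y y = 0"
      using ux(2) xy by (simp add: kl lorentz.add_left lorentz.scaleR_left)
    ultimately show False using xx yy uu(2) kl by simp
  qed
  have ind: "independent {u, x, y}"
    using s1 s2 s3 by (intro independent_insertI) (simp_all add: independent_empty)
  have "card {u, x, y} = 3"
    using s1 s2 s3 by (metis card_3_iff insertI1 insert_commute span_base)
  moreover have "DIM(real ^ ('m option)) = 3" using m by simp
  ultimately have "UNIV \<subseteq> span {u, x, y}"
    using ind by (intro card_ge_dim_independent) (auto simp: dim_UNIV)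
  moreover have "span {u, x, y} \<subseteq> {v. lorentz u v = 0}"
    by (rule span_minimal) (use ux uu in \<open>auto simp: subspace_def lorentz.zero_right lorentz.add_right lorentz.scaleR_right\<close>)
  ultimately have "origin \<in> {v. lorentz u v = 0}" by blast
  then show False using u by (simp add: null_sphere_def)
qed

text \<open>If both forms vanish, then the real and imaginary parts are null and orthogonal, hence proportional.\<close>

lemma null_complex_vector:
  assumes "herm z z = 0" "cquad z = 0" "z \<noteq> 0"
  obtains u k where "u \<in> null_sphere" "k \<noteq> 0" "z = k *s complex_vec u 0"
proof -
  let ?x = "re_vec z" and ?y = "im_vec z"
  have 1: "lorentz ?x ?x + lorentz ?y ?y = 0" using assms(1) by (simp add: herm_self flip: of_real_add)
  have 2: "lorentz ?x ?x = lorentz ?y ?y" "lorentz ?x ?y = 0"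
    using assms(2) by (simp_all add: cquad_lorentz complex_eq_iff)
  have 3: "lorentz ?x ?x = 0" "lorentz ?y ?y = 0" using 1 2(1) by auto
  show thesis
  proof (cases "?x = 0")
    case True
    then have y: "?y \<noteq> 0" using assms(3) re_im_vec_eqI[of z 0] by auto
    note n = null_sphere_normalize[OF 3(2) y]
    define u where "u = (1 / ?y $ None) *\<^sub>R ?y"
    show thesis
    proof (rule that[of u "\<i> * of_real (?y $ None)"])
      show "z = (\<i> * of_real (?y $ None)) *s complex_vec u 0"
        using n True by (intro re_im_vec_eqI) (simp_all add: re_im_vec_scale u_def)
    qed (use n in \<open>simp_all add: u_def\<close>)
  next
    case False
    note n = null_sphere_normalize[OF 3(1) False]
    define u where "u = (1 / ?x $ None) *\<^sub>R ?x"
    have x: "?x = (?x $ None) *\<^sub>R u" using n by (simp add: u_def)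
    have "lorentz u ?y = 0" using 2(2) by (simp add: u_def lorentz.scaleR_left)
    then have y: "?y = (?y $ None) *\<^sub>R u"
      using null_orthogonal_null_sphere[of u ?y] n 3(2) by (simp add: u_def)
    show thesis
    proof (rule that[of u "Complex (?x $ None) (?y $ None)"])
      show "z = Complex (?x $ None) (?y $ None) *s complex_vec u 0"
        using x y by (intro re_im_vec_eqI) (simp_all add: re_im_vec_scale)
      show "Complex (?x $ None) (?y $ None) \<noteq> 0" using n by (simp add: complex_eq_iff)
    qed (use n in \<open>simp add: u_def\<close>)
  qed
qed

lemma real_null_vector:
  assumes "u \<in> null_sphere"
  shows "complex_vec u 0 \<noteq> 0" "herm (complex_vec u 0) (complex_vec u 0) = 0" "cquad (complex_vec u 0) = 0"
    "clorentz u (complex_vec u 0) = 0"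
proof -
  show "complex_vec u 0 \<noteq> 0"
    using re_im_vec_simps(1)[of u 0] null_sphere_nonzero[OF assms] by (metis re_im_vec_simps(8))
qed (use assms in \<open>simp_all add: herm_self cquad_lorentz clorentz_real null_sphere_def complex_eq_iff lorentz.zero_left lorentz.zero_right\<close>)

lemma bdry_HR_null_sphere: "bdry_HR = (\<lambda>u. hclass (complex_vec u 0)) ` null_sphere"
proof (intro Set.set_eqI iffI)
  fix x :: "('a option) cproj" assume "x \<in> bdry_HR"
  then obtain z w where z: "x = hclass z" "z \<noteq> 0" "herm z z = 0"
    and w: "x = hclass w" "w \<noteq> 0" "\<And>i. w $ i \<in> \<real>"
    unfolding bdry_HR_def bdry_HC_def PR_def by blast
  obtain c where c: "w = c *s z" using hclass_eq_iff[OF z(2) w(2)] z(1) w(1) by auto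
  have "herm w w = 0" by (simp add: c herm_scale z(3))
  moreover have "im_vec w = 0" using w(3) by (simp add: im_vec_def vec_eq_iff complex_is_Real_iff)
  ultimately have "cquad w = 0"
    by (simp add: herm_self cquad_lorentz complex_eq_iff lorentz.zero_left lorentz.zero_right flip: of_real_add)
  then obtain u k where "u \<in> null_sphere" "k \<noteq> 0" "w = k *s complex_vec u 0"
    using null_complex_vector \<open>herm w w = 0\<close> w(2) by blast
  then show "x \<in> (\<lambda>u. hclass (complex_vec u 0)) ` null_sphere"
    using w(1) hclass_scale real_null_vector(1) by blast
next
  fix x :: "('a option) cproj" assume "x \<in> (\<lambda>u. hclass (complex_vec u 0)) ` null_sphere"
  then obtain u where u: "u \<in> null_sphere" "x = hclass (complex_vec u 0)" by auto
  have "\<forall>i. complex_vec u 0 $ i \<in> \<real>" by (simp add: complex_vec_def complex_is_Real_iff)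
  then show "x \<in> bdry_HR"
    using real_null_vector[OF u(1)] u(2) by (auto simp: bdry_HR_def bdry_HC_def PR_def)
qed

lemma HR_timelike:
  assumes "p \<in> HR"
  obtains x where "lorentz x x < 0" "p = hclass (complex_vec x 0)" "complex_vec x 0 \<noteq> 0"
proof -
  obtain z w where z: "p = hclass z" "z \<noteq> 0" "Re (herm z z) < 0"
    and w: "p = hclass w" "w \<noteq> 0" "\<And>i. w $ i \<in> \<real>"
    using assms unfolding HR_def HC_def PR_def by blast
  obtain c where c: "w = c *s z" "c \<noteq> 0" using hclass_eq_iff[OF z(2) w(2)] z(1) w(1) by auto
  have "Re (herm w w) < 0" using z(3) c(2) by (simp add: c herm_scale mult_pos_neg)
  moreover have im: "im_vec w = 0" using w(3) by (simp add: im_vec_def vec_eq_iff complex_is_Real_iff)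
  ultimately have "lorentz (re_vec w) (re_vec w) < 0"
    by (simp add: herm_self lorentz.zero_left)
  moreover have "w = complex_vec (re_vec w) 0" using im by (intro re_im_vec_eqI) simp_all
  ultimately show thesis using that w by metis
qed

section \<open>Cluster points\<close>

context discrete_lorentz_group
begin

lemma invertible_complexify:
  assumes A: "A \<in> \<Gamma>" shows "invertible (complexify A)"
proof -
  have mult: "complexify (B ** C) = complexify B ** complexify C" for B C :: "real ^ ('m option) ^ ('m option)"
    by (simp add: vec_eq_iff matrix_matrix_mult_def)
  have one: "complexify (mat 1 :: real ^ ('m option) ^ ('m option)) = mat 1"
    by (simp add: vec_eq_iff mat_def)
  show ?thesis
    unfolding invertible_def
    by (rule exI[of _ "complexify (lorentz_adjoint A)"])
       (simp add: mult[symmetric] inverse_mult[OF A] one)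
qed

lemma complexify_nonzero: "A \<in> \<Gamma> \<Longrightarrow> z \<noteq> 0 \<Longrightarrow> complexify A *v z \<noteq> 0"
  by (metis invertible_complexify invertible_left_inverse matrix_left_invertible_ker)

lemma proj_act_complexify: "A \<in> \<Gamma> \<Longrightarrow> z \<noteq> 0 \<Longrightarrow> proj_act (complexify A) (hclass z) = hclass (complexify A *v z)"
  by (rule proj_act_hclass[OF invertible_complexify])

lemma inj_complexify: "inj (complexify :: real ^ 'n::finite ^ 'n \<Rightarrow> _)"
  by (rule injI) (simp add: vec_eq_iff)

lemma infinite_complexify_iff:
  "infinite {g \<in> complexify ` \<Gamma>. P g} \<longleftrightarrow> infinite {A \<in> \<Gamma>. P (complexify A)}"
proof -
  have "{g \<in> complexify ` \<Gamma>. P g} = complexify ` {A \<in> \<Gamma>. P (complexify A)}" by auto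
  moreover have "inj_on complexify {A \<in> \<Gamma>. P (complexify A)}"
    using inj_complexify by (rule inj_on_subset) simp
  ultimately show ?thesis by (simp only: finite_image_iff)
qed

lemma herm_complexify: "A \<in> \<Gamma> \<Longrightarrow> herm (complexify A *v z) (complexify A *v z) = herm z z"
  by (simp add: herm_self re_im_vec_complexify preserves_lorentz)

lemma cquad_complexify: "A \<in> \<Gamma> \<Longrightarrow> cquad (complexify A *v z) = cquad z"
  by (simp add: cquad_lorentz re_im_vec_complexify preserves_lorentz)

lemma clorentz_complexify: "A \<in> \<Gamma> \<Longrightarrow> clorentz (A *v u) (complexify A *v z) = clorentz u z"
  by (simp add: clorentz_def re_im_vec_complexify preserves_lorentz)

text \<open>Lifting to vectors and choosing the elements outside the finite sets of bounded corner entry makes the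
  sequence diverge.\<close>

lemma cluster_sequence:
  assumes "x \<in> cluster_points (complexify ` \<Gamma>) K"
  obtains g z w c l where "\<And>n. g n \<in> \<Gamma>" "filterlim (\<lambda>n. g n $ None $ None) at_top sequentially"
    "\<And>n. norm (z n) = 1" "\<And>n. hclass (z n) \<in> K"
    "\<And>n. complexify (g n) *v z n = c n *s w n" "\<And>n. c n \<noteq> 0" "w \<longlonglongrightarrow> l" "l \<noteq> 0" "x = hclass l"
proof -
  obtain l where l: "l \<noteq> 0" "x = hclass l" by (rule cproj_cases)
  define V where "V n = ball l (1 / real (Suc n)) - {0}" for n
  have inf: "infinite {A \<in> \<Gamma>. proj_act (complexify A) ` K \<inter> hclass ` V n \<noteq> {}}" for n
  proof -
    have "open (hclass ` V n)" by (rule open_hclass_image) (auto simp: V_def)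
    moreover have "x \<in> hclass ` V n" using l by (auto simp: V_def)
    ultimately show ?thesis
      using assms infinite_complexify_iff[of "\<lambda>g. proj_act g ` K \<inter> hclass ` V n \<noteq> {}"]
      by (simp add: cluster_points_def)
  qed
  have "\<exists>A z w c. A \<in> \<Gamma> \<and> A $ None $ None > real n \<and> norm z = 1 \<and> hclass z \<in> K \<and>
      complexify A *v z = c *s w \<and> c \<noteq> 0 \<and> w \<in> V n" for n
  proof -
    have "\<not> {A \<in> \<Gamma>. proj_act (complexify A) ` K \<inter> hclass ` V n \<noteq> {}} \<subseteq> {A \<in> \<Gamma>. A $ None $ None \<le> real n}"
      using inf[of n] finite_bounded_corner finite_subset by blast
    then obtain A where "A \<in> {A \<in> \<Gamma>. proj_act (complexify A) ` K \<inter> hclass ` V n \<noteq> {}}"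
      "A \<notin> {A \<in> \<Gamma>. A $ None $ None \<le> real n}" by blast
    then have A: "A \<in> \<Gamma>" "A $ None $ None > real n" "proj_act (complexify A) ` K \<inter> hclass ` V n \<noteq> {}"
      by (simp_all add: not_le)
    then obtain y w where y: "y \<in> K" "proj_act (complexify A) y = hclass w" "w \<in> V n" by auto
    obtain z0 where z0: "z0 \<noteq> 0" "y = hclass z0" by (rule cproj_cases)
    define z where "z = of_real (1 / norm z0) *s z0"
    have "z = (1 / norm z0) *\<^sub>R z0"
      by (simp add: z_def vec_eq_iff vector_scalar_mult_def scaleR_conv_of_real[where 'a = complex])
    then have z: "norm z = 1" using z0 by simp
    then have z': "z \<noteq> 0" "hclass z = y"
      using z0 hclass_scale[of z0 "of_real (1 / norm z0)"] by (auto simp: z_def)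
    have "w \<noteq> 0" using y(3) by (simp add: V_def)
    moreover have "complexify A *v z \<noteq> 0" by (rule complexify_nonzero[OF A(1) z'(1)])
    moreover have "hclass w = hclass (complexify A *v z)"
      using y(2) z' proj_act_complexify[OF A(1) z'(1)] by simp
    ultimately obtain c where "c \<noteq> 0" "complexify A *v z = c *s w"
      using hclass_eq_iff by metis
    then show ?thesis using A y z z' by blast
  qed
  then obtain g z w c where *: "\<And>n. g n \<in> \<Gamma> \<and> g n $ None $ None > real n \<and> norm (z n) = 1 \<and>
      hclass (z n) \<in> K \<and> complexify (g n) *v z n = c n *s w n \<and> c n \<noteq> 0 \<and> w n \<in> V n"
    by metis
  have "filterlim (\<lambda>n. g n $ None $ None) at_top sequentially"
    by (rule filterlim_at_top_mono[OF filterlim_real_sequentially])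
       (use * in \<open>auto intro!: always_eventually less_imp_le\<close>)
  moreover have "w \<longlonglongrightarrow> l"
  proof (rule metric_LIMSEQ_I)
    fix e :: real assume "e > 0"
    then obtain N where N: "1 / real (Suc N) < e" using nat_approx_posE by blast
    have "dist (w n) l < e" if "n \<ge> N" for n
    proof -
      have "dist (w n) l < 1 / real (Suc n)" using *[of n] by (simp add: V_def dist_commute)
      also have "\<dots> \<le> 1 / real (Suc N)" using that by (simp add: frac_le)
      finally show ?thesis using N by simp
    qed
    then show "\<exists>no. \<forall>n\<ge>no. dist (w n) l < e" by blast
  qed
  ultimately show thesis using * l by (intro that[of g z c w l]) auto
qed

text \<open>With the scaling factors kept bounded, \<open>\<langle>g\<^sub>n origin, g\<^sub>n z\<^sub>n\<rangle>\<close> is constant while \<open>g\<^sub>n origin\<close>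
  blows up in a null direction; hence every cluster point is orthogonal to that direction, unless the
  scaling factors degenerate, which forces the limit of the \<open>z\<^sub>n\<close> to be null.\<close>

lemma cluster_point_tangent:
  assumes x: "x \<in> cluster_points (complexify ` \<Gamma>) K" and K: "closed K" "K \<inter> bdry_HR = {}"
  shows "\<exists>l p. l \<noteq> 0 \<and> x = hclass l \<and> p \<in> null_sphere \<and> clorentz p l = 0"
proof -
  obtain g z w c l where g: "\<And>n. g n \<in> \<Gamma>" and lim: "filterlim (\<lambda>n. g n $ None $ None) at_top sequentially"
    and z: "\<And>n. norm (z n) = 1" "\<And>n. hclass (z n) \<in> K"
    and gz: "\<And>n. complexify (g n) *v z n = c n *s w n" and c: "\<And>n. c n \<noteq> 0"
    and w: "w \<longlonglongrightarrow> l" "l \<noteq> 0" "x = hclass l"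
    using cluster_sequence[OF x] by metis
  \<comment> \<open>Scaling by \<open>a n\<close> keeps both \<open>a n\<close> and \<open>d n = a n c n\<close> bounded, whatever \<open>c n\<close> does.\<close>
  define a where "a n = 1 / (1 + cmod (c n))" for n
  define d where "d n = of_real (a n) * c n" for n
  have cp: "1 + cmod (c n) > 0" for n by (smt (verit) norm_ge_zero)
  have a: "a n > 0" "a n \<le> 1" "cmod (d n) = 1 - a n" for n
  proof -
    show "a n > 0" "a n \<le> 1" using cp[of n] by (simp_all add: a_def)
    then have "cmod (d n) = a n * cmod (c n)" by (simp add: d_def norm_mult)
    then show "cmod (d n) = 1 - a n" using cp[of n] by (simp add: a_def field_simps)
  qed
  have "bounded (range (\<lambda>n. (z n, d n)))"
  proof (rule bounded_subset)
    show "bounded (cball 0 1 \<times> cball 0 1 :: ((complex ^ 'm option) \<times> complex) set)"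
      by (intro bounded_Times bounded_cball)
    show "range (\<lambda>n. (z n, d n)) \<subseteq> cball 0 1 \<times> cball 0 1"
      using z(1) a by (auto simp: less_imp_le)
  qed
  then obtain zd r where r: "strict_mono r" "((\<lambda>n. (z n, d n)) \<circ> r) \<longlonglongrightarrow> zd"
    by (rule bounded_seq_convergent_subseq)
  have limr: "filterlim (\<lambda>n. (g \<circ> r) n $ None $ None) at_top sequentially"
    unfolding o_def by (rule filterlim_compose[OF lim filterlim_subseq[OF r(1)]])
  obtain r' p q where r': "strict_mono r'" "attracts (g \<circ> r \<circ> r') p q"
    using exists_attracts[of "g \<circ> r"] g limr by auto
  define s where "s = r \<circ> r'"
  have s: "strict_mono s" unfolding s_def by (rule strict_mono_o[OF r(1) r'(1)])
  have at: "attracts (g \<circ> s) p q" using r'(2) by (simp add: s_def comp_assoc)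
  have zd: "(\<lambda>n. (z (s n), d (s n))) \<longlonglongrightarrow> zd"
    using LIMSEQ_subseq_LIMSEQ[OF r(2) r'(1)] by (simp add: s_def o_def)
  define z0 d0 where "z0 = fst zd" and "d0 = snd zd"
  have z0: "(\<lambda>n. z (s n)) \<longlonglongrightarrow> z0" and d0: "(\<lambda>n. d (s n)) \<longlonglongrightarrow> d0"
    using tendsto_fst[OF zd] tendsto_snd[OF zd] by (simp_all add: z0_def d0_def)
  have ws: "(\<lambda>n. w (s n)) \<longlonglongrightarrow> l" using LIMSEQ_subseq_LIMSEQ[OF w(1) s] by (simp add: o_def)
  have agz: "of_real (a n) *s (complexify (g n) *v z n) = d n *s w n" for n
    by (simp add: gz d_def vector_smult_assoc)
  have nz0: "norm z0 = 1" using tendsto_norm[OF z0] by (simp add: z LIMSEQ_const_iff)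
  then have "z0 \<noteq> 0" by auto
  have z0K: "hclass z0 \<in> K"
  proof (rule ccontr)
    assume "hclass z0 \<notin> K"
    then have "\<forall>\<^sub>F n in sequentially. z (s n) \<noteq> 0 \<and> hclass (z (s n)) \<in> - K"
      using eventually_hclass[OF z0 \<open>z0 \<noteq> 0\<close>, of "- K"] K(1) by (auto simp: open_Compl)
    then show False using z(2) eventually_happens'[OF sequentially_bot] by fastforce
  qed
  show ?thesis
  proof (cases "d0 = 0")
    case True
    have "(\<lambda>n. 1 - cmod (d (s n))) \<longlonglongrightarrow> 1 - cmod d0" by (intro tendsto_intros d0)
    then have as: "(\<lambda>n. a (s n)) \<longlonglongrightarrow> 1" using True by (simp add: a(3))
    have h: "of_real ((a n)\<^sup>2) * herm (z n) (z n) = of_real ((cmod (d n))\<^sup>2) * herm (w n) (w n)" for n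
      using arg_cong[OF agz[of n], of "\<lambda>v. herm v v"] a(1)[of n]
      by (simp add: herm_scale herm_complexify g)
    have q: "of_real ((a n)\<^sup>2) * cquad (z n) = (d n)\<^sup>2 * cquad (w n)" for n
      using arg_cong[OF agz[of n], of cquad] by (simp add: cquad_scale cquad_complexify g)
    have "herm z0 z0 = 0"
    proof (rule LIMSEQ_unique)
      have "(\<lambda>n. of_real ((a (s n))\<^sup>2) * herm (z (s n)) (z (s n))) \<longlonglongrightarrow> of_real (1\<^sup>2) * herm z0 z0"
        by (intro tendsto_intros tendsto_herm as z0)
      then show "(\<lambda>n. of_real ((a (s n))\<^sup>2) * herm (z (s n)) (z (s n))) \<longlonglongrightarrow> herm z0 z0" by simp
      have "(\<lambda>n. of_real ((cmod (d (s n)))\<^sup>2) * herm (w (s n)) (w (s n))) \<longlonglongrightarrow> of_real ((cmod d0)\<^sup>2) * herm l l"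
        by (intro tendsto_intros tendsto_herm d0 ws)
      then show "(\<lambda>n. of_real ((a (s n))\<^sup>2) * herm (z (s n)) (z (s n))) \<longlonglongrightarrow> 0" unfolding h using True by simp
    qed
    moreover have "cquad z0 = 0"
    proof (rule LIMSEQ_unique)
      have "(\<lambda>n. of_real ((a (s n))\<^sup>2) * cquad (z (s n))) \<longlonglongrightarrow> of_real (1\<^sup>2) * cquad z0"
        by (intro tendsto_intros tendsto_cquad as z0)
      then show "(\<lambda>n. of_real ((a (s n))\<^sup>2) * cquad (z (s n))) \<longlonglongrightarrow> cquad z0" by simp
      have "(\<lambda>n. (d (s n))\<^sup>2 * cquad (w (s n))) \<longlonglongrightarrow> d0\<^sup>2 * cquad l"
        by (intro tendsto_intros tendsto_cquad d0 ws)
      then show "(\<lambda>n. of_real ((a (s n))\<^sup>2) * cquad (z (s n))) \<longlonglongrightarrow> 0" unfolding q using True by simp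
    qed
    ultimately obtain u k where "u \<in> null_sphere" "k \<noteq> 0" "z0 = k *s complex_vec u 0"
      using null_complex_vector \<open>z0 \<noteq> 0\<close> by blast
    then have "hclass z0 \<in> bdry_HR"
      using hclass_scale real_null_vector(1) unfolding bdry_HR_null_sphere by blast
    then show ?thesis using K(2) z0K by blast
  next
    case False
    let ?g = "g \<circ> s"
    have t: "(\<lambda>n. (1 / ?g n $ None $ None) *\<^sub>R (?g n *v origin)) \<longlonglongrightarrow> p"
      using attracts_vector[OF at tendsto_const[of origin]] attractsD(3)[OF at] by (simp add: null_sphere_def)
    have "clorentz ((1 / ?g n $ None $ None) *\<^sub>R (?g n *v origin)) (d (s n) *s w (s n))
        = of_real (1 / ?g n $ None $ None) * (of_real (a (s n)) * clorentz origin (z (s n)))" for n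
      by (simp add: agz[symmetric] clorentz_scale clorentz_scaleR clorentz_complexify g)
    moreover have "(\<lambda>n. of_real (1 / ?g n $ None $ None) * (of_real (a (s n)) * clorentz origin (z (s n)))) \<longlonglongrightarrow> of_real 0 * (of_real (1 - cmod d0) * clorentz origin z0)"
    proof (intro tendsto_intros tendsto_clorentz z0)
      show "(\<lambda>n. 1 / ?g n $ None $ None) \<longlonglongrightarrow> 0"
        by (intro tendsto_divide_0[OF tendsto_const] filterlim_at_top_imp_at_infinity attractsD(4)[OF at])
      have "a n = 1 - cmod (d n)" for n by (simp add: a(3))
      then show "(\<lambda>n. a (s n)) \<longlonglongrightarrow> 1 - cmod d0" by (auto intro!: tendsto_intros d0)
    qed
    moreover have "(\<lambda>n. clorentz ((1 / ?g n $ None $ None) *\<^sub>R (?g n *v origin)) (d (s n) *s w (s n)))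
        \<longlonglongrightarrow> clorentz p (d0 *s l)"
      by (intro tendsto_clorentz t tendsto_vector_scalar_mult d0 ws)
    ultimately have "clorentz p (d0 *s l) = 0" using LIMSEQ_unique by fastforce
    then have "clorentz p l = 0" using False by (simp add: clorentz_scale)
    then show ?thesis using w attractsD(2)[OF at] by blast
  qed
qed

text \<open>Both \<open>\<langle>z, z\<rangle>\<close> and the quadratic form vanish along the orbit of a real boundary point, and this
  persists in the limit.\<close>

lemma cluster_point_boundary:
  assumes x: "x \<in> cluster_points (complexify ` \<Gamma>) {y}" and y: "y \<in> bdry_HR"
  shows "\<exists>l p. l \<noteq> 0 \<and> x = hclass l \<and> p \<in> null_sphere \<and> clorentz p l = 0"
proof -
  obtain g z w c l where g: "\<And>n. g n \<in> \<Gamma>"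
    and z: "\<And>n. norm (z n) = 1" "\<And>n. hclass (z n) \<in> {y}"
    and gz: "\<And>n. complexify (g n) *v z n = c n *s w n" and c: "\<And>n. c n \<noteq> 0"
    and w: "w \<longlonglongrightarrow> l" "l \<noteq> 0" "x = hclass l"
    using cluster_sequence[OF x] by metis
  obtain u where u: "u \<in> null_sphere" "y = hclass (complex_vec u 0)"
    using y unfolding bdry_HR_null_sphere by blast
  have "herm (w n) (w n) = 0 \<and> cquad (w n) = 0" for n
  proof -
    have "z n \<noteq> 0" using z(1)[of n] by auto
    then obtain k where "z n = k *s complex_vec u 0"
      using hclass_eq_iff[OF real_null_vector(1)[OF u(1)] \<open>z n \<noteq> 0\<close>] z(2)[of n] u(2) by auto
    then have "herm (z n) (z n) = 0" "cquad (z n) = 0"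
      by (simp_all add: herm_scale cquad_scale real_null_vector[OF u(1)])
    then have "herm (c n *s w n) (c n *s w n) = 0" "cquad (c n *s w n) = 0"
      by (simp_all add: gz[symmetric] herm_complexify cquad_complexify g)
    then show ?thesis using c[of n] by (simp add: herm_scale cquad_scale)
  qed
  then have "herm l l = 0" "cquad l = 0"
    using tendsto_herm[OF w(1)] tendsto_cquad[OF w(1)] by (simp_all add: LIMSEQ_const_iff)
  then obtain p k where "p \<in> null_sphere" "l = k *s complex_vec p 0"
    using null_complex_vector w(2) by blast
  then have "clorentz p l = 0" by (simp add: clorentz_scale real_null_vector)
  then show ?thesis using w \<open>p \<in> null_sphere\<close> by blast
qed

end

section \<open>Vectors tangent to the light cone\<close>

text \<open>The orthogonal projection of the origin to the complement of \<open>X\<close> is timelike, and the dimension bound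
  leaves room for one more vector orthogonal to it and to \<open>X\<close>.\<close>

lemma exists_two_null_orthogonal:
  fixes X :: "(real ^ ('m::finite option)) set"
  assumes X: "finite X" "card X < CARD('m)" and pos: "\<And>x. x \<in> X \<Longrightarrow> lorentz x x > 0"
    and orth: "\<And>x y. x \<in> X \<Longrightarrow> y \<in> X \<Longrightarrow> x \<noteq> y \<Longrightarrow> lorentz x y = 0"
  obtains p q where "p \<in> null_sphere" "q \<in> null_sphere" "p \<noteq> q"
    "\<And>x. x \<in> X \<Longrightarrow> lorentz p x = 0" "\<And>x. x \<in> X \<Longrightarrow> lorentz q x = 0"
proof -
  define t where "t = origin + (\<Sum>x\<in>X. (x $ None / lorentz x x) *\<^sub>R x)"
  have tX: "lorentz t y = 0" if "y \<in> X" for y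
  proof -
    have "(\<Sum>x\<in>X. x $ None / lorentz x x * lorentz x y) = (\<Sum>x\<in>X. if x = y then y $ None else 0)"
      using pos orth that by (intro sum.cong refl) force
    also have "\<dots> = y $ None" using X(1) that by simp
    finally show ?thesis
      by (simp add: t_def lorentz.add_left lorentz.sum_left lorentz.scaleR_left)
  qed
  have "lorentz t t = lorentz t origin + (\<Sum>x\<in>X. x $ None / lorentz x x * lorentz t x)"
    by (subst (2) t_def) (simp add: lorentz.add_right lorentz.sum_right lorentz.scaleR_right)
  also have "\<dots> = lorentz t origin" using tX by simp
  also have "\<dots> = - 1 - (\<Sum>x\<in>X. (x $ None)\<^sup>2 / lorentz x x)"
    by (simp add: t_def power2_eq_square)
  also have "\<dots> < 0"
    using sum_nonneg[of X "\<lambda>x. (x $ None)\<^sup>2 / lorentz x x"] pos by (smt (verit) divide_nonneg_pos zero_le_power2)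
  finally have tt: "lorentz t t < 0" .
  have "card (insert t X) \<le> CARD('m)" using X card_insert_le_m1[of "CARD('m)" X t] by (simp add: card_insert_if)
  then obtain n where n: "n \<noteq> 0" "\<And>x. x \<in> insert t X \<Longrightarrow> lorentz x n = 0"
    using exists_lorentz_orthogonal[of "insert t X"] X(1) by auto
  obtain p q where pq: "p \<in> null_sphere" "q \<in> null_sphere" "p \<noteq> q" "p \<in> span {t, n}" "q \<in> span {t, n}"
    using exists_two_null[OF tt n(1)] n(2) by blast
  have "span {t, n} \<subseteq> {v. lorentz v x = 0}" if "x \<in> X" for x
    using that tX n(2) lorentz_commute[of n x]
    by (intro span_minimal) (auto simp: subspace_def lorentz.zero_left lorentz.add_left lorentz.scaleR_left)
  then show thesis using that pq by blast
qed

lemma exists_two_tangents: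
  fixes z :: "complex ^ ('m::finite option)"
  assumes m: "CARD('m) > 2" and z: "gap z > 0"
  obtains p q where "p \<in> null_sphere" "q \<in> null_sphere" "p \<noteq> q" "clorentz p z = 0" "clorentz q z = 0"
proof -
  obtain c where c: "cmod c = 1" "lorentz (re_vec (c *s z)) (re_vec (c *s z)) = gap z / 2"
    "lorentz (im_vec (c *s z)) (im_vec (c *s z)) = (Re (herm z z) + cmod (cquad z)) / 2"
    "lorentz (re_vec (c *s z)) (im_vec (c *s z)) = 0"
    by (rule exists_phase)
  define x y where "x = re_vec (c *s z)" and "y = im_vec (c *s z)"
  have "Re (herm z z) + cmod (cquad z) > 0" using z by (simp add: gap_def) (smt (verit) norm_ge_zero)
  then have xy: "lorentz x x > 0" "lorentz y y > 0" "lorentz x y = 0"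
    using c z by (simp_all add: x_def y_def)
  have "card {x, y} \<le> 2" by (simp add: card_insert_if)
  then have card: "card {x, y} < CARD('m)" using m by linarith
  have pos: "lorentz v v > 0" if "v \<in> {x, y}" for v using that xy by auto
  have orth: "lorentz v w = 0" if "v \<in> {x, y}" "w \<in> {x, y}" "v \<noteq> w" for v w
    using that xy(3) lorentz_commute[of x y] by auto
  obtain p q where pq: "p \<in> null_sphere" "q \<in> null_sphere" "p \<noteq> q"
    "\<And>v. v \<in> {x, y} \<Longrightarrow> lorentz p v = 0" "\<And>v. v \<in> {x, y} \<Longrightarrow> lorentz q v = 0"
    using exists_two_null_orthogonal[OF _ card pos orth] by blast
  have "clorentz p (c *s z) = 0" "clorentz q (c *s z) = 0"
    using pq by (simp_all add: clorentz_def complex_eq_iff x_def y_def)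
  then have "clorentz p z = 0" "clorentz q z = 0" using c(1) by (auto simp: clorentz_scale)
  then show thesis using that pq by blast
qed

lemma exists_unit_orthogonal:
  fixes u :: "real ^ ('m::finite option)"
  assumes "CARD('m) \<ge> 2"
  obtains s where "lorentz u s = 0" "lorentz s s = 1"
proof -
  have "card {origin, u} \<le> CARD('m)" using assms by (simp add: card_insert_if)
  then obtain n where n: "n \<noteq> 0" "lorentz origin n = 0" "lorentz u n = 0"
    using exists_lorentz_orthogonal[of "{origin, u}"] by auto
  have "lorentz n n > 0" by (rule lorentz_orthogonal_timelike[OF _ n(2,1)]) simp
  then have "lorentz ((1 / sqrt (lorentz n n)) *\<^sub>R n) ((1 / sqrt (lorentz n n)) *\<^sub>R n) = 1"
    by (simp add: lorentz.scaleR_left lorentz.scaleR_right)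
  then show thesis using that[of "(1 / sqrt (lorentz n n)) *\<^sub>R n"] n(3) by (simp add: lorentz.scaleR_right)
qed

text \<open>After a rotation the real part is null and orthogonal to the imaginary part. It provides \<open>u\<close> unless it
  vanishes; then \<open>z\<close> is a multiple of a real spacelike vector, which still has null vectors orthogonal
  to it.\<close>

lemma gap_zero_decomposition:
  fixes z :: "complex ^ ('m::finite option)"
  assumes m: "CARD('m) \<ge> 2" and z: "gap z = 0" "z \<noteq> 0"
  obtains u s a b where "u \<in> null_sphere" "lorentz u s = 0" "lorentz s s = 1"
    "z = a *s complex_vec u 0 + b *s complex_vec s 0"
proof (cases "cquad z = 0")
  case True
  then have "herm z z = 0" using z(1) by (simp add: gap_def herm_self)
  then obtain u k where u: "u \<in> null_sphere" "z = k *s complex_vec u 0"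
    using null_complex_vector True z(2) by blast
  obtain s where "lorentz u s = 0" "lorentz s s = 1" using exists_unit_orthogonal[OF m] by blast
  then show thesis using that[of u s k 0] u by simp
next
  case False
  define N where "N = Re (herm z z)"
  have N: "N = cmod (cquad z)" "N > 0" using z(1) False by (simp_all add: gap_def N_def)
  obtain c where c: "cmod c = 1" "lorentz (re_vec (c *s z)) (re_vec (c *s z)) = 0"
    "lorentz (im_vec (c *s z)) (im_vec (c *s z)) = N"
    "lorentz (re_vec (c *s z)) (im_vec (c *s z)) = 0"
    using exists_phase[of z] z(1) N unfolding N_def by (metis div_0 field_sum_of_halves add_divide_distrib)
  have c0: "c \<noteq> 0" using c(1) by auto
  define x y where "x = re_vec (c *s z)" and "y = im_vec (c *s z)"
  define s where "s = (1 / sqrt N) *\<^sub>R y"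
  have ss: "lorentz s s = 1" and ys: "y = sqrt N *\<^sub>R s"
    using c(3) N by (simp_all add: s_def y_def lorentz.scaleR_left lorentz.scaleR_right)
  have "\<exists>u k. u \<in> null_sphere \<and> lorentz u y = 0 \<and> x = k *\<^sub>R u"
  proof (cases "x = 0")
    case True
    have "lorentz y y > 0" using c(3) N by (simp add: y_def)
    then obtain p where "p \<in> null_sphere" "lorentz p y = 0"
      using exists_two_null_orthogonal[of "{y}"] m by auto
    then show ?thesis using True by (intro exI[of _ p] exI[of _ 0]) simp
  next
    case False
    note n = null_sphere_normalize[of x]
    show ?thesis
      using n False c(2,4) by (intro exI[of _ "(1 / x $ None) *\<^sub>R x"] exI[of _ "x $ None"])
        (simp add: x_def y_def lorentz.scaleR_left)
  qed
  then obtain u k where u: "u \<in> null_sphere" "lorentz u y = 0" "x = k *\<^sub>R u" by blast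
  have us: "lorentz u s = 0" using u(2) by (simp add: s_def lorentz.scaleR_right)
  have "c *s z = of_real k *s complex_vec u 0 + (\<i> * of_real (sqrt N)) *s complex_vec s 0"
  proof -
    have "c *s z = complex_vec x y" by (simp add: x_def y_def)
    also have "\<dots> = of_real k *s complex_vec u 0 + (\<i> * of_real (sqrt N)) *s complex_vec s 0"
      by (rule re_im_vec_eqI) (simp_all add: re_im_vec_scale u(3) ys)
    finally show ?thesis .
  qed
  then have "inverse c *s (c *s z)
      = (inverse c * of_real k) *s complex_vec u 0 + (inverse c * (\<i> * of_real (sqrt N))) *s complex_vec s 0"
    by (simp add: vector_add_ldistrib vector_smult_assoc)
  then have "z = (inverse c * of_real k) *s complex_vec u 0 + (inverse c * (\<i> * of_real (sqrt N))) *s complex_vec s 0"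
    using c0 by (simp add: vector_smult_assoc)
  then show thesis using that[OF u(1) us ss] by blast
qed

lemma tangent_iff_gap:
  fixes z :: "complex ^ ('m::finite option)"
  assumes m: "CARD('m) \<ge> 2" and z: "z \<noteq> 0"
  shows "(\<exists>p\<in>null_sphere. clorentz p z = 0) \<longleftrightarrow> (if CARD('m) = 2 then gap z = 0 else gap z \<ge> 0)"
proof
  assume "\<exists>p\<in>null_sphere. clorentz p z = 0"
  then show "if CARD('m) = 2 then gap z = 0 else gap z \<ge> 0"
    using tangent_gap_zero tangent_gap_nonneg by auto
next
  assume g: "if CARD('m) = 2 then gap z = 0 else gap z \<ge> 0"
  show "\<exists>p\<in>null_sphere. clorentz p z = 0"
  proof (cases "gap z = 0")
    case True
    obtain u s a b where "u \<in> null_sphere" "lorentz u s = 0" "lorentz s s = 1"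
      "z = a *s complex_vec u 0 + b *s complex_vec s 0"
      by (rule gap_zero_decomposition[OF m True z])
    then show ?thesis
      by (intro bexI[of _ u]) (simp_all add: clorentz_add clorentz_scale clorentz_real null_sphere_def)
  next
    case False
    then have "CARD('m) > 2" "gap z > 0" using g m by (auto split: if_splits)
    then obtain p q where "p \<in> null_sphere" "q \<in> null_sphere" "p \<noteq> q" "clorentz p z = 0" "clorentz q z = 0"
      by (rule exists_two_tangents)
    then show ?thesis by blast
  qed
qed

text \<open>The union of the hyperplanes \<open>H\<^sub>p\<close>: since \<open>p\<close> is real, \<open>clorentz p z\<close> is the complex conjugate of
  \<open>\<langle>p, z\<rangle>\<close>.\<close>

definition tangent_union :: "('m::finite option) cproj set"
  where "tangent_union = {hclass z | z. z \<noteq> 0 \<and> (\<exists>p\<in>null_sphere. clorentz p z = 0)}"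

lemma hclass_tangent_union: "z \<noteq> 0 \<Longrightarrow> hclass z \<in> tangent_union \<longleftrightarrow> (\<exists>p\<in>null_sphere. clorentz p z = 0)"
proof
  assume z: "z \<noteq> 0" and "hclass z \<in> tangent_union"
  then obtain w p where w: "w \<noteq> 0" "hclass z = hclass w" "p \<in> null_sphere" "clorentz p w = 0"
    by (auto simp: tangent_union_def)
  then obtain c where "z = c *s w" using hclass_eq_iff[OF w(1) z] by auto
  then show "\<exists>p\<in>null_sphere. clorentz p z = 0" using w by (auto simp: clorentz_scale)
qed (auto simp: tangent_union_def)

lemma continuous_on_gap: "continuous_on S gap"
  unfolding gap_def[abs_def] herm_def cquad_def by (intro continuous_intros)

lemma closed_tangent_union:
  assumes m: "CARD('m::finite) \<ge> 2"
  shows "closed (tangent_union :: ('m option) cproj set)"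
proof -
  let ?C = "{z :: complex ^ ('m option). if CARD('m) = 2 then gap z = 0 else gap z \<ge> 0}"
  have "closed ?C"
    by (cases "CARD('m) = 2") (auto intro!: closed_Collect_eq closed_Collect_le continuous_on_gap continuous_intros)
  then have "open (- {0} - ?C)" by (intro open_Diff) auto
  moreover have "hclass z \<in> - tangent_union \<longleftrightarrow> z \<notin> ?C" if "z \<noteq> 0" for z
    unfolding Compl_iff hclass_tangent_union[OF that] tangent_iff_gap[OF m that] by simp
  then have "{z. z \<noteq> 0 \<and> hclass z \<in> - tangent_union} = - {0} - ?C" by blast
  ultimately show ?thesis by (simp add: closed_def open_cproj_def)
qed

lemma tendsto_hclass: "f \<longlonglongrightarrow> z \<Longrightarrow> z \<noteq> 0 \<Longrightarrow> (\<lambda>n. hclass (f n)) \<longlonglongrightarrow> hclass z"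
  by (rule topological_tendstoI) (auto dest: eventually_hclass elim: eventually_mono)

section \<open>Full limit set\<close>

locale full_limit_set = discrete_lorentz_group \<Gamma>
  for \<Gamma> :: "(real ^ ('m::finite option) ^ ('m option)) set" +
  fixes base :: "('m option) cproj"
  assumes dim: "CARD('m) \<ge> 2"
    and base: "base \<in> HR"
    and full: "limit_set_at \<Gamma> base = bdry_HR"
begin

definition limit_pair where "limit_pair p q \<longleftrightarrow> (\<exists>g. attracts g p q)"

lemma limit_pair_sphere: "limit_pair p q \<Longrightarrow> p \<in> null_sphere" "limit_pair p q \<Longrightarrow> q \<in> null_sphere"
  using attractsD by (auto simp: limit_pair_def)

lemma limit_pair_sym: "limit_pair p q \<Longrightarrow> limit_pair q p"
  using attracts_inverse by (auto simp: limit_pair_def)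

lemma limit_pair_trans: "limit_pair p q \<Longrightarrow> limit_pair p' q' \<Longrightarrow> q \<noteq> p' \<Longrightarrow> limit_pair p q'"
  using attracts_mult by (force simp: limit_pair_def)

lemma boundary_cluster_point: "x \<in> bdry_HR \<Longrightarrow> x \<in> cluster_points (complexify ` \<Gamma>) {base}"
proof -
  assume "x \<in> bdry_HR"
  then have "x \<in> limit_set_at \<Gamma> base" by (simp only: full)
  then have x: "x islimpt {proj_act (complexify A) base | A. A \<in> \<Gamma>}"
    by (simp add: limit_set_at_def)
  have "infinite {A \<in> \<Gamma>. proj_act (complexify A) ` {base} \<inter> U \<noteq> {}}" if U: "open U" "x \<in> U" for U
  proof
    assume fin: "finite {A \<in> \<Gamma>. proj_act (complexify A) ` {base} \<inter> U \<noteq> {}}"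
    have "U \<inter> {proj_act (complexify A) base | A. A \<in> \<Gamma>}
        \<subseteq> (\<lambda>A. proj_act (complexify A) base) ` {A \<in> \<Gamma>. proj_act (complexify A) ` {base} \<inter> U \<noteq> {}}"
      by auto
    then have "finite (U \<inter> {proj_act (complexify A) base | A. A \<in> \<Gamma>})"
      using fin finite_subset by blast
    then show False using x U unfolding islimpt_eq_acc_point by blast
  qed
  then show ?thesis
    unfolding cluster_points_def using infinite_complexify_iff[of "\<lambda>g. proj_act g ` {base} \<inter> U \<noteq> {}" for U]
    by simp
qed

text \<open>A boundary point is the limit of an orbit of a point of hyperbolic space, and such orbits converge to
  attracting points, because a repelling null vector is never orthogonal to a timelike one.\<close>

lemma exists_limit_pair:
  assumes p: "p \<in> null_sphere"
  obtains q where "limit_pair p q"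
proof -
  have "hclass (complex_vec p 0) \<in> bdry_HR" using p by (auto simp: bdry_HR_null_sphere)
  then have cl: "hclass (complex_vec p 0) \<in> cluster_points (complexify ` \<Gamma>) {base}"
    by (rule boundary_cluster_point)
  obtain g z w c l where g: "\<And>n. g n \<in> \<Gamma>" and lim: "filterlim (\<lambda>n. g n $ None $ None) at_top sequentially"
    and z: "\<And>n. norm (z n) = 1" "\<And>n. hclass (z n) \<in> {base}"
    and gz: "\<And>n. complexify (g n) *v z n = c n *s w n" and c: "\<And>n. c n \<noteq> 0"
    and w: "w \<longlonglongrightarrow> l" "l \<noteq> 0" "hclass (complex_vec p 0) = hclass l"
    using cluster_sequence[OF cl] by metis
  obtain x where x: "lorentz x x < 0" "base = hclass (complex_vec x 0)" "complex_vec x 0 \<noteq> 0"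
    using HR_timelike[OF base] by blast
  obtain r p' q' where r: "strict_mono r" "attracts (g \<circ> r) p' q'"
    using exists_attracts[OF g lim] by blast
  note sph = attractsD(2,3)[OF r(2)]
  define k where "k = - lorentz q' x"
  have k: "k \<noteq> 0"
  proof
    assume "k = 0"
    then have "lorentz x q' = 0" by (simp add: k_def lorentz_commute)
    then show False
      using lorentz_orthogonal_timelike[OF x(1)] sph(2) null_sphere_nonzero[OF sph(2)] by (force simp: null_sphere_def)
  qed
  define v where "v n = (1 / (g \<circ> r) n $ None $ None) *\<^sub>R ((g \<circ> r) n *v x)" for n
  have "v \<longlonglongrightarrow> k *\<^sub>R p'"
    unfolding v_def k_def by (rule attracts_vector[OF r(2) tendsto_const])
  then have vlim: "(\<lambda>n. complex_vec (v n) 0) \<longlonglongrightarrow> complex_vec (k *\<^sub>R p') 0"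
    by (intro tendsto_intros)
  have kp: "complex_vec (k *\<^sub>R p') 0 = of_real k *s complex_vec p' 0"
    by (rule re_im_vec_eqI) (simp_all add: re_im_vec_scale)
  have kp0: "complex_vec (k *\<^sub>R p') 0 \<noteq> 0"
    using k real_null_vector(1)[OF sph(1)] by (simp add: kp)
  have veq: "hclass (complex_vec (v n) 0) = hclass (w (r n))" for n
  proof -
    let ?n = "r n"
    have zn: "z ?n \<noteq> 0" using z(1)[of ?n] by auto
    then obtain a where a: "a \<noteq> 0" "complex_vec x 0 = a *s z ?n"
      using hclass_eq_iff[OF zn x(3)] z(2)[of ?n] x(2) by auto
    have pos: "g ?n $ None $ None > 0" by (rule corner_pos[OF g])
    have "complex_vec (v n) 0 = of_real (1 / g ?n $ None $ None) *s (complexify (g ?n) *v complex_vec x 0)"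
      by (rule re_im_vec_eqI) (simp_all add: re_im_vec_scale re_im_vec_complexify v_def)
    also have "\<dots> = (of_real (1 / g ?n $ None $ None) * a * c ?n) *s w ?n"
      by (simp add: a(2) vector_scalar_commute gz vector_smult_assoc mult.assoc)
    finally have eq: "complex_vec (v n) 0 = (of_real (1 / g ?n $ None $ None) * a * c ?n) *s w ?n" .
    have "c ?n *s w ?n \<noteq> 0" using complexify_nonzero[OF g zn] gz by metis
    then have "w ?n \<noteq> 0" by auto
    then show ?thesis unfolding eq using a(1) c pos by (intro hclass_scale) auto
  qed
  have "(\<lambda>n. hclass (w (r n))) \<longlonglongrightarrow> hclass l"
    using LIMSEQ_subseq_LIMSEQ[OF w(1) r(1)] w(2) by (intro tendsto_hclass) (simp_all add: o_def)
  moreover have "(\<lambda>n. hclass (w (r n))) \<longlonglongrightarrow> hclass (complex_vec (k *\<^sub>R p') 0)"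
    using tendsto_hclass[OF vlim kp0] by (simp add: veq)
  ultimately have "hclass (complex_vec p 0) = hclass (complex_vec (k *\<^sub>R p') 0)"
    using LIMSEQ_unique w(3) by metis
  also have "\<dots> = hclass (complex_vec p' 0)"
    unfolding kp using k real_null_vector(1)[OF sph(1)] by (intro hclass_scale) auto
  finally obtain b where b: "complex_vec p' 0 = b *s complex_vec p 0"
    using hclass_eq_iff real_null_vector(1) p sph(1) by metis
  have "Complex 1 0 = b * Complex 1 0"
    using arg_cong[OF b, of "\<lambda>v. v $ None"] p sph(1) by (simp add: complex_vec_def null_sphere_def)
  then have "b = 1" by (auto simp: complex_eq_iff)
  then have "complex_vec p' 0 = complex_vec p 0" using b by simp
  then have "re_vec (complex_vec p' 0) = re_vec (complex_vec p 0)" by (simp only:)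
  then have "p' = p" by simp
  then show thesis using that r(2) by (auto simp: limit_pair_def)
qed

lemma exists_two_other_points:
  obtains p q where "p \<in> null_sphere" "q \<in> null_sphere" "p \<noteq> q" "p \<noteq> r" "q \<noteq> (r :: real ^ ('m option))"
proof -
  obtain i j :: 'm where ij: "i \<noteq> j"
    using dim by (metis UNIV_I card_le_Suc0_iff_eq finite numeral_2_eq_2 not_less_eq_eq)
  define P where "P s i = origin + s *\<^sub>R axis (Some i) 1" for s :: real and i :: 'm
  have comp: "P s i $ None = 1" "P s i $ Some k = (if k = i then s else 0)" for s i k
    by (simp_all add: P_def origin_def axis_def)
  have in_sphere: "P s i \<in> null_sphere" if "s\<^sup>2 = 1" for s i
    using that by (simp add: null_sphere_def comp lorentz_def if_distrib[of "\<lambda>x. x * _"] power2_eq_square cong: if_cong)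
  have "P 1 i $ Some i \<noteq> P (-1) i $ Some i" "P 1 i $ Some i \<noteq> P 1 j $ Some i" "P (-1) i $ Some i \<noteq> P 1 j $ Some i"
    using ij by (simp_all add: comp)
  then have d: "P 1 i \<noteq> P (-1) i" "P 1 i \<noteq> P 1 j" "P (-1) i \<noteq> P 1 j" by metis+
  have s: "P 1 i \<in> null_sphere" "P (-1) i \<in> null_sphere" "P 1 j \<in> null_sphere" by (simp_all add: in_sphere)
  show thesis
    using that[OF s(1,2) d(1)] that[OF s(1,3) d(2)] that[OF s(2,3) d(3)] d by metis
qed

end

subsection \<open>No common fixed point\<close>

locale fixes_null_point = discrete_lorentz_group +
  fixes r
  assumes r: "r \<in> null_sphere" and fix_r: "\<And>A. A \<in> \<Gamma> \<Longrightarrow> A *v r = (A *v r) $ None *\<^sub>R r"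
begin

text \<open>With \<open>r\<close> moved to infinity the group acts on Euclidean space by similarities, and the factor is the
  ratio of the similarity.\<close>

definition factor where "factor A = (A *v r) $ None"

lemma factor: "A \<in> \<Gamma> \<Longrightarrow> A *v r = factor A *\<^sub>R r"
  and factor_pos: "A \<in> \<Gamma> \<Longrightarrow> factor A > 0"
  using fix_r future_null[OF _ r] by (simp_all add: factor_def)

lemma factor_inverse: "A \<in> \<Gamma> \<Longrightarrow> lorentz_adjoint A *v r = (1 / factor A) *\<^sub>R r"
proof -
  assume A: "A \<in> \<Gamma>"
  have "r = factor A *\<^sub>R (lorentz_adjoint A *v r)"
    using inverse_mult_vec(1)[OF A, of r] factor[OF A] by (simp add: matrix_vector_mult_scaleR)
  then have "(1 / factor A) *\<^sub>R r = (1 / factor A) *\<^sub>R (factor A *\<^sub>R (lorentz_adjoint A *v r))"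
    by simp
  then show ?thesis using factor_pos[OF A] by simp
qed

lemma conjugate_in: "A \<in> \<Gamma> \<Longrightarrow> B \<in> \<Gamma> \<Longrightarrow> A ** B ** lorentz_adjoint A \<in> \<Gamma>"
  by (simp add: mult_closed inverse_closed)

lemma conjugate_factor:
  assumes "A \<in> \<Gamma>" "B \<in> \<Gamma>"
  shows "(A ** B ** lorentz_adjoint A) *v r = factor B *\<^sub>R r" "factor (A ** B ** lorentz_adjoint A) = factor B"
proof -
  show *: "(A ** B ** lorentz_adjoint A) *v r = factor B *\<^sub>R r"
    using factor_pos[OF assms(1)]
    by (simp add: matrix_vector_mul_assoc[symmetric] factor_inverse factor assms matrix_vector_mult_scaleR)
  then show "factor (A ** B ** lorentz_adjoint A) = factor B"
    using r by (simp add: factor_def null_sphere_def)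
qed

text \<open>A fixed null direction other than \<open>r\<close> has the inverse of the factor as its eigenvalue, so two of them
  are orthogonal.\<close>

lemma fixed_point_unique:
  assumes A: "A \<in> \<Gamma>" "factor A \<noteq> 1" and s: "s \<in> null_sphere" "s \<noteq> r" "A *v s = c *\<^sub>R s"
    and s': "s' \<in> null_sphere" "s' \<noteq> r" "A *v s' = c' *\<^sub>R s'"
  shows "s = s'"
proof -
  have c: "c * factor A = 1" if "s \<in> null_sphere" "s \<noteq> r" "A *v s = c *\<^sub>R s" for s c
  proof -
    have "lorentz s r = c * (factor A * lorentz s r)"
      using preserves_lorentz[OF A(1), of s r] that(3) factor[OF A(1)]
      by (simp add: lorentz.scaleR_left lorentz.scaleR_right mult.left_commute)
    moreover have "lorentz s r \<noteq> 0" using lorentz_null_sphere_neg[OF that(1) r that(2)] by simp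
    ultimately show ?thesis by simp
  qed
  have f: "factor A > 0" by (rule factor_pos[OF A(1)])
  have cc: "c = 1 / factor A" "c' = 1 / factor A" using c[OF s] c[OF s'] f by (simp_all add: field_simps)
  have "lorentz s s' = c * (c' * lorentz s s')"
    using preserves_lorentz[OF A(1), of s s'] s(3) s'(3)
    by (simp add: lorentz.scaleR_left lorentz.scaleR_right mult.left_commute)
  then have "lorentz s s' * ((factor A)\<^sup>2 - 1) = 0" using f by (simp add: cc field_simps power2_eq_square)
  moreover have "(factor A)\<^sup>2 \<noteq> 1" using A(2) f by (simp add: power2_eq_1_iff)
  ultimately have "lorentz s s' = 0" by simp
  then show ?thesis using lorentz_null_sphere[OF s(1) s'(1)] by simp
qed

lemma attracts_factor:
  assumes g: "attracts g p r" and pr: "p \<noteq> r"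
  shows "(\<lambda>n. factor (g n) * g n $ None $ None) \<longlonglongrightarrow> - 1 / lorentz p r" "(\<lambda>n. factor (g n)) \<longlonglongrightarrow> 0"
proof -
  let ?c = "\<lambda>n. g n $ None $ None"
  have neg: "lorentz p r < 0" using lorentz_null_sphere_neg[OF attractsD(2)[OF g] r pr] .
  have "(\<lambda>n. (1 / ?c n) *\<^sub>R (g n *v origin)) \<longlonglongrightarrow> p"
    using attracts_vector[OF g tendsto_const[of origin]] r by (simp add: null_sphere_def)
  then have lim: "(\<lambda>n. lorentz ((1 / ?c n) *\<^sub>R (g n *v origin)) r) \<longlonglongrightarrow> lorentz p r"
    by (intro lorentz.tendsto tendsto_const)
  have "factor (g n) * ?c n = - 1 / lorentz ((1 / ?c n) *\<^sub>R (g n *v origin)) r" for n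
  proof -
    note gn = attractsD(1)[OF g, of n]
    have "factor (g n) * lorentz (g n *v origin) r = -1"
      using preserves_lorentz[OF gn, of origin r] factor[OF gn] r
      by (simp add: lorentz.scaleR_right null_sphere_def)
    moreover have "lorentz (g n *v origin) r = factor (g n) * lorentz (g n *v origin) r / factor (g n)"
      using factor_pos[OF gn] by simp
    ultimately have "lorentz (g n *v origin) r = - 1 / factor (g n)" by (simp only:)
    then show ?thesis
      using corner_pos[OF gn] factor_pos[OF gn] by (simp add: lorentz.scaleR_left)
  qed
  then show 1: "(\<lambda>n. factor (g n) * ?c n) \<longlonglongrightarrow> - 1 / lorentz p r"
    using neg by (simp only:) (intro tendsto_intros lim, simp)
  have "(\<lambda>n. (factor (g n) * ?c n) * (1 / ?c n)) \<longlonglongrightarrow> (- 1 / lorentz p r) * 0"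
    by (intro tendsto_mult 1 tendsto_divide_0[OF tendsto_const] filterlim_at_top_imp_at_infinity attractsD(4)[OF g])
  moreover have "(factor (g n) * ?c n) * (1 / ?c n) = factor (g n)" for n
    using corner_pos[OF attractsD(1)[OF g, of n]] by simp
  ultimately show "(\<lambda>n. factor (g n)) \<longlonglongrightarrow> 0" by simp
qed

text \<open>Seen from \<open>r\<close> at infinity the \<open>g\<^sub>n\<close> are similarities contracting everything to \<open>p\<close>; so the
  conjugates \<open>g\<^sub>n h g\<^sub>n\<^sup>-\<^sup>1\<close> have a constant scaling factor and move points near \<open>p\<close> very little. They are
  bounded, so by discreteness they take finitely many values, and such a value fixes \<open>p\<close>.\<close>

lemma conjugates_fix_limit:
  assumes g: "attracts g p r" and pr: "p \<noteq> r" and h: "h \<in> \<Gamma>"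
  shows "\<exists>k :: nat \<Rightarrow> nat. strict_mono k \<and>
    (\<forall>n. \<exists>c. (g (k n) ** h ** lorentz_adjoint (g (k n))) *v p = c *\<^sub>R p)"
proof -
  let ?c = "\<lambda>n. g n $ None $ None"
  define B where "B n = g n ** h ** lorentz_adjoint (g n)" for n
  note gG = attractsD(1)[OF g]
  have BG: "B n \<in> \<Gamma>" for n unfolding B_def by (rule conjugate_in[OF gG h])
  define a where "a = - 1 / lorentz p r"
  have neg: "lorentz p r < 0" using lorentz_null_sphere_neg[OF attractsD(2)[OF g] r pr] .
  then have a: "a > 0" by (simp add: a_def divide_neg_neg)
  have scaled: "(\<lambda>n. factor (g n) *\<^sub>R (g n *v v)) \<longlonglongrightarrow> a *\<^sub>R (- lorentz r v *\<^sub>R p)" for v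
  proof -
    have "(\<lambda>n. (factor (g n) * ?c n) *\<^sub>R ((1 / ?c n) *\<^sub>R (g n *v v))) \<longlonglongrightarrow> a *\<^sub>R (- lorentz r v *\<^sub>R p)"
      unfolding a_def by (intro tendsto_scaleR attracts_factor(1)[OF g pr] attracts_vector[OF g tendsto_const])
    moreover have "(factor (g n) * ?c n) *\<^sub>R ((1 / ?c n) *\<^sub>R (g n *v v)) = factor (g n) *\<^sub>R (g n *v v)" for n
      using corner_pos[OF gG[of n]] by simp
    ultimately show ?thesis by (simp only:)
  qed
  \<comment> \<open>The images of the origin, rescaled to converge to a multiple of \<open>p\<close>; adding \<open>r\<close> makes the limit timelike.\<close>
  define y where "y n = factor (g n) *\<^sub>R (g n *v origin)" for n
  have y: "y \<longlonglongrightarrow> a *\<^sub>R p"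
    using scaled[of origin] r by (simp add: y_def[abs_def] null_sphere_def)
  have "B n *v y n = factor (g n) *\<^sub>R (g n *v (h *v origin))" for n
    by (simp add: B_def y_def matrix_vector_mul_assoc[symmetric] matrix_vector_mult_scaleR inverse_mult_vec(1)[OF gG])
  then have By: "(\<lambda>n. B n *v y n) \<longlonglongrightarrow> a *\<^sub>R (- lorentz r (h *v origin) *\<^sub>R p)"
    using scaled[of "h *v origin"] by simp
  have "finite (range B)"
  proof (rule finite_range_of_bounded_timelike[OF BG])
    show "(\<lambda>n. y n + r) \<longlonglongrightarrow> a *\<^sub>R p + r" by (intro tendsto_intros y)
    have "lorentz (a *\<^sub>R p + r) (a *\<^sub>R p + r) = 2 * (a * lorentz p r)"
      using r attractsD(2)[OF g] lorentz_commute[of r p]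
      by (simp add: lorentz.add_left lorentz.add_right lorentz.scaleR_left lorentz.scaleR_right null_sphere_def)
    also have "\<dots> < 0" using a neg by (simp add: mult_pos_neg)
    finally show "lorentz (a *\<^sub>R p + r) (a *\<^sub>R p + r) < 0" .
    have "B n *v (y n + r) = B n *v y n + factor h *\<^sub>R r" for n
      using conjugate_factor(1)[OF gG[of n] h] by (simp add: matrix_vector_right_distrib B_def)
    then show "(\<lambda>n. B n *v (y n + r)) \<longlonglongrightarrow> a *\<^sub>R (- lorentz r (h *v origin) *\<^sub>R p) + factor h *\<^sub>R r"
      by (simp only:) (intro tendsto_intros By)
  qed
  then obtain C where C: "infinite (B -` {C})"
    using inf_img_fin_dom[of B UNIV] by auto
  then obtain k :: "nat \<Rightarrow> nat" where k: "strict_mono k" "\<And>n. k n \<in> B -` {C}"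
    using infinite_enumerate[OF C] by auto
  have "(\<lambda>n. C *v y (k n)) \<longlonglongrightarrow> C *v (a *\<^sub>R p)"
    using LIMSEQ_subseq_LIMSEQ[OF y k(1)] by (intro tendsto_matrix_vector_mult tendsto_const) (simp add: o_def)
  moreover have "(\<lambda>n. C *v y (k n)) \<longlonglongrightarrow> a *\<^sub>R (- lorentz r (h *v origin) *\<^sub>R p)"
    using LIMSEQ_subseq_LIMSEQ[OF By k(1)] k(2) by (simp add: o_def)
  ultimately have "C *v (a *\<^sub>R p) = a *\<^sub>R (- lorentz r (h *v origin) *\<^sub>R p)" by (rule LIMSEQ_unique)
  then have "a *\<^sub>R (C *v p) = a *\<^sub>R (- lorentz r (h *v origin) *\<^sub>R p)" by (simp add: matrix_vector_mult_scaleR)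
  then have "C *v p = - lorentz r (h *v origin) *\<^sub>R p \<or> a = 0" by (simp only: scaleR_cancel_left)
  then have "C *v p = - lorentz r (h *v origin) *\<^sub>R p" using a by blast
  then have "\<exists>c. B (k n) *v p = c *\<^sub>R p" for n using k(2)[of n] by (intro exI[of _ "- lorentz r (h *v origin)"]) simp
  then show ?thesis using k(1) by (intro exI[of _ k]) (simp add: B_def)
qed

text \<open>For \<open>p \<noteq> r\<close> conjugating a contraction in the group by a sequence that attracts to \<open>p\<close> gives an element
  that fixes \<open>p\<close> and has factor different from one. If \<open>h\<close> is such an element for a point \<open>t\<close>, and
  \<open>g\<^sub>n\<close> attracts to \<open>s\<close>, then \<open>g\<^sub>n h g\<^sub>n\<^sup>-\<^sup>1\<close> fixes both \<open>s\<close> and \<open>g\<^sub>n t\<close> for infinitely many \<open>n\<close>, whence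
  \<open>g\<^sub>n t = s\<close>. This holds for two different \<open>t\<close> with the same \<open>g\<^sub>n\<close>, which is absurd.\<close>

lemma no_full_attraction:
  assumes all: "\<And>p. p \<in> null_sphere \<Longrightarrow> p \<noteq> r \<Longrightarrow> \<exists>g. attracts g p r"
    and s: "s \<in> null_sphere" "s \<noteq> r" and s': "s' \<in> null_sphere" "s' \<noteq> r" and ne: "s \<noteq> s'"
  shows False
proof -
  have contr: "\<exists>A c. A \<in> \<Gamma> \<and> factor A \<noteq> 1 \<and> A *v p = c *\<^sub>R p" if p: "p \<in> null_sphere" "p \<noteq> r" for p
  proof -
    obtain g where g: "attracts g p r" using all p by blast
    have "\<forall>\<^sub>F n in sequentially. factor (g n) < 1"
      using order_tendstoD(2)[OF attracts_factor(2)[OF g p(2)]] by simp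
    then obtain N where N: "factor (g N) < 1" using eventually_happens'[OF sequentially_bot] by blast
    note h = attractsD(1)[OF g, of N]
    obtain k :: "nat \<Rightarrow> nat" where k: "strict_mono k"
      "\<And>n. \<exists>c. (g (k n) ** g N ** lorentz_adjoint (g (k n))) *v p = c *\<^sub>R p"
      using conjugates_fix_limit[OF g p(2) h] by blast
    let ?A = "g (k 0) ** g N ** lorentz_adjoint (g (k 0))"
    have "?A \<in> \<Gamma>" "factor ?A \<noteq> 1"
      using conjugate_in[OF attractsD(1)[OF g] h] conjugate_factor(2)[OF attractsD(1)[OF g] h] N by simp_all
    then show ?thesis using k(2)[of 0] by blast
  qed
  have to_s: "\<exists>k :: nat \<Rightarrow> nat. strict_mono k \<and> (\<forall>n. sphere_action (g (k n)) t = s)"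
    if g: "attracts g s r" and t: "t \<in> null_sphere" "t \<noteq> r" for g t
  proof -
    obtain A c where A: "A \<in> \<Gamma>" "factor A \<noteq> 1" "A *v t = c *\<^sub>R t" using contr t by blast
    obtain k :: "nat \<Rightarrow> nat" where k: "strict_mono k"
      "\<And>n. \<exists>c. (g (k n) ** A ** lorentz_adjoint (g (k n))) *v s = c *\<^sub>R s"
      using conjugates_fix_limit[OF g s(2) A(1)] by blast
    have "sphere_action (g (k n)) t = s" for n
    proof -
      let ?g = "g (k n)"
      note gG = attractsD(1)[OF g, of "k n"]
      let ?t = "sphere_action ?g t"
      have tt: "?t \<in> null_sphere" by (rule sphere_action_in[OF gG t(1)])
      have pos: "(?g *v t) $ None > 0" by (rule future_null[OF gG t(1)])
      have "?t \<noteq> r"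
      proof
        assume "?t = r"
        then have "(?g *v t) $ None *\<^sub>R ?t = (?g *v t) $ None *\<^sub>R r" by simp
        then have "?g *v t = (?g *v t) $ None *\<^sub>R r" using pos by (simp add: sphere_action_def)
        then have "t = (?g *v t) $ None *\<^sub>R (lorentz_adjoint ?g *v r)"
          using inverse_mult_vec(1)[OF gG, of t] by (metis matrix_vector_mult_scaleR)
        then have "t = ((?g *v t) $ None * (1 / factor ?g)) *\<^sub>R r" by (simp add: factor_inverse[OF gG])
        then show False using null_sphere_eqI[OF r t(1)] t(2) by blast
      qed
      moreover have "(?g ** A ** lorentz_adjoint ?g) *v ?t = c *\<^sub>R ?t"
        by (simp add: sphere_action_def matrix_vector_mul_assoc[symmetric] matrix_vector_mult_scaleR
            inverse_mult_vec(1)[OF gG] A(3))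
      moreover obtain c' where "(?g ** A ** lorentz_adjoint ?g) *v s = c' *\<^sub>R s" using k(2)[of n] by blast
      moreover have "factor (?g ** A ** lorentz_adjoint ?g) \<noteq> 1"
        using conjugate_factor(2)[OF gG A(1)] A(2) by simp
      ultimately show ?thesis
        using fixed_point_unique[OF conjugate_in[OF gG A(1)] _ tt _ _ s] by blast
    qed
    then show ?thesis using k(1) by blast
  qed
  obtain g where g: "attracts g s r" using all s by blast
  obtain k :: "nat \<Rightarrow> nat" where k: "strict_mono k" "\<And>n. sphere_action (g (k n)) s = s" using to_s[OF g s] by blast
  have gk: "attracts (g \<circ> k) s r" by (rule attracts_subseq[OF g k(1)])
  then obtain l :: "nat \<Rightarrow> nat" where l: "strict_mono l" "\<And>n. sphere_action ((g \<circ> k) (l n)) s' = s" using to_s[OF gk s'] by blast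
  let ?g = "g (k (l 0))"
  note gG = attractsD(1)[OF g, of "k (l 0)"]
  have pos: "(?g *v s) $ None > 0" "(?g *v s') $ None > 0" using future_null[OF gG] s(1) s'(1) by blast+
  have "sphere_action ?g s = sphere_action ?g s'" using k(2) l(2)[of 0] by simp
  then have "(?g *v s') $ None *\<^sub>R ((1 / (?g *v s) $ None) *\<^sub>R (?g *v s)) = (?g *v s') $ None *\<^sub>R ((1 / (?g *v s') $ None) *\<^sub>R (?g *v s'))"
    by (simp add: sphere_action_def)
  then have "?g *v s' = ?g *v (((?g *v s') $ None * (1 / (?g *v s) $ None)) *\<^sub>R s)"
    using pos by (simp add: matrix_vector_mult_scaleR)
  then have "s' = ((?g *v s') $ None * (1 / (?g *v s) $ None)) *\<^sub>R s"
    by (metis inverse_mult_vec(1)[OF gG])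
  then show False using null_sphere_eqI[OF s(1) s'(1)] ne by blast
qed

end

context full_limit_set
begin

text \<open>If \<open>r\<close> occurred in every limit pair, then composing a sequence with a group element, which moves only
  the repelling point, would show that the group fixes \<open>r\<close>.\<close>

lemma exists_limit_pair_avoiding:
  assumes r: "r \<in> null_sphere"
  shows "\<exists>s t. limit_pair s t \<and> s \<noteq> r \<and> t \<noteq> r"
proof (rule ccontr)
  assume "\<not> ?thesis"
  then have H: "s = r \<or> t = r" if "limit_pair s t" for s t using that by blast
  have att: "\<exists>g. attracts g p r" if p: "p \<in> null_sphere" "p \<noteq> r" for p
  proof -
    obtain q where "limit_pair p q" using exists_limit_pair[OF p(1)] by blast
    then show ?thesis using H[of p q] p(2) by (auto simp: limit_pair_def)
  qed
  obtain s s' where s: "s \<in> null_sphere" "s' \<in> null_sphere" "s \<noteq> s'" "s \<noteq> r" "s' \<noteq> r"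
    by (rule exists_two_other_points)
  obtain g where g: "attracts g s r" using att s by blast
  have fix_r: "A *v r = (A *v r) $ None *\<^sub>R r" if A: "A \<in> \<Gamma>" for A
  proof -
    have "attracts (\<lambda>n. g n ** lorentz_adjoint A) s (sphere_action A r)"
      using attracts_mult_right[OF g inverse_closed[OF A]] by simp
    then have "sphere_action A r = r" using H s(4) unfolding limit_pair_def by blast
    then have "(A *v r) $ None *\<^sub>R sphere_action A r = (A *v r) $ None *\<^sub>R r" by simp
    then show ?thesis using future_null[OF A r] by (simp add: sphere_action_def)
  qed
  interpret fixes_null_point \<Gamma> r
    by unfold_locales (fact r, fact fix_r)
  show False
    by (rule no_full_attraction[OF _ s(1,4) s(2,5) s(3)]) (rule att)
qed

text \<open>Pairs compose unless the inner points agree; in that case a pair that avoids the common inner point is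
  inserted.\<close>

lemma limit_pair_all:
  assumes p: "p \<in> null_sphere" and q: "q \<in> null_sphere"
  shows "limit_pair p q"
proof -
  obtain p' where p': "limit_pair p p'" using exists_limit_pair[OF p] by blast
  obtain q' where "limit_pair q q'" using exists_limit_pair[OF q] by blast
  then have q': "limit_pair q' q" by (rule limit_pair_sym)
  show ?thesis
  proof (cases "p' = q'")
    case True
    obtain s t where st: "limit_pair s t" "s \<noteq> p'" "t \<noteq> p'"
      using exists_limit_pair_avoiding[OF limit_pair_sphere(2)[OF p']] by blast
    have "limit_pair p t" using limit_pair_trans[OF p' st(1)] st(2) by blast
    then show ?thesis using limit_pair_trans[OF _ q'] st(3) True by blast
  qed (rule limit_pair_trans[OF p' q'])
qed

section \<open>The Kulkarni limit set\<close>

abbreviation "G \<equiv> complexify ` \<Gamma>"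

lemma closed_kulkarni: "closed (kulkarni_limit_set G)"
  unfolding kulkarni_limit_set_def kulkarni_L0_def kulkarni_L1_def kulkarni_L2_def
  by (intro closed_Un closed_closure)

lemma singleton_cluster_tangent: "x \<in> cluster_points G {y} \<Longrightarrow> x \<in> tangent_union"
proof -
  assume x: "x \<in> cluster_points G {y}"
  have "\<exists>l p. l \<noteq> 0 \<and> x = hclass l \<and> p \<in> null_sphere \<and> clorentz p l = 0"
    using cluster_point_boundary[OF x] cluster_point_tangent[OF x] by (cases "y \<in> bdry_HR") auto
  then show ?thesis by (auto simp: tangent_union_def)
qed

lemma L0_tangent: "kulkarni_L0 G \<subseteq> tangent_union"
  unfolding kulkarni_L0_def
proof (rule closure_minimal[OF _ closed_tangent_union[OF dim]], clarify)
  fix x assume inf: "infinite {g \<in> G. proj_act g x = x}"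
  have "infinite {g \<in> G. proj_act g ` {x} \<inter> U \<noteq> {}}" if "x \<in> U" for U
    by (rule infinite_super[OF _ inf]) (use that in auto)
  then have "x \<in> cluster_points G {x}" by (auto simp: cluster_points_def)
  then show "x \<in> tangent_union" by (rule singleton_cluster_tangent)
qed

lemma L1_tangent: "kulkarni_L1 G \<subseteq> tangent_union"
  unfolding kulkarni_L1_def
  by (rule closure_minimal[OF _ closed_tangent_union[OF dim]]) (auto dest: singleton_cluster_tangent)

lemma base_not_L0: "base \<notin> kulkarni_L0 G"
proof
  assume "base \<in> kulkarni_L0 G"
  then have b: "base \<in> tangent_union" using L0_tangent by blast
  obtain x where x: "lorentz x x < 0" "base = hclass (complex_vec x 0)" "complex_vec x 0 \<noteq> 0"
    using HR_timelike[OF base] by blast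
  have "\<exists>p\<in>null_sphere. clorentz p (complex_vec x 0) = 0"
    using b hclass_tangent_union[OF x(3)] x(2) by simp
  then have "gap (complex_vec x 0) \<ge> 0" using tangent_gap_nonneg by blast
  moreover have "Re (herm (complex_vec x 0) (complex_vec x 0)) < 0"
    using x(1) by (simp add: herm_self lorentz.zero_left)
  ultimately show False by (simp add: gap_def) (smt (verit) norm_ge_zero)
qed

lemma boundary_L1: "bdry_HR \<subseteq> kulkarni_L1 G"
proof
  fix x :: "('m option) cproj" assume "x \<in> bdry_HR"
  then have "x \<in> (\<Union>z \<in> - kulkarni_L0 G. cluster_points G {z})"
    using boundary_cluster_point base_not_L0 by blast
  then show "x \<in> kulkarni_L1 G" unfolding kulkarni_L1_def by (rule subsetD[OF closure_subset])
qed

lemma kulkarni_subset_tangent: "kulkarni_limit_set G \<subseteq> tangent_union"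
proof -
  have "kulkarni_L2 G \<subseteq> tangent_union"
    unfolding kulkarni_L2_def
  proof (rule closure_minimal[OF _ closed_tangent_union[OF dim]], clarify)
    fix x K assume K: "compact K" "K \<subseteq> - (kulkarni_L0 G \<union> kulkarni_L1 G)" and x: "x \<in> cluster_points G K"
    have "K \<inter> bdry_HR = {}" using K(2) boundary_L1 by blast
    then show "x \<in> tangent_union"
      using cluster_point_tangent[OF x compact_imp_closed[OF K(1)]] by (auto simp: tangent_union_def)
  qed
  then show ?thesis using L0_tangent L1_tangent by (simp add: kulkarni_limit_set_def)
qed

lemma complexify_eigenvector:
  "B *v p = d *\<^sub>R p \<Longrightarrow> complexify B *v complex_vec p 0 = of_real d *s complex_vec p 0"
  by (rule re_im_vec_eqI) (simp_all add: re_im_vec_scale re_im_vec_complexify)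

text \<open>Points of the line through \<open>s\<close> and the repelling point are carried to arbitrary points of the line
  through \<open>s\<close> and the attracting point, along powers that almost fix \<open>s\<close>: the component along
  the attracting point is chosen so small that the power restores it.\<close>

lemma loxodromic_transport:
  assumes A: "loxodromic A p q c" and s: "clorentz p s = 0" "clorentz q s = 0"
    and nz: "s + a *s complex_vec p 0 \<noteq> 0" "s + b *s complex_vec q 0 \<noteq> 0"
    and start: "hclass (s + b *s complex_vec q 0) \<notin> kulkarni_L0 G \<union> kulkarni_L1 G"
  shows "hclass (s + a *s complex_vec p 0) \<in> kulkarni_L2 G"
proof -
  note lox = A[unfolded loxodromic_def]
  let ?P = "complex_vec p 0" and ?Q = "complex_vec q 0"
  let ?N = "\<lambda>n. complexify (matrix_power A n)"
  have AG: "matrix_power A n \<in> \<Gamma>" for n using lox matrix_power_in by blast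
  have "lorentz p (re_vec s) = 0" "lorentz q (re_vec s) = 0" "lorentz p (im_vec s) = 0" "lorentz q (im_vec s) = 0"
    using s by (simp_all add: clorentz_def complex_eq_iff)
  then obtain k where k: "\<And>j. k j \<ge> j" "(\<lambda>j. matrix_power A (k j) *v re_vec s) \<longlonglongrightarrow> re_vec s"
    "(\<lambda>j. matrix_power A (k j) *v im_vec s) \<longlonglongrightarrow> im_vec s"
    using loxodromic_recurrent[OF A] by metis
  have sk: "(\<lambda>j. ?N (k j) *v s) \<longlonglongrightarrow> s"
  proof -
    have "?N n *v s = complex_vec (matrix_power A n *v re_vec s) (matrix_power A n *v im_vec s)" for n
      by (rule re_im_vec_eqI) (simp_all add: re_im_vec_complexify)
    then show ?thesis using tendsto_complex_vec[OF k(2,3)] by simp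
  qed
  have eig: "?N n *v ?P = of_real (c ^ n) *s ?P" "?N n *v ?Q = of_real (inverse c ^ n) *s ?Q" for n
    using lox by (auto intro!: complexify_eigenvector matrix_power_eigenvector simp del: of_real_power of_real_inverse)
  have kinf: "filterlim k at_top sequentially"
    by (rule filterlim_at_top_mono[OF filterlim_ident]) (simp add: k(1))
  have "norm (inverse c) < 1" using lox by (simp add: inverse_less_1_iff)
  then have "(\<lambda>n. inverse c ^ n) \<longlonglongrightarrow> 0" by (rule LIMSEQ_power_zero)
  then have e0: "(\<lambda>j. inverse c ^ k j) \<longlonglongrightarrow> 0" by (rule filterlim_compose[OF _ kinf])
  define e where "e j = (of_real (inverse c ^ k j) :: complex)" for j
  have e: "e \<longlonglongrightarrow> 0" unfolding e_def using tendsto_of_real[OF e0, where 'a = complex] by simp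
  have ec: "e j * of_real (c ^ k j) = 1" for j
    using lox by (simp add: e_def power_inverse flip: of_real_mult)
  define u where "u j = (a * e j) *s ?P + s + b *s ?Q" for j
  have u: "u \<longlonglongrightarrow> s + b *s ?Q"
  proof -
    have "u \<longlonglongrightarrow> (a * 0) *s ?P + s + b *s ?Q"
      unfolding u_def[abs_def] by (intro tendsto_intros tendsto_vector_scalar_mult e)
    then show ?thesis by simp
  qed
  have Nu: "(\<lambda>j. ?N (k j) *v u j) \<longlonglongrightarrow> s + a *s ?P"
  proof -
    have "?N (k j) *v u j = a *s ?P + ?N (k j) *v s + (b * e j) *s ?Q" for j
    proof -
      have "?N (k j) *v u j = (a * (e j * of_real (c ^ k j))) *s ?P + ?N (k j) *v s + (b * of_real (inverse c ^ k j)) *s ?Q"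
        by (simp add: u_def matrix_vector_right_distrib vector_scalar_commute eig vector_smult_assoc mult.assoc
            del: of_real_power)
      then show ?thesis unfolding ec by (simp add: e_def)
    qed
    moreover have "(\<lambda>j. a *s ?P + ?N (k j) *v s + (b * e j) *s ?Q) \<longlonglongrightarrow> a *s ?P + s + (b * 0) *s ?Q"
      by (intro tendsto_intros tendsto_vector_scalar_mult e sk)
    ultimately show ?thesis by (simp add: add.commute)
  qed
  let ?O = "{z. z \<noteq> 0 \<and> hclass z \<in> - (kulkarni_L0 G \<union> kulkarni_L1 G)}"
  have "open ?O"
    unfolding kulkarni_L0_def kulkarni_L1_def by (intro open_lift open_Compl closed_Un closed_closure)
  moreover have "s + b *s ?Q \<in> ?O" using nz(2) start by simp
  ultimately obtain d where d: "d > 0" "cball (s + b *s ?Q) d \<subseteq> ?O"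
    by (meson open_contains_cball)
  define K where "K = hclass ` cball (s + b *s ?Q) d"
  have z0: "0 \<notin> cball (s + b *s ?Q) d" using d(2) by blast
  have "compact K"
    unfolding K_def by (intro z0 compact_continuous_image continuous_on_hclass compact_cball)
  moreover have "K \<subseteq> - (kulkarni_L0 G \<union> kulkarni_L1 G)" using d(2) by (auto simp: K_def)
  moreover have "hclass (s + a *s ?P) \<in> cluster_points G K"
    unfolding cluster_points_def
  proof (intro CollectI allI impI, elim conjE)
    fix U assume U: "open U" "hclass (s + a *s ?P) \<in> U"
    have "\<forall>\<^sub>F j in sequentially. u j \<in> ball (s + b *s ?Q) d"
      using topological_tendstoD[OF u open_ball] d(1) by simp
    moreover have "\<forall>\<^sub>F j in sequentially. ?N (k j) *v u j \<noteq> 0 \<and> hclass (?N (k j) *v u j) \<in> U"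
      by (rule eventually_hclass[OF Nu nz(1) U])
    ultimately have "\<forall>\<^sub>F j in sequentially. proj_act (?N (k j)) ` K \<inter> U \<noteq> {}"
    proof eventually_elim
      case (elim j)
      then have uK: "u j \<in> cball (s + b *s ?Q) d" by simp
      then have "u j \<noteq> 0" using z0 by metis
      then have "proj_act (?N (k j)) (hclass (u j)) = hclass (?N (k j) *v u j)"
        by (rule proj_act_complexify[OF AG])
      then show ?case using elim uK unfolding K_def by (metis IntI empty_iff imageI)
    qed
    then obtain J where J: "\<And>j. j \<ge> J \<Longrightarrow> proj_act (?N (k j)) ` K \<inter> U \<noteq> {}"
      by (auto simp: eventually_sequentially)
    have "infinite (k ` {J..})"
      unfolding infinite_nat_iff_unbounded_le
    proof
      fix m show "\<exists>n\<ge>m. n \<in> k ` {J..}"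
        using k(1)[of "max m J"] by (intro exI[of _ "k (max m J)"]) auto
    qed
    then have "infinite (matrix_power A ` k ` {J..})"
      using loxodromic_power_inj[OF A] by (metis finite_imageD inj_on_subset subset_UNIV)
    moreover have "matrix_power A ` k ` {J..} \<subseteq> {B \<in> \<Gamma>. proj_act (complexify B) ` K \<inter> U \<noteq> {}}"
      using AG J by auto
    ultimately have "infinite {B \<in> \<Gamma>. proj_act (complexify B) ` K \<inter> U \<noteq> {}}"
      using finite_subset by blast
    then show "infinite {g \<in> G. proj_act g ` K \<inter> U \<noteq> {}}"
      using infinite_complexify_iff[of "\<lambda>g. proj_act g ` K \<inter> U \<noteq> {}"] by simp
  qed
  ultimately have "hclass (s + a *s ?P)
      \<in> (\<Union>K \<in> {K. compact K \<and> K \<subseteq> - (kulkarni_L0 G \<union> kulkarni_L1 G)}. cluster_points G K)" by blast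
  then show ?thesis unfolding kulkarni_L2_def by (rule subsetD[OF closure_subset])
qed

text \<open>Fixed point pairs of loxodromic elements are dense among the pairs of null directions. If both points
  were outside the closed limit set, then so would be nearby points for a nearby loxodromic element,
  which contradicts \<open>loxodromic_transport\<close>.\<close>

lemma kulkarni_dichotomy:
  assumes pq: "p \<in> null_sphere" "q \<in> null_sphere" "p \<noteq> q"
    and s: "clorentz p s = 0" "clorentz q s = 0"
    and nz: "s + a *s complex_vec p 0 \<noteq> 0" "s + b *s complex_vec q 0 \<noteq> 0"
  shows "hclass (s + a *s complex_vec p 0) \<in> kulkarni_limit_set G \<or>
    hclass (s + b *s complex_vec q 0) \<in> kulkarni_limit_set G"
proof (rule ccontr)
  assume neg: "\<not> ?thesis"
  obtain g where g: "attracts g p q" using limit_pair_all[OF pq(1,2)] by (auto simp: limit_pair_def)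
  define near where "near n A p' q' c \<longleftrightarrow>
    loxodromic A p' q' c \<and> dist p' p < 1 / real (Suc n) \<and> dist q' q < 1 / real (Suc n)" for n A p' q' c
  have "\<exists>A p' q' c. near n A p' q' c" for n
  proof -
    have "1 / real (Suc n) > 0" by simp
    then obtain A p' q' c where "loxodromic A p' q' c" "dist p' p < 1 / real (Suc n)" "dist q' q < 1 / real (Suc n)"
      by (rule exists_loxodromic[OF g pq(3)])
    then show ?thesis unfolding near_def by blast
  qed
  then obtain A P Q c where near: "\<And>n. near n (A n) (P n) (Q n) (c n)" by metis
  have lox: "loxodromic (A n) (P n) (Q n) (c n)"
    and d: "dist (P n) p < inverse (real (Suc n))" "dist (Q n) q < inverse (real (Suc n))" for n
    using near[of n] by (simp_all add: near_def inverse_eq_divide)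
  have lim: "f \<longlonglongrightarrow> l" if "\<And>n. dist (f n) l < inverse (real (Suc n))" for f :: "nat \<Rightarrow> real ^ ('m option)" and l
    unfolding tendsto_dist_iff[of f]
    by (rule tendsto_sandwich[OF _ _ tendsto_const LIMSEQ_inverse_real_of_nat])
       (use that in \<open>auto intro!: always_eventually less_imp_le\<close>)
  have P: "P \<longlonglongrightarrow> p" and Q: "Q \<longlonglongrightarrow> q" by (rule lim, rule d)+
  have sph: "P n \<in> null_sphere" "Q n \<in> null_sphere" "lorentz (P n) (Q n) < 0" for n
    using lox[of n] loxodromic_distinct[OF lox[of n]] lorentz_null_sphere_neg
    by (auto simp: loxodromic_def)
  have lpq: "lorentz p q \<noteq> 0" using lorentz_null_sphere_neg[OF pq] by simp
  define S where "S n = s - (clorentz (Q n) s / of_real (lorentz (P n) (Q n))) *s complex_vec (P n) 0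
      - (clorentz (P n) s / of_real (lorentz (P n) (Q n))) *s complex_vec (Q n) 0" for n
  have "S \<longlonglongrightarrow> s - (clorentz q s / of_real (lorentz p q)) *s complex_vec p 0
      - (clorentz p s / of_real (lorentz p q)) *s complex_vec q 0"
    unfolding S_def[abs_def]
    by (intro tendsto_intros tendsto_vector_scalar_mult tendsto_clorentz lorentz.tendsto P Q) (simp_all add: lpq)
  then have S: "S \<longlonglongrightarrow> s" by (simp add: s)
  have orth: "clorentz (P n) (S n) = 0" "clorentz (Q n) (S n) = 0" for n
    using sph[of n] lorentz_commute[of "Q n" "P n"]
    by (simp_all add: S_def clorentz_diff clorentz_scale clorentz_real null_sphere_def)
  have U: "open (- kulkarni_limit_set G)" using closed_kulkarni by (simp add: open_Compl)
  have "(\<lambda>n. S n + a *s complex_vec (P n) 0) \<longlonglongrightarrow> s + a *s complex_vec p 0"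
    by (intro tendsto_intros tendsto_vector_scalar_mult P S)
  from eventually_hclass[OF this nz(1) U]
  have 1: "\<forall>\<^sub>F n in sequentially. S n + a *s complex_vec (P n) 0 \<noteq> 0 \<and>
      hclass (S n + a *s complex_vec (P n) 0) \<in> - kulkarni_limit_set G" using neg by simp
  have "(\<lambda>n. S n + b *s complex_vec (Q n) 0) \<longlonglongrightarrow> s + b *s complex_vec q 0"
    by (intro tendsto_intros tendsto_vector_scalar_mult Q S)
  from eventually_hclass[OF this nz(2) U]
  have 2: "\<forall>\<^sub>F n in sequentially. S n + b *s complex_vec (Q n) 0 \<noteq> 0 \<and>
      hclass (S n + b *s complex_vec (Q n) 0) \<in> - kulkarni_limit_set G" using neg by simp
  obtain n where n: "S n + a *s complex_vec (P n) 0 \<noteq> 0" "hclass (S n + a *s complex_vec (P n) 0) \<notin> kulkarni_limit_set G"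
    "S n + b *s complex_vec (Q n) 0 \<noteq> 0" "hclass (S n + b *s complex_vec (Q n) 0) \<notin> kulkarni_limit_set G"
    using eventually_happens'[OF sequentially_bot eventually_conj[OF 1 2]] by auto
  have "hclass (S n + a *s complex_vec (P n) 0) \<in> kulkarni_L2 G"
    by (rule loxodromic_transport[OF lox orth n(1,3)]) (use n(4) in \<open>simp add: kulkarni_limit_set_def\<close>)
  then show False using n(2) by (simp add: kulkarni_limit_set_def)
qed

text \<open>Scaling \<open>p\<close>, \<open>q\<close> and the two vectors changes neither hypotheses nor points; this form suits null vectors
  that vary with a parameter.\<close>

lemma kulkarni_dichotomy_scaled:
  assumes pq: "lorentz p p = 0" "lorentz q q = 0" "lorentz p q \<noteq> 0"
    and s: "clorentz p s = 0" "clorentz q s = 0" and k: "k \<noteq> 0" "l \<noteq> 0"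
    and nz: "k *s s + a *s complex_vec p 0 \<noteq> 0" "l *s s + b *s complex_vec q 0 \<noteq> 0"
  shows "hclass (k *s s + a *s complex_vec p 0) \<in> kulkarni_limit_set G \<or>
    hclass (l *s s + b *s complex_vec q 0) \<in> kulkarni_limit_set G"
proof -
  have pq0: "p \<noteq> 0" "q \<noteq> 0" using pq(3) by (auto simp: lorentz.zero_left lorentz.zero_right)
  define p' q' where "p' = (1 / p $ None) *\<^sub>R p" and "q' = (1 / q $ None) *\<^sub>R q"
  note n = null_sphere_normalize[OF pq(1) pq0(1)] null_sphere_normalize[OF pq(2) pq0(2)]
  have p': "p' \<in> null_sphere" "q' \<in> null_sphere" using n by (simp_all add: p'_def q'_def)
  have "lorentz p' q' \<noteq> 0" using pq(3) n by (simp add: p'_def q'_def lorentz.scaleR_left lorentz.scaleR_right)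
  then have ne: "p' \<noteq> q'" using p' by (auto simp: null_sphere_def)
  have s': "clorentz p' s = 0" "clorentz q' s = 0" using s by (simp_all add: p'_def q'_def clorentz_scaleR)
  have vp: "complex_vec p 0 = of_real (p $ None) *s complex_vec p' 0"
    using n by (intro re_im_vec_eqI) (simp_all add: re_im_vec_scale p'_def)
  have vq: "complex_vec q 0 = of_real (q $ None) *s complex_vec q' 0"
    using n by (intro re_im_vec_eqI) (simp_all add: re_im_vec_scale q'_def)
  have ep: "k *s s + a *s complex_vec p 0 = k *s (s + (a * of_real (p $ None) / k) *s complex_vec p' 0)"
    using k by (simp add: vp vector_add_ldistrib vector_smult_assoc)
  have eq: "l *s s + b *s complex_vec q 0 = l *s (s + (b * of_real (q $ None) / l) *s complex_vec q' 0)"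
    using k by (simp add: vq vector_add_ldistrib vector_smult_assoc)
  have nz': "s + (a * of_real (p $ None) / k) *s complex_vec p' 0 \<noteq> 0" "s + (b * of_real (q $ None) / l) *s complex_vec q' 0 \<noteq> 0"
    using nz ep eq by (metis vector_smult_rzero)+
  then show ?thesis
    using kulkarni_dichotomy[OF p' ne s' nz'] unfolding ep eq
    by (simp only: hclass_scale[OF nz'(1) k(1)] hclass_scale[OF nz'(2) k(2)])
qed

lemma positive_gap_in_kulkarni:
  assumes "CARD('m) > 2" and z: "z \<noteq> 0" "gap z > 0"
  shows "hclass z \<in> kulkarni_limit_set G"
proof -
  obtain p q where pq: "p \<in> null_sphere" "q \<in> null_sphere" "p \<noteq> q" "clorentz p z = 0" "clorentz q z = 0"
    by (rule exists_two_tangents[OF assms(1) z(2)])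
  show ?thesis using kulkarni_dichotomy[OF pq, of 0 0] z by simp
qed

text \<open>A degenerate \<open>z = a u + b s\<close> is approached from two sides. Choose \<open>v\<close> null, orthogonal to \<open>s\<close>, with
  \<open>\<langle>u, v\<rangle> = -1\<close>. The vectors \<open>N x = u + x s + (x\<^sup>2/2) v\<close> are null, and \<open>S x = u - (x\<^sup>2/2) v\<close> is
  orthogonal to \<open>N x\<close> and \<open>N (- x)\<close>. The combination \<open>Z x\<close> of \<open>S x\<close> and \<open>N x\<close> is chosen so that its
  coefficients at \<open>u\<close> and \<open>s\<close> are exactly \<open>a\<close> and \<open>b\<close>; then it tends to \<open>z\<close> as \<open>x\<close> tends to zero
  from either side. The dichotomy puts \<open>Z x\<close> or \<open>Z (- x)\<close> into the limit set.\<close>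

lemma zero_gap_in_kulkarni:
  assumes z: "z \<noteq> 0" "gap z = 0"
  shows "hclass z \<in> kulkarni_limit_set G"
proof (rule ccontr)
  assume neg: "hclass z \<notin> kulkarni_limit_set G"
  obtain u s a b where u: "u \<in> null_sphere" "lorentz u s = 0" "lorentz s s = 1"
    and zab: "z = a *s complex_vec u 0 + b *s complex_vec s 0"
    by (rule gap_zero_decomposition[OF dim z(2,1)])
  have su: "lorentz s u = 0" using u(2) by (simp add: lorentz_commute)
  \<comment> \<open>The reflection of \<open>u\<close>, corrected by multiples of \<open>s\<close> and \<open>u\<close>, gives \<open>v\<close>.\<close>
  define w where "w = 2 *\<^sub>R origin - u"
  have w: "lorentz w w = 0" "lorentz u w = -2" "lorentz w u = -2"
    using u(1) by (simp_all add: w_def null_sphere_def lorentz.diff_left lorentz.diff_right lorentz.scaleR_left lorentz.scaleR_right)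
  have sw: "lorentz s w = lorentz w s" by (rule lorentz_commute)
  define h where "h = lorentz w s"
  define v where "v = (1 / 2) *\<^sub>R w - (h / 2) *\<^sub>R s - (h\<^sup>2 / 8) *\<^sub>R u"
  have v: "lorentz v v = 0" "lorentz u v = -1" "lorentz v u = -1" "lorentz s v = 0" "lorentz v s = 0"
    using u w su sw unfolding v_def null_sphere_def
    by (simp_all add: lorentz.diff_left lorentz.diff_right lorentz.add_left lorentz.add_right
        lorentz.scaleR_left lorentz.scaleR_right power2_eq_square algebra_simps flip: h_def)
  define N where "N x = u + x *\<^sub>R s + (x\<^sup>2 / 2) *\<^sub>R v" for x
  define S where "S x = complex_vec (u - (x\<^sup>2 / 2) *\<^sub>R v) 0" for x
  have uu: "lorentz u u = 0" using u(1) by (simp add: null_sphere_def)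
  note forms = lorentz.add_left lorentz.add_right lorentz.diff_left lorentz.diff_right
    lorentz.scaleR_left lorentz.scaleR_right u(2,3) su uu v
  have NN: "lorentz (N x) (N x) = 0" "lorentz (N x) (N (- x)) = - 2 * x\<^sup>2" "clorentz (N x) (S x) = 0"
    "clorentz (N (- x)) (S x) = 0" for x
    by (simp_all add: N_def S_def clorentz_real forms power2_eq_square)
  define Z where "Z x = (a - b / of_real x) *s S x + (b / of_real x) *s complex_vec (N x) 0" for x
  have Zeq: "Z x = z + (b * of_real x - a * of_real (x\<^sup>2 / 2)) *s complex_vec v 0" if "x \<noteq> 0" for x
  proof -
    have S: "S x = complex_vec u 0 - of_real (x\<^sup>2 / 2) *s complex_vec v 0"
      by (rule re_im_vec_eqI) (simp_all add: S_def re_im_vec_scale)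
    have N: "complex_vec (N x) 0 = complex_vec u 0 + of_real x *s complex_vec s 0 + of_real (x\<^sup>2 / 2) *s complex_vec v 0"
      by (rule re_im_vec_eqI) (simp_all add: N_def re_im_vec_scale)
    show ?thesis
      using that unfolding Z_def S N zab vec_eq_iff
      by (simp add: field_simps power2_eq_square)
  qed
  define t where "t n = 1 / real (Suc n)" for n
  have t: "t \<longlonglongrightarrow> 0" "t n \<noteq> 0" for n
    using LIMSEQ_inverse_real_of_nat by (simp_all add: t_def[abs_def] inverse_eq_divide)
  have Zlim: "(\<lambda>n. Z (c * t n)) \<longlonglongrightarrow> z" if "c \<noteq> 0" for c
  proof -
    have "(\<lambda>n. z + (b * of_real (c * t n) - a * of_real ((c * t n)\<^sup>2 / 2)) *s complex_vec v 0)
        \<longlonglongrightarrow> z + (b * of_real (c * 0) - a * of_real ((c * 0)\<^sup>2 / 2)) *s complex_vec v 0"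
      by (intro tendsto_intros tendsto_vector_scalar_mult t) simp
    then show ?thesis using Zeq that t(2) by simp
  qed
  have U: "open (- kulkarni_limit_set G)" using closed_kulkarni by (simp add: open_Compl)
  have ev: "\<forall>\<^sub>F n in sequentially. Z (c * t n) \<noteq> 0 \<and> hclass (Z (c * t n)) \<in> - kulkarni_limit_set G" if "c \<noteq> 0" for c
    by (rule eventually_hclass[OF Zlim[OF that] z(1) U]) (use neg in simp)
  have nzc: "\<forall>\<^sub>F n in sequentially. a - b / of_real (c * t n) \<noteq> 0" if c: "c \<noteq> 0" for c
  proof (cases "b = 0")
    case True
    then have "a \<noteq> 0" using z(1) zab by auto
    then show ?thesis using True by simp
  next
    case False
    have "(\<lambda>n. a * of_real (c * t n) - b) \<longlonglongrightarrow> a * of_real (c * 0) - b"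
      by (intro tendsto_intros t)
    then have "\<forall>\<^sub>F n in sequentially. a * of_real (c * t n) - b \<noteq> 0"
      by (rule tendsto_imp_eventually_ne) (use False in simp)
    then show ?thesis
      by eventually_elim (use c t(2) in \<open>auto simp: field_simps\<close>)
  qed
  obtain n where n: "Z (t n) \<noteq> 0" "hclass (Z (t n)) \<notin> kulkarni_limit_set G"
    "Z (- t n) \<noteq> 0" "hclass (Z (- t n)) \<notin> kulkarni_limit_set G"
    "a - b / of_real (t n) \<noteq> 0" "a - b / of_real (- t n) \<noteq> 0"
    using eventually_happens'[OF sequentially_bot eventually_conj[OF eventually_conj[OF ev[of 1] ev[of "-1"]]
          eventually_conj[OF nzc[of 1] nzc[of "-1"]]]] by auto
  have S: "S (- x) = S x" for x by (simp add: S_def)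
  have "hclass (Z (t n)) \<in> kulkarni_limit_set G \<or> hclass (Z (- t n)) \<in> kulkarni_limit_set G"
    unfolding Z_def S
  proof (rule kulkarni_dichotomy_scaled)
    show "lorentz (N (t n)) (N (- t n)) \<noteq> 0" using NN(2) t(2) by simp
  qed (use n NN in \<open>simp_all add: Z_def S\<close>)
  then show False using n by blast
qed

theorem kulkarni_limit_set_eq: "kulkarni_limit_set G = tangent_union"
proof
  show "tangent_union \<subseteq> kulkarni_limit_set G"
  proof
    fix x :: "('m option) cproj" assume x: "x \<in> tangent_union"
    obtain z where z: "z \<noteq> 0" "x = hclass z" by (rule cproj_cases)
    have "if CARD('m) = 2 then gap z = 0 else gap z \<ge> 0"
      using x z hclass_tangent_union tangent_iff_gap[OF dim] by blast
    then have "gap z = 0 \<or> CARD('m) > 2 \<and> gap z > 0" using dim by (auto split: if_splits)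
    then show "x \<in> kulkarni_limit_set G"
      using zero_gap_in_kulkarni[OF z(1)] positive_gap_in_kulkarni[OF _ z(1)] z(2) by blast
  qed
qed (rule kulkarni_subset_tangent)

end

section \<open>Semi-algebraicity and interior\<close>

lemma real_polynomial_lorentz:
  fixes f g :: "complex ^ 'n::finite \<Rightarrow> real ^ ('m::finite option)"
  assumes "\<And>i. real_polynomial_function (\<lambda>z. f z $ i)" "\<And>i. real_polynomial_function (\<lambda>z. g z $ i)"
  shows "real_polynomial_function (\<lambda>z. lorentz (f z) (g z))"
  unfolding lorentz_def
  by (intro real_polynomial_function_diff real_polynomial_function_sum real_polynomial_function.intros(4) assms) auto

lemma real_polynomial_re_im_vec:
  "real_polynomial_function (\<lambda>z :: complex ^ 'n::finite. re_vec z $ i)"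
  "real_polynomial_function (\<lambda>z :: complex ^ 'n::finite. im_vec z $ i)"
  unfolding re_vec_def im_vec_def vec_lambda_beta
  by (intro real_polynomial_function.intros(1) bounded_linear_compose[OF bounded_linear_Re bounded_linear_vec_nth]
      bounded_linear_compose[OF bounded_linear_Im bounded_linear_vec_nth])+

text \<open>Squaring removes the modulus: \<open>N\<^sup>2 - |Q|\<^sup>2\<close> is a polynomial, and the sign of \<open>N\<close> is polynomial as well.\<close>

lemma semialgebraic_gap:
  "semialgebraic_condition (\<lambda>z :: complex ^ ('m::finite option). gap z = 0)"
  "semialgebraic_condition (\<lambda>z :: complex ^ ('m::finite option). gap z \<ge> 0)"
proof -
  let ?a = "\<lambda>z :: complex ^ ('m option). lorentz (re_vec z) (re_vec z)"
  let ?b = "\<lambda>z :: complex ^ ('m option). lorentz (re_vec z) (im_vec z)"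
  let ?c = "\<lambda>z :: complex ^ ('m option). lorentz (im_vec z) (im_vec z)"
  define N where "N z = ?a z + ?c z" for z
  define D where "D z = (?a z + ?c z) * (?a z + ?c z) - ((?a z - ?c z) * (?a z - ?c z) + 4 * (?b z * ?b z))" for z
  have N: "real_polynomial_function (\<lambda>z. - 1 * N z)"
    unfolding N_def
    by (intro real_polynomial_function.intros(2-4) real_polynomial_lorentz real_polynomial_re_im_vec)
  have D: "real_polynomial_function D" "real_polynomial_function (\<lambda>z. - 1 * D z)"
    unfolding D_def[abs_def]
    by (intro real_polynomial_function_diff real_polynomial_function.intros(2-4) real_polynomial_lorentz real_polynomial_re_im_vec)+
  have "(cmod (cquad z))\<^sup>2 = (?a z - ?c z)\<^sup>2 + (2 * ?b z)\<^sup>2" for z :: "complex ^ ('m option)"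
    by (simp add: cquad_lorentz cmod_power2)
  then have sq: "(N z)\<^sup>2 - (cmod (cquad z))\<^sup>2 = D z" for z
    by (simp add: N_def D_def power2_eq_square)
  have gap: "gap z = N z - cmod (cquad z)" for z by (simp add: gap_def N_def herm_self)
  have 0: "gap z = 0 \<longleftrightarrow> \<not> - 1 * N z > 0 \<and> D z = 0" for z
    using sq[of z] power2_eq_iff_nonneg[of "N z" "cmod (cquad z)"] by (auto simp: gap)
  have 1: "gap z \<ge> 0 \<longleftrightarrow> \<not> - 1 * N z > 0 \<and> \<not> - 1 * D z > 0" for z
    using sq[of z] abs_le_square_iff[of "cmod (cquad z)" "N z"] norm_ge_zero[THEN order_trans, of "cquad z" "N z"] by (auto simp: gap)
  show "semialgebraic_condition (\<lambda>z :: complex ^ ('m option). gap z = 0)"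
    unfolding 0 by (intro semialgebraic_condition.intros N D)
  show "semialgebraic_condition (\<lambda>z :: complex ^ ('m option). gap z \<ge> 0)"
    unfolding 1 by (intro semialgebraic_condition.intros N D)
qed

lemma semialgebraic_tangent_union:
  assumes "CARD('m::finite) \<ge> 2"
  shows "semialgebraic (tangent_union :: ('m option) cproj set)"
  unfolding semialgebraic_def
proof (intro exI conjI allI impI)
  let ?P = "\<lambda>z :: complex ^ ('m option). if CARD('m) = 2 then gap z = 0 else gap z \<ge> 0"
  show "semialgebraic_condition ?P"
    using semialgebraic_gap by (cases "CARD('m) = 2") simp_all
  show "hclass z \<in> tangent_union \<longleftrightarrow> ?P z" if "z \<noteq> 0" for z
    using hclass_tangent_union[OF that] tangent_iff_gap[OF assms that] by (rule trans)
qed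

lemma interior_tangent_union:
  assumes m: "CARD('m::finite) > 2"
  shows "interior (tangent_union :: ('m option) cproj set) \<noteq> {}"
proof -
  let ?V = "{z :: complex ^ ('m option). gap z > 0} - {0}"
  have "open ?V" by (intro open_Diff open_Collect_less continuous_on_gap continuous_intros)
  then have "open (hclass ` ?V)" by (rule open_hclass_image) simp
  moreover have "hclass ` ?V \<subseteq> tangent_union"
  proof
    fix x :: "('m option) cproj" assume "x \<in> hclass ` ?V"
    then obtain z where z: "gap z > 0" "z \<noteq> 0" "x = hclass z" by blast
    have "if CARD('m) = 2 then gap z = 0 else gap z \<ge> 0" using m z by auto
    then show "x \<in> tangent_union"
      using hclass_tangent_union[OF z(2)] tangent_iff_gap[OF _ z(2)] m z(3) by simp
  qed
  moreover have "?V \<noteq> {}"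
  proof -
    obtain i j :: 'm where ij: "i \<noteq> j"
      using m by (metis UNIV_I card_le_Suc0_iff_eq finite less_Suc_eq_le less_imp_le not_less_eq numeral_2_eq_2)
    define x y :: "real ^ ('m option)" where "x = axis (Some i) 1" and "y = axis (Some j) 1"
    have "lorentz x x = 1" "lorentz y y = 1" "lorentz x y = 0"
      using ij by (simp_all add: x_def y_def lorentz_axis coordinate_sign_def) (simp add: axis_def)
    then have g: "gap (complex_vec x y) = 2"
      by (simp add: gap_def herm_self cquad_lorentz Complex_eq_0)
    have "gap (0 :: complex ^ ('m option)) = 0"
      using gap_scale[of 0 "0 :: complex ^ ('m option)"] by simp
    then have "complex_vec x y \<noteq> 0" using g by (metis zero_neq_numeral)
    then have "complex_vec x y \<in> ?V" using g by simp
    then show ?thesis by blast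
  qed
  ultimately show ?thesis by (metis image_is_empty interior_maximal subset_empty)
qed

theorem theorem1p2:
  fixes \<Gamma> :: "(real ^ ('m::finite option) ^ ('m option)) set"
    and p :: "('m option) cproj"
  assumes "CARD('m) \<ge> 2"
    and "subgroup \<Gamma> SO_plus"
    and "discrete \<Gamma>"
    and "p \<in> HR"
    and "limit_set_at \<Gamma> p = bdry_HR"
  shows "semialgebraic (kulkarni_limit_set (complexify ` \<Gamma>)) \<and>
    (CARD('m) > 2 \<longrightarrow> interior (kulkarni_limit_set (complexify ` \<Gamma>)) \<noteq> {})"
proof -
  interpret full_limit_set \<Gamma> p
    by (intro full_limit_set.intro discrete_lorentz_group.intro full_limit_set_axioms.intro assms)
  show ?thesis
    unfolding kulkarni_limit_set_eq
    using semialgebraic_tangent_union[OF assms(1)] interior_tangent_union by blast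
qed

end
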